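(* Let $n\ge 2$, let $F_n$ be the free group with free basis $A=\{a_1,\ldots,a_n\}$, and let either $s=a_1^2a_2^2\cdots a_n^2$, or $n$ be even and $s=[a_1,a_2][a_3,a_4]\cdots[a_{n-1},a_n]$. Then the Cayley graph $\mathrm{Cay}(F_n;A^{\pm1}\cup\{s^{\pm1}\})$ is outerplanar.
   Context: $[x,y]=xyx^{-1}y^{-1}$. For a group $G$ and symmetric $S\subseteq G$, $\mathrm{Cay}(G;S)$ has vertex set $G$, with $x$ adjacent to $y$ iff $x^{-1}y\in S$. For a connected locally finite graph $X$, $|X|$ denotes its Freudenthal compactification (add one point per end to $X$ viewed as a 1-complex), and a hamiltonian circle is a subspace of $|X|$ homeomorphic to $S^1$ containing all vertices. A locally finite connected graph $X$ is outerplanar if there is an embedding of $|X|$ into a closed disk such that some hamiltonian circle of $|X|$ is mapped onto the boundary of the disk. *)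

theory Defs
  imports "HOL-Analysis.Analysis" "HOL-Algebra.Group"
begin

definition list_prod :: "('g, 'm) monoid_scheme \<Rightarrow> 'g list \<Rightarrow> 'g" where
  "list_prod G xs = foldr (\<lambda>x y. x \<otimes>\<^bsub>G\<^esub> y) xs \<one>\<^bsub>G\<^esub>"

definition commutator :: "('g, 'm) monoid_scheme \<Rightarrow> 'g \<Rightarrow> 'g \<Rightarrow> 'g" where
  "commutator G x y = x \<otimes>\<^bsub>G\<^esub> y \<otimes>\<^bsub>G\<^esub> inv\<^bsub>G\<^esub> x \<otimes>\<^bsub>G\<^esub> inv\<^bsub>G\<^esub> y"

text \<open>The letter \<open>(x, True)\<close> stands for \<open>x\<close> and \<open>(x, False)\<close> for its formal inverse.\<close>

definition letter_val :: "('g, 'm) monoid_scheme \<Rightarrow> 'g \<times> bool \<Rightarrow> 'g" where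
  "letter_val G l = (if snd l then fst l else inv\<^bsub>G\<^esub> (fst l))"

definition reduced_word :: "('g \<times> bool) list \<Rightarrow> bool" where
  "reduced_word w \<longleftrightarrow> successively (\<lambda>k l. \<not> (fst k = fst l \<and> snd k \<noteq> snd l)) w"

definition free_basis :: "('g, 'm) monoid_scheme \<Rightarrow> 'g set \<Rightarrow> bool" where
  "free_basis G A \<longleftrightarrow> A \<subseteq> carrier G \<and>
     bij_betw (\<lambda>w. list_prod G (map (letter_val G) w))
       {w \<in> lists (A \<times> UNIV). reduced_word w} (carrier G)"

record 'v ugraph =
  verts :: "'v set"
  edges :: "'v set set"

definition simple_graph :: "'v ugraph \<Rightarrow> bool" where
  "simple_graph X \<longleftrightarrow> (\<forall>e\<in>edges X. e \<subseteq> verts X \<and> card e = 2)"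

definition locally_finite_graph :: "'v ugraph \<Rightarrow> bool" where
  "locally_finite_graph X \<longleftrightarrow> (\<forall>v\<in>verts X. finite {e \<in> edges X. v \<in> e})"

definition connected_graph :: "'v ugraph \<Rightarrow> bool" where
  "connected_graph X \<longleftrightarrow> verts X \<noteq> {} \<and>
     (\<forall>x\<in>verts X. \<forall>y\<in>verts X. (x, y) \<in> {(u, v). {u, v} \<in> edges X}\<^sup>*)"

definition Cay :: "('g, 'm) monoid_scheme \<Rightarrow> 'g set \<Rightarrow> 'g ugraph" where
  "Cay G S = \<lparr>verts = carrier G,
     edges = {{x, y} | x y. x \<in> carrier G \<and> y \<in> carrier G \<and> inv\<^bsub>G\<^esub> x \<otimes>\<^bsub>G\<^esub> y \<in> S}\<rparr>"

text \<open>Points are given by their barycentric coordinates: \<open>edge_point u v t\<close> is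
  \<open>(1 - t) u + t v\<close>.\<close>

definition vertex_point :: "'v \<Rightarrow> 'v \<Rightarrow> real" where
  "vertex_point v = (\<lambda>w. of_bool (w = v))"

definition edge_point :: "'v \<Rightarrow> 'v \<Rightarrow> real \<Rightarrow> 'v \<Rightarrow> real" where
  "edge_point u v t = (\<lambda>w. (1 - t) * vertex_point u w + t * vertex_point v w)"

definition complex_points :: "'v ugraph \<Rightarrow> ('v \<Rightarrow> real) set" where
  "complex_points X = vertex_point ` verts X \<union>
     {edge_point u v t | u v t. {u, v} \<in> edges X \<and> t \<in> {0..1}}"

text \<open>The weak (CW) topology, not the subspace topology of the function space.\<close>

definition complex_open :: "'v ugraph \<Rightarrow> ('v \<Rightarrow> real) set \<Rightarrow> bool" where
  "complex_open X U \<longleftrightarrow> U \<subseteq> complex_points X \<and>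
     (\<forall>u v. {u, v} \<in> edges X \<longrightarrow>
        openin (top_of_set {0..1}) {t \<in> {0..1}. edge_point u v t \<in> U})"

definition one_complex :: "'v ugraph \<Rightarrow> ('v \<Rightarrow> real) topology" where
  "one_complex X = topology (complex_open X)"

lemma istopology_complex_open: "istopology (complex_open X)"
proof -
  have "complex_open X (S \<inter> T)" if "complex_open X S" "complex_open X T" for S T
  proof -
    have "{t \<in> {0..1}. edge_point u v t \<in> S \<inter> T} =
        {t \<in> {0..1}. edge_point u v t \<in> S} \<inter> {t \<in> {0..1}. edge_point u v t \<in> T}" for u v
      by auto
    then show ?thesis
      using that by (auto simp: complex_open_def)
  qed
  moreover have "complex_open X (\<Union>\<K>)" if "\<forall>K\<in>\<K>. complex_open X K" for \<K>
  proof -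
    have "{t \<in> {0..1}. edge_point u v t \<in> \<Union>\<K>} =
        (\<Union>K\<in>\<K>. {t \<in> {0..1}. edge_point u v t \<in> K})" for u v
      by auto
    then show ?thesis
      using that by (auto simp: complex_open_def)
  qed
  ultimately show ?thesis
    by (auto simp: istopology_def)
qed

lemma openin_one_complex: "openin (one_complex X) U \<longleftrightarrow> complex_open X U"
  by (simp add: one_complex_def istopology_complex_open topology_inverse')

lemma topspace_one_complex: "topspace (one_complex X) = complex_points X"
proof
  show "topspace (one_complex X) \<subseteq> complex_points X"
    using openin_topspace[of "one_complex X"] unfolding openin_one_complex complex_open_def by blast
  have "{t \<in> {0..1}. edge_point u v t \<in> complex_points X} = {0..1}" if "{u, v} \<in> edges X" for u v
    using that by (auto simp: complex_points_def)
  then have "complex_open X (complex_points X)"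
    by (auto simp: complex_open_def)
  then show "complex_points X \<subseteq> topspace (one_complex X)"
    by (simp add: openin_one_complex openin_subset)
qed

text \<open>An end chooses, compatibly, a component of the complement of each compact set; this is an
  element of the inverse limit of the component sets of these complements.\<close>

definition ends_of :: "'a topology \<Rightarrow> ('a set \<Rightarrow> 'a set) set" where
  "ends_of T =
     {e \<in> (\<Pi>\<^sub>E K\<in>{K. compactin T K}. connected_components_of (subtopology T (topspace T - K))).
        \<forall>K L. compactin T K \<and> compactin T L \<and> K \<subseteq> L \<longrightarrow> e L \<subseteq> e K}"

text \<open>\<open>Inl\<close> embeds the original space, \<open>Inr\<close> marks the added ends.  A basic neighbourhood of an end
  \<open>e\<close> consists of the component \<open>e K\<close> and all ends living in it.\<close>

definition freudenthal :: "'a topology \<Rightarrow> ('a + ('a set \<Rightarrow> 'a set)) topology" where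
  "freudenthal T = topology_generated_by
     ({Inl ` U | U. openin T U} \<union>
      {Inl ` e K \<union> Inr ` {e' \<in> ends_of T. e' K = e K} | e K. e \<in> ends_of T \<and> compactin T K})"

lemma topspace_freudenthal:
  "topspace (freudenthal T) = Inl ` topspace T \<union> Inr ` ends_of T"
proof -
  have sub: "e K \<subseteq> topspace T" if "e \<in> ends_of T" "compactin T K" for e K
  proof -
    have "e K \<in> connected_components_of (subtopology T (topspace T - K))"
      using that by (auto simp: ends_of_def)
    then show ?thesis
      using connected_components_of_subset by fastforce
  qed
  have "Inr e \<in> topspace (freudenthal T)" if "e \<in> ends_of T" for e
    using that unfolding freudenthal_def topology_generated_by_topspace
    by (intro UnionI[of "Inl ` e {} \<union> Inr ` {e' \<in> ends_of T. e' {} = e {}}"])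
       (use compactin_empty in blast)+
  moreover have "Inl x \<in> topspace (freudenthal T)" if "x \<in> topspace T" for x
    using that unfolding freudenthal_def topology_generated_by_topspace
    by (intro UnionI[of "Inl ` topspace T"]) auto
  moreover have "topspace (freudenthal T) \<subseteq> Inl ` topspace T \<union> Inr ` ends_of T"
    unfolding freudenthal_def topology_generated_by_topspace
    using sub openin_subset by fast
  ultimately show ?thesis
    by blast
qed

abbreviation graph_compactification ::
    "'v ugraph \<Rightarrow> (('v \<Rightarrow> real) + (('v \<Rightarrow> real) set \<Rightarrow> ('v \<Rightarrow> real) set)) topology" where
  "graph_compactification X \<equiv> freudenthal (one_complex X)"

definition hamiltonian_circle ::
    "'v ugraph \<Rightarrow> (('v \<Rightarrow> real) + (('v \<Rightarrow> real) set \<Rightarrow> ('v \<Rightarrow> real) set)) set \<Rightarrow> bool" where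
  "hamiltonian_circle X H \<longleftrightarrow>
     H \<subseteq> topspace (graph_compactification X) \<and>
     subtopology (graph_compactification X) H homeomorphic_space top_of_set (sphere (0::complex) 1) \<and>
     (\<forall>v\<in>verts X. Inl (vertex_point v) \<in> H)"

definition outerplanar :: "'v ugraph \<Rightarrow> bool" where
  "outerplanar X \<longleftrightarrow>
     simple_graph X \<and> locally_finite_graph X \<and> connected_graph X \<and>
     (\<exists>f H. embedding_map (graph_compactification X) (top_of_set (cball (0::complex) 1)) f \<and>
            hamiltonian_circle X H \<and> f ` H = sphere 0 1)"

end

theory Submission
  imports Defs "HOL-Number_Theory.Cong"
begin

text \<open>The free group is the fundamental group of a compact surface with one boundary circle, read as \<open>s\<close>.
  Its universal cover is tiled by polygons with boundary word \<open>s\<close>: every edge labelled by a basis element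
  lies on two polygons, every edge labelled by \<open>s\<close> on one, and the dual graph is a tree. Placing the
  polygons one after the other, starting at the one with vertices \<open>1, \<dots>, s\<close>, amounts to subdividing
  the unit interval: a polygon entered through an edge that occupies an interval cuts this interval into \<open>L\<close> equal
  parts, and the parts belonging to \<open>s\<close>-edges are not subdivided further. Edges that are subdivided are drawn as nested arcs
  above the interval, the others as parts of the interval itself. Infinite sequences of nested intervals
  are the ends, so the interval together with the outermost arc becomes the Hamiltonian circle.\<close>

section \<open>Nested subdivisions of the unit interval\<close>

text \<open>The drawing is built from the types of darts alone, without covering space theory, so
  the main burden is to show that its points are the group elements, each occurring once. The label
  of a point must not depend on the cell used to compute it: the flags at a point (a cell together
  with its end there) form a chain under clockwise rotation, rotation preserves the label, and every
  rank in \<open>{0..M}\<close> occurs exactly once, so locally the drawing is the Cayley graph.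
  Globally, the edges carrying basis letters connect all points, and a shortest path along them
  spells a reduced word; freeness then makes the labels distinct. The constant \<open>L\<close> is
  the length of \<open>s\<close> as a word and also the number of basis letters and their inverses,
  \<open>2 * n\<close> in both cases, because each \<open>a i\<close> occurs twice in
  \<open>s\<close>, up to inversion. Hence the \<open>L\<close> darts along one polygon and their
  mirror images exhaust the \<open>2 * L\<close> darts of basis letters, and one type of polygon
  suffices. Compactness of the Freudenthal compactification, by Koenig's lemma, turns the continuous
  injection into the disk into an embedding.\<close>

text \<open>The head of a word is its last, innermost digit.\<close>

primrec lo :: "nat \<Rightarrow> nat list \<Rightarrow> real" where
  "lo L [] = 0"
| "lo L (j # w) = lo L w + real j / real L ^ Suc (length w)"

definition len :: "nat \<Rightarrow> nat list \<Rightarrow> real" where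
  "len L w = 1 / real L ^ length w"

definition hi :: "nat \<Rightarrow> nat list \<Rightarrow> real" where
  "hi L w = lo L w + len L w"

text \<open>The last two assumptions say that no point lies on infinitely many cells.\<close>

locale cell_tree =
  fixes L :: nat and N :: "nat list set"
  assumes L_ge2: "2 \<le> L"
    and Nil_in_N: "[] \<in> N"
    and N_ConsD: "j # w \<in> N \<Longrightarrow> w \<in> N \<and> j < L"
    and left_chain: "w \<in> N \<Longrightarrow> \<exists>k. replicate k 0 @ w \<notin> N"
    and right_chain: "w \<in> N \<Longrightarrow> \<exists>k. replicate k (L - 1) @ w \<notin> N"
begin

abbreviation "l \<equiv> lo L"
abbreviation "h \<equiv> hi L"

text \<open>\<open>N\<close> holds the cells that are subdivided; the cells of \<open>W\<close>
  outside \<open>N\<close> are the flat ones, drawn as pieces of the axis.\<close>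

definition W :: "nat list set" where
  "W = insert [] {j # w | j w. w \<in> N \<and> j < L}"

lemma N_subset_W: "w \<in> N \<Longrightarrow> w \<in> W"
  using N_ConsD by (cases w) (auto simp: W_def)

lemma Nil_in_W [simp]: "[] \<in> W"
  by (simp add: W_def)

lemma Cons_in_W: "j # w \<in> W \<longleftrightarrow> w \<in> N \<and> j < L"
  by (auto simp: W_def)

lemma append_in_N: "v @ w \<in> N \<Longrightarrow> w \<in> N"
  by (induction v) (auto dest: N_ConsD)

lemma append_in_W: "v @ w \<in> W \<Longrightarrow> v \<noteq> [] \<Longrightarrow> w \<in> N"
  by (cases v) (auto simp: Cons_in_W dest: append_in_N)

lemma append_in_W': "v @ w \<in> W \<Longrightarrow> w \<in> W"
  using append_in_W N_subset_W by (cases "v = []") auto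

lemma len_pos: "0 < len L w"
  using L_ge2 by (simp add: len_def)

lemma len_Cons: "len L (j # w) = len L w / L"
  by (simp add: len_def)

lemma lo_less_hi: "l w < h w"
  using len_pos by (simp add: hi_def)

lemma lo_Nil [simp]: "l [] = 0" and hi_Nil [simp]: "h [] = 1"
  by (simp_all add: hi_def len_def)

lemma lo_Cons: "l (j # w) = l w + j * len L w / L"
  by (simp add: len_def)

declare lo.simps(2) [simp del]

lemma hi_Cons: "h (j # w) = l w + (j + 1) * len L w / L"
  by (simp add: hi_def len_Cons lo_Cons add_divide_distrib distrib_right)

lemma lo_Cons_0 [simp]: "l (0 # w) = l w"
  by (simp add: lo_Cons)

lemma hi_Cons_last: "h ((L - 1) # w) = h w"
  using L_ge2 by (subst hi_Cons) (simp add: hi_def of_nat_diff)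

lemma lo_Cons_Suc: "l (Suc j # w) = h (j # w)"
  by (simp add: hi_Cons lo_Cons add_ac)

lemma lo_le_lo_Cons: "l w \<le> l (j # w)"
  using len_pos[of w] by (simp add: lo_Cons)

lemma hi_Cons_le_hi:
  assumes "j < L" shows "h (j # w) \<le> h w"
proof -
  have "real (Suc j) \<le> real L"
    using assms by (simp only: of_nat_le_iff)
  then have "real (Suc j) * len L w \<le> real L * len L w"
    using len_pos[of w] by (intro mult_right_mono) auto
  then show ?thesis
    using L_ge2 by (subst hi_Cons) (simp add: hi_def divide_le_eq algebra_simps)
qed

lemma lo_Cons_gt: "0 < j \<Longrightarrow> l w < l (j # w)"
  using len_pos[of w] L_ge2 by (simp add: lo_Cons)

lemma hi_Cons_less_hi:
  assumes "j < L - 1" shows "h (j # w) < h w"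
proof -
  have "real (Suc j) < real L"
    using assms by (simp only: of_nat_less_iff)
  then have "real (Suc j) * len L w < real L * len L w"
    using len_pos[of w] by (intro mult_strict_right_mono) auto
  then show ?thesis
    using L_ge2 by (subst hi_Cons) (simp add: hi_def divide_less_eq algebra_simps)
qed

lemma nested:
  "v @ w \<in> W \<Longrightarrow> l w \<le> l (v @ w) \<and> h (v @ w) \<le> h w"
proof (induction v)
  case (Cons j v)
  then have "v @ w \<in> W" "j < L"
    by (auto simp: Cons_in_W N_subset_W)
  then show ?case
    using Cons.IH lo_le_lo_Cons[of "v @ w" j] hi_Cons_le_hi[of j "v @ w"] by auto
qed auto

lemma disjoint_Cons:
  assumes "i \<noteq> j" shows "h (i # w) \<le> l (j # w) \<or> h (j # w) \<le> l (i # w)"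
proof -
  have *: "h (i # w) \<le> l (j # w)" if "i < j" for i j
  proof -
    have "real (Suc i) \<le> real j"
      using that by (simp only: of_nat_le_iff)
    then have "real (Suc i) * len L w / L \<le> real j * len L w / L"
      using len_pos[of w] by (intro divide_right_mono mult_right_mono) auto
    then show ?thesis
      by (simp add: hi_Cons lo_Cons add.commute)
  qed
  then show ?thesis
    using assms by (cases i j rule: linorder_cases) auto
qed

lemma disjoint_same_length:
  "length w = length w' \<Longrightarrow> w \<in> W \<Longrightarrow> w' \<in> W \<Longrightarrow> w \<noteq> w' \<Longrightarrow> h w \<le> l w' \<or> h w' \<le> l w"
proof (induction w w' rule: list_induct2)
  case (Cons i w j w')
  then have W: "w \<in> W" "w' \<in> W" "i < L" "j < L"
    by (auto simp: Cons_in_W N_subset_W)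
  show ?case
  proof (cases "w = w'")
    case True
    then show ?thesis using Cons.prems disjoint_Cons[of i j w] by auto
  next
    case False
    then show ?thesis
      using Cons.IH W lo_le_lo_Cons[of w i] lo_le_lo_Cons[of w' j] hi_Cons_le_hi[of i w] hi_Cons_le_hi[of j w']
      by auto
  qed
qed auto

text \<open>The head is the innermost digit, so \<open>drop\<close> yields the ancestor of
  \<open>w'\<close> at the depth of \<open>w\<close>. Cells of equal depth coincide or do not
  overlap.\<close>

lemma cells_cases:
  assumes "w \<in> W" "w' \<in> W" "length w \<le> length w'"
  obtains v where "w' = v @ w" | "h w \<le> l w'" | "h w' \<le> l w"
proof -
  define u where "u = drop (length w' - length w) w'"
  define v where "v = take (length w' - length w) w'"
  have w': "w' = v @ u"
    by (simp add: u_def v_def)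
  have u: "length u = length w"
    using assms by (simp add: u_def)
  have uW: "u \<in> W"
    using assms(2) append_in_W' w' by auto
  show ?thesis
  proof (cases "u = w")
    case True
    then show ?thesis using w' that(1) by auto
  next
    case False
    then have "h u \<le> l w \<or> h w \<le> l u"
      using disjoint_same_length u uW assms by auto
    then show ?thesis
      using nested[of v u] assms(2) w' that(2,3) by fastforce
  qed
qed

lemma lo_nonneg: "w \<in> W \<Longrightarrow> 0 \<le> l w" and hi_le_1: "w \<in> W \<Longrightarrow> h w \<le> 1"
  using nested[of w "[]"] by auto

text \<open>Equal lengths force equal depth, as the powers of \<open>L\<close> are distinct, and
  different cells of one depth do not overlap.\<close>

lemma cell_eqI:
  assumes "w \<in> W" "w' \<in> W" "l w = l w'" "h w = h w'"
  shows "w = w'"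
proof -
  have len: "len L w = len L w'"
    using assms by (simp add: hi_def)
  then have "length w = length w'"
    using L_ge2 by (simp add: len_def)
  then show ?thesis
    using disjoint_same_length[of w w'] assms lo_less_hi[of w] lo_less_hi[of w'] by auto
qed

lemma lo_append_eq:
  "v @ w \<in> W \<Longrightarrow> l (v @ w) = l w \<Longrightarrow> v = replicate (length v) 0"
proof (induction v)
  case (Cons j v)
  then have "v @ w \<in> W"
    by (auto simp: Cons_in_W N_subset_W)
  then have "l w \<le> l (v @ w)"
    using nested by blast
  then have "j = 0"
    using Cons.prems lo_Cons_gt[of j "v @ w"] by (cases j) auto
  then show ?case
    using Cons \<open>v @ w \<in> W\<close> by auto
qed auto

lemma hi_append_eq:
  "v @ w \<in> W \<Longrightarrow> h (v @ w) = h w \<Longrightarrow> v = replicate (length v) (L - 1)"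
proof (induction v)
  case (Cons j v)
  then have "v @ w \<in> W" "j < L"
    by (auto simp: Cons_in_W N_subset_W)
  then have "h (v @ w) \<le> h w"
    using nested by blast
  then have "j = L - 1"
    using Cons.prems hi_Cons_less_hi[of j "v @ w"] \<open>j < L\<close> by fastforce
  then show ?case
    using Cons \<open>v @ w \<in> W\<close> hi_Cons_last by auto
qed auto

lemma replicate_append_in_N:
  "replicate (k + m) x @ w \<in> N \<Longrightarrow> replicate k x @ w \<in> N"
  using append_in_N[of "replicate m x" "replicate k x @ w"]
  by (metis add.commute append.assoc replicate_add)

lemma finite_replicate_W:
  assumes "replicate k x @ w \<notin> N"
  shows "finite {v @ w | v. v @ w \<in> W \<and> v = replicate (length v) x}"
proof -
  have "{v @ w | v. v @ w \<in> W \<and> v = replicate (length v) x} \<subseteq> (\<lambda>i. replicate i x @ w) ` {..k}"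
  proof clarify
    fix v assume v: "v @ w \<in> W" "v = replicate (length v) x"
    have "length v \<le> k"
    proof (rule ccontr)
      assume "\<not> length v \<le> k"
      then obtain m where m: "length v = Suc (k + m)"
        by (metis less_iff_Suc_add not_le)
      then have "v = x # replicate (k + m) x"
        using v(2) by simp
      then have "replicate (k + m) x @ w \<in> N"
        using v(1) by (simp add: Cons_in_W)
      then show False
        using replicate_append_in_N assms by blast
    qed
    then show "v @ w \<in> (\<lambda>i. replicate i x @ w) ` {..k}"
      using v(2) by (metis atMost_iff image_eqI)
  qed
  then show ?thesis
    using finite_subset by blast
qed

lemma chain_leaves_N:
  "w \<in> W \<Longrightarrow> \<exists>k. replicate k 0 @ w \<notin> N" "w \<in> W \<Longrightarrow> \<exists>k. replicate k (L - 1) @ w \<notin> N"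
  using left_chain[of w] right_chain[of w] by (metis append_Nil replicate_0)+

text \<open>All cells starting at \<open>p\<close> extend the shortest of them by digits 0, and
  \<open>left_chain\<close> bounds how many. This gives local finiteness of the graph, and later
  keeps ends away from the endpoints of cells.\<close>

lemma finite_lo: "finite {w \<in> W. l w = p}"
proof (cases "{w \<in> W. l w = p} = {}")
  case False
  define w0 where "w0 = arg_min length (\<lambda>w. w \<in> W \<and> l w = p)"
  from False have w0: "w0 \<in> W" "l w0 = p" and least: "\<And>w. w \<in> W \<Longrightarrow> l w = p \<Longrightarrow> length w0 \<le> length w"
    using arg_min_nat_lemma[of "\<lambda>w. w \<in> W \<and> l w = p"] unfolding w0_def by auto
  obtain k where k: "replicate k 0 @ w0 \<notin> N"
    using chain_leaves_N w0 by blast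
  have "w \<in> {v @ w0 | v. v @ w0 \<in> W \<and> v = replicate (length v) 0}" if w: "w \<in> W" "l w = p" for w
  proof -
    obtain v where "w = v @ w0"
      using cells_cases[OF w0(1) w(1) least[OF w]] w w0 lo_less_hi[of w] lo_less_hi[of w0] by auto
    then show ?thesis using lo_append_eq[of v w0] w w0 by auto
  qed
  then show ?thesis
    by (intro finite_subset[OF _ finite_replicate_W[OF k]]) auto
next
  case True
  then show ?thesis by (metis finite.emptyI)
qed

lemma finite_hi: "finite {w \<in> W. h w = p}"
proof (cases "{w \<in> W. h w = p} = {}")
  case False
  define w0 where "w0 = arg_min length (\<lambda>w. w \<in> W \<and> h w = p)"
  from False have w0: "w0 \<in> W" "h w0 = p" and least: "\<And>w. w \<in> W \<Longrightarrow> h w = p \<Longrightarrow> length w0 \<le> length w"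
    using arg_min_nat_lemma[of "\<lambda>w. w \<in> W \<and> h w = p"] unfolding w0_def by auto
  obtain k where k: "replicate k (L - 1) @ w0 \<notin> N"
    using chain_leaves_N w0 by blast
  have "w \<in> {v @ w0 | v. v @ w0 \<in> W \<and> v = replicate (length v) (L - 1)}" if w: "w \<in> W" "h w = p" for w
  proof -
    obtain v where "w = v @ w0"
      using cells_cases[OF w0(1) w(1) least[OF w]] w w0 lo_less_hi[of w] lo_less_hi[of w0] by auto
    then show ?thesis using hi_append_eq[of v w0] w w0 by auto
  qed
  then show ?thesis
    by (intro finite_subset[OF _ finite_replicate_W[OF k]]) auto
next
  case True
  then show ?thesis by (metis finite.emptyI)
qed

definition points :: "real set" where
  "points = l ` W \<union> h ` W"

text \<open>The first member of the chain outside \<open>N\<close> is \<open>w\<close> itself or has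
  its parent in \<open>N\<close>; in both cases it is a cell.\<close>

lemma chain_flat:
  assumes "w \<in> W" "replicate k x @ w \<notin> N" "x < L"
  obtains m where "replicate m x @ w \<in> W - N"
proof -
  define m where "m = (LEAST k. replicate k x @ w \<notin> N)"
  have m: "replicate m x @ w \<notin> N"
    unfolding m_def using assms by (intro LeastI)
  have "replicate m x @ w \<in> W"
  proof (cases m)
    case (Suc i)
    then have "replicate i x @ w \<in> N"
      using not_less_Least[of i "\<lambda>k. replicate k x @ w \<notin> N"] unfolding m_def by auto
    then show ?thesis using Suc assms by (simp add: Cons_in_W)
  qed (use assms in auto)
  then show ?thesis using m that by blast
qed

lemma lo_replicate: "l (replicate m 0 @ w) = l w"
  by (induction m) auto

lemma hi_replicate: "h (replicate m (L - 1) @ w) = h w"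
  by (induction m) (use hi_Cons_last in auto)

text \<open>Leftmost children share the left end, rightmost children the right end, and both chains
  stop at a flat cell. So every vertex is an end of an edge drawn on the axis, which
  \<open>draw_on_axis\<close> needs.\<close>

lemma flat_at_point:
  assumes "p \<in> points"
  obtains w where "w \<in> W - N" "p = l w \<or> p = h w"
proof -
  from assms consider w where "w \<in> W" "p = l w" | w where "w \<in> W" "p = h w"
    by (auto simp: points_def)
  then show ?thesis
  proof cases
    case 1
    then obtain m where "replicate m 0 @ w \<in> W - N"
      using chain_leaves_N(1) chain_flat[of w _ 0] L_ge2 by (metis (full_types) less_le_trans pos2)
    then show ?thesis using that[of "replicate m 0 @ w"] 1 lo_replicate by auto
  next
    case 2
    then obtain m where "replicate m (L - 1) @ w \<in> W - N"
      using chain_leaves_N(2) chain_flat[of w _ "L - 1"] L_ge2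
      by (metis One_nat_def diff_less less_le_trans pos2 zero_less_one)
    then show ?thesis using that[of "replicate m (L - 1) @ w"] 2 hi_replicate by auto
  qed
qed

text \<open>The missing case, \<open>w' = v @ w\<close> with \<open>v\<close> nonempty, would put
  \<open>w\<close> into \<open>N\<close>.\<close>

lemma flat_minimal:
  assumes "w \<in> W - N" "w' \<in> W" "w' \<noteq> w"
  shows "(\<exists>v. v \<noteq> [] \<and> w = v @ w') \<or> h w \<le> l w' \<or> h w' \<le> l w"
proof (cases "length w' \<le> length w")
  case True
  then show ?thesis using cells_cases[of w' w] assms by (metis DiffD1 append_Nil)
next
  case False
  then show ?thesis using cells_cases[of w w'] assms append_in_W
    by (metis DiffD1 DiffD2 append_Nil nat_le_linear)
qed

end

section \<open>Drawing a graph over the cells\<close>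

lemma vertex_point_eq_iff [simp]: "vertex_point u = vertex_point v \<longleftrightarrow> u = v"
  by (auto simp: vertex_point_def fun_eq_iff)

lemma edge_point_0 [simp]: "edge_point u v 0 = vertex_point u"
  and edge_point_1 [simp]: "edge_point u v 1 = vertex_point v"
  by (simp_all add: edge_point_def)

lemma edge_point_swap: "edge_point v u t = edge_point u v (1 - t)"
  by (simp add: edge_point_def add.commute)

lemma support_edge_point:
  assumes "u \<noteq> v" "0 < t" "t < 1"
  shows "{w. edge_point u v t w \<noteq> 0} = {u, v}"
  using assms by (auto simp: edge_point_def vertex_point_def)

lemma support_vertex_point: "{w. vertex_point v w \<noteq> 0} = {v}"
  by (auto simp: vertex_point_def)

text \<open>The interface between drawing and group: the drawing uses nothing about \<open>X\<close>
  beyond this identification with the cells, \<open>\<gamma> p\<close> being the vertex placed at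
  \<open>p\<close>.\<close>

locale cell_graph = cell_tree L N for L N +
  fixes X :: "'v ugraph" and \<gamma> :: "real \<Rightarrow> 'v"
  assumes inj_\<gamma>: "inj_on \<gamma> points"
    and verts_X: "verts X = \<gamma> ` points"
    and edges_X: "edges X = (\<lambda>w. {\<gamma> (l w), \<gamma> (h w)}) ` W"
begin

definition epoint :: "nat list \<Rightarrow> real \<Rightarrow> 'v \<Rightarrow> real" where
  "epoint w t = edge_point (\<gamma> (l w)) (\<gamma> (h w)) t"

text \<open>Over a cell in \<open>N\<close> the arc is the graph of \<open>x \<mapsto> (x - lo) (hi - x)\<close>: for nested cells these
  functions are strictly ordered, so arcs do not cross.\<close>

definition curve :: "nat list \<Rightarrow> real \<Rightarrow> complex" where
  "curve w t = Complex (l w + t * len L w) (if w \<in> N then t * (1 - t) * (len L w)\<^sup>2 else 0)"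

lemma lo_in_points: "w \<in> W \<Longrightarrow> l w \<in> points" and hi_in_points: "w \<in> W \<Longrightarrow> h w \<in> points"
  by (auto simp: points_def)

lemma \<gamma>_eq_iff: "p \<in> points \<Longrightarrow> q \<in> points \<Longrightarrow> \<gamma> p = \<gamma> q \<longleftrightarrow> p = q"
  using inj_\<gamma> by (auto simp: inj_on_def)

lemma \<gamma>_lo_neq_hi: "w \<in> W \<Longrightarrow> \<gamma> (l w) \<noteq> \<gamma> (h w)"
  using \<gamma>_eq_iff lo_in_points hi_in_points lo_less_hi by (metis less_irrefl)

lemma epoint_0 [simp]: "epoint w 0 = vertex_point (\<gamma> (l w))"
  and epoint_1 [simp]: "epoint w 1 = vertex_point (\<gamma> (h w))"
  by (simp_all add: epoint_def)

lemma curve_0 [simp]: "curve w 0 = complex_of_real (l w)"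
  and curve_1 [simp]: "curve w 1 = complex_of_real (h w)"
  by (simp_all add: curve_def hi_def complex_eq_iff)

lemma Re_curve: "Re (curve w t) = l w + t * len L w"
  by (simp add: curve_def)

lemma Im_curve: "Im (curve w t) = (if w \<in> N then (Re (curve w t) - l w) * (h w - Re (curve w t)) else 0)"
  by (simp add: curve_def hi_def power2_eq_square algebra_simps)

lemma Re_curve_bounds:
  assumes "t \<in> {0..1}" shows "l w \<le> Re (curve w t)" "Re (curve w t) \<le> h w"
  using assms len_pos[of w] mult_right_mono[of t 1 "len L w"] by (auto simp: Re_curve hi_def)

lemma Re_curve_strict:
  assumes "0 < t" "t < 1" shows "l w < Re (curve w t)" "Re (curve w t) < h w"
  using assms len_pos[of w] mult_strict_right_mono[of t 1 "len L w"] by (auto simp: Re_curve hi_def)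

lemma Im_curve_nonneg: "t \<in> {0..1} \<Longrightarrow> 0 \<le> Im (curve w t)"
  using Re_curve_bounds[of t w] by (simp add: Im_curve)

lemma Re_curve_inj: "Re (curve w t) = Re (curve w t') \<Longrightarrow> t = t'"
  using len_pos[of w] by (simp add: Re_curve)

text \<open>The factors \<open>x - lo\<close> and \<open>hi - x\<close> do not grow when passing to
  the inner cell, and one of them drops because different cells differ in an end. If
  \<open>x\<close> is an end of the inner cell, the inner height is 0 and the outer one
  positive.\<close>

lemma nested_height:
  assumes "v @ w \<in> W" "v \<noteq> []" "0 < t" "t < 1" "t' \<in> {0..1}"
    and x: "Re (curve w t) = Re (curve (v @ w) t')"
  shows "Im (curve (v @ w) t') < Im (curve w t)"
proof -
  let ?x = "Re (curve w t)"
  have w: "w \<in> N" "w \<in> W"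
    using assms append_in_W N_subset_W by auto
  have 1: "l w < ?x" "?x < h w"
    using Re_curve_strict[of t w] assms by simp_all
  have 2: "l (v @ w) \<le> ?x" "?x \<le> h (v @ w)"
    using Re_curve_bounds[OF assms(5), of "v @ w"] x by auto
  have 3: "l w \<le> l (v @ w)" "h (v @ w) \<le> h w"
    using nested assms by auto
  have 4: "\<not> (l w = l (v @ w) \<and> h (v @ w) = h w)"
    using cell_eqI[of w "v @ w"] w assms by auto
  have "(?x - l (v @ w)) * (h (v @ w) - ?x) < (?x - l w) * (h w - ?x)"
  proof (cases "l (v @ w) = ?x \<or> h (v @ w) = ?x")
    case True
    then show ?thesis using 1 by auto
  next
    case False
    show ?thesis
    proof (cases "l w = l (v @ w)")
      case True
      then show ?thesis using False 1 2 3 4 by (intro mult_le_less_imp_less) auto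
    next
      case F: False
      then show ?thesis using False 1 2 3 4 by (intro mult_less_le_imp_less) auto
    qed
  qed
  moreover have "0 < (?x - l w) * (h w - ?x)"
    using 1 by simp
  ultimately show ?thesis
    using w x by (simp add: Im_curve)
qed

text \<open>Nested cells are separated by their heights, other cells by their real parts.\<close>

lemma curve_interior:
  assumes "w \<in> W" "w' \<in> W" "0 < t" "t < 1" "t' \<in> {0..1}" "curve w t = curve w' t'"
  shows "w' = w \<and> t' = t"
proof (cases "w = w'")
  case True
  then show ?thesis using Re_curve_inj assms by metis
next
  case False
  have b: "l w < Re (curve w t)" "Re (curve w t) < h w"
    using Re_curve_strict[of t w] assms by simp_all
  have b': "l w' \<le> Re (curve w t)" "Re (curve w t) \<le> h w'"
    using Re_curve_bounds[of t' w'] assms by auto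
  consider v where "w' = v @ w" | v where "w = v @ w'" | "h w \<le> l w'" | "h w' \<le> l w"
    using cells_cases[of w w'] cells_cases[of w' w] assms by (metis nat_le_linear)
  then show ?thesis
  proof cases
    case 1
    then show ?thesis using nested_height[of v w t t'] assms False by auto
  next
    case 2
    then have "l w' \<le> l w" "h w \<le> h w'"
      using nested[of v w'] assms by auto
    \<comment> \<open>The ends of the outer cell \<open>w'\<close> lie outside the open interval of
      \<open>w\<close>, so \<open>nested_height\<close> applies with the roles exchanged.\<close>
    then have "t' \<noteq> 0" "t' \<noteq> 1"
      using assms(6) b by auto
    then show ?thesis using 2 nested_height[of v w' t' t] assms False by auto
  qed (use b b' in auto)
qed

text \<open>The support of the barycentric coordinates is the pair of ends of the edge; by
  injectivity of \<open>\<gamma>\<close> it gives back the ends of the cell, hence the cell.\<close>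

lemma epoint_interior:
  assumes "w \<in> W" "w' \<in> W" "0 < t" "t < 1" "t' \<in> {0..1}" "epoint w t = epoint w' t'"
  shows "w' = w \<and> t' = t"
proof -
  have supp: "{v. epoint w t v \<noteq> 0} = {\<gamma> (l w), \<gamma> (h w)}"
    unfolding epoint_def using support_edge_point \<gamma>_lo_neq_hi assms by metis
  have "t' \<noteq> 0" "t' \<noteq> 1"
    using supp \<gamma>_lo_neq_hi[of w] assms(1) unfolding assms(6) by (auto simp: support_vertex_point)
  then have "{\<gamma> (l w), \<gamma> (h w)} = {\<gamma> (l w'), \<gamma> (h w')}"
    using supp support_edge_point[of "\<gamma> (l w')" "\<gamma> (h w')" t'] \<gamma>_lo_neq_hi[of w'] assms
    by (auto simp: epoint_def)
  then have "(l w = l w' \<and> h w = h w') \<or> (l w = h w' \<and> h w = l w')"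
    using assms \<gamma>_eq_iff lo_in_points hi_in_points by (auto simp: doubleton_eq_iff)
  then have "w' = w"
    using lo_less_hi[of w] lo_less_hi[of w'] cell_eqI[of w w'] assms by auto
  moreover have "epoint w s (\<gamma> (h w)) = s" for s
    using \<gamma>_lo_neq_hi[OF assms(1)] by (auto simp: epoint_def edge_point_def vertex_point_def)
  ultimately show ?thesis
    using assms(6) by metis
qed

text \<open>Read from right to left this makes \<open>draw\<close> well defined, from left to right
  it makes \<open>draw\<close> injective.\<close>

lemma curve_eq_iff:
  assumes "w \<in> W" "w' \<in> W" "t \<in> {0..1}" "t' \<in> {0..1}"
  shows "curve w t = curve w' t' \<longleftrightarrow> epoint w t = epoint w' t'"
proof (cases "(0 < t \<and> t < 1) \<or> (0 < t' \<and> t' < 1)")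
  case True
  then show ?thesis
    using curve_interior[of w w' t t'] curve_interior[of w' w t' t]
      epoint_interior[of w w' t t'] epoint_interior[of w' w t' t] assms by metis
next
  case False
  then have "t = 0 \<or> t = 1" "t' = 0 \<or> t' = 1"
    using assms by auto
  then show ?thesis
    using \<gamma>_eq_iff lo_in_points hi_in_points assms by auto
qed

definition draw :: "('v \<Rightarrow> real) \<Rightarrow> complex" where
  "draw x = (SOME z. \<exists>w\<in>W. \<exists>t\<in>{0..1}. x = epoint w t \<and> z = curve w t)"

lemma draw_epoint:
  assumes "w \<in> W" "t \<in> {0..1}" shows "draw (epoint w t) = curve w t"
proof -
  have "\<exists>z. \<exists>w'\<in>W. \<exists>t'\<in>{0..1}. epoint w t = epoint w' t' \<and> z = curve w' t'"
    using assms by blast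
  from someI_ex[OF this] show ?thesis
    unfolding draw_def[symmetric] using curve_eq_iff assms by metis
qed

definition seg :: "nat list \<Rightarrow> ('v \<Rightarrow> real) set" where
  "seg w = epoint w ` {0..1}"

lemma complex_points_eq: "complex_points X = (\<Union>w\<in>W. seg w)"
proof
  have "vertex_point (\<gamma> p) \<in> (\<Union>w\<in>W. seg w)" if "p \<in> points" for p
  proof -
    from that obtain w where "w \<in> W" "p = l w \<or> p = h w"
      by (auto simp: points_def)
    then have "vertex_point (\<gamma> p) \<in> seg w"
      using epoint_0[of w] epoint_1[of w] unfolding seg_def
      by (metis atLeastAtMost_iff image_eqI order_refl zero_le_one)
    then show ?thesis using \<open>w \<in> W\<close> by auto
  qed
  moreover have "edge_point u v t \<in> (\<Union>w\<in>W. seg w)" if "{u, v} \<in> edges X" "t \<in> {0..1}" for u v t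
  proof -
    from that obtain w where w: "w \<in> W" "{u, v} = {\<gamma> (l w), \<gamma> (h w)}"
      by (auto simp: edges_X)
    then have "edge_point u v t = epoint w t \<or> edge_point u v t = epoint w (1 - t)"
      using edge_point_swap[of u v t] by (auto simp: doubleton_eq_iff epoint_def)
    then have "edge_point u v t \<in> seg w"
      using that(2) by (auto simp: seg_def)
    then show ?thesis using w by blast
  qed
  ultimately show "complex_points X \<subseteq> (\<Union>w\<in>W. seg w)"
    unfolding complex_points_def verts_X by blast
  show "(\<Union>w\<in>W. seg w) \<subseteq> complex_points X"
    unfolding complex_points_def edges_X seg_def epoint_def by blast
qed

lemma pointE:
  assumes "x \<in> complex_points X"
  obtains w t where "w \<in> W" "t \<in> {0..1}" "x = epoint w t"
  using assms by (auto simp: complex_points_eq seg_def)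

lemma epoint_in: "w \<in> W \<Longrightarrow> t \<in> {0..1} \<Longrightarrow> epoint w t \<in> complex_points X"
  by (force simp: complex_points_eq seg_def)

lemma inj_draw: "inj_on draw (complex_points X)"
proof (rule inj_onI)
  fix x y assume "x \<in> complex_points X" "y \<in> complex_points X" and eq: "draw x = draw y"
  then obtain w t w' t' where *: "w \<in> W" "t \<in> {0..1}" "x = epoint w t" "w' \<in> W" "t' \<in> {0..1}" "y = epoint w' t'"
    by (meson pointE)
  then have "curve w t = curve w' t'"
    using eq draw_epoint by simp
  then show "x = y"
    using * curve_eq_iff by simp
qed

abbreviation "T \<equiv> one_complex X"

text \<open>One parametrisation per cell is enough, because reversing an edge is the homeomorphism
  \<open>t \<mapsto> 1 - t\<close> of the unit interval.\<close>

lemma openin_T: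
  "openin T U \<longleftrightarrow> U \<subseteq> complex_points X \<and>
     (\<forall>w\<in>W. openin (top_of_set {0..1}) {t \<in> {0..1}. epoint w t \<in> U})" (is "_ \<longleftrightarrow> ?R")
proof
  assume "openin T U"
  then show ?R
    unfolding openin_one_complex complex_open_def epoint_def edges_X by blast
next
  assume R: ?R
  have "openin (top_of_set {0..1}) {t \<in> {0..1}. edge_point u v t \<in> U}" if uv: "{u, v} \<in> edges X" for u v
  proof -
    from uv obtain w where w: "w \<in> W" "{u, v} = {\<gamma> (l w), \<gamma> (h w)}"
      by (auto simp: edges_X)
    let ?S = "{t \<in> {0..1}. epoint w t \<in> U}"
    have S: "openin (top_of_set {0..1}) ?S"
      using R w by blast
    from w consider "u = \<gamma> (l w)" "v = \<gamma> (h w)" | "v = \<gamma> (l w)" "u = \<gamma> (h w)"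
      by (auto simp: doubleton_eq_iff)
    then show ?thesis
    proof cases
      case 1
      then show ?thesis using S by (simp add: epoint_def)
    next
      case 2
      have "continuous_on {0..1::real} (\<lambda>t. 1 - t)"
        by (intro continuous_intros)
      then have "openin (top_of_set {0..1}) ({0..1} \<inter> (\<lambda>t. 1 - t) -` ?S)"
        by (rule continuous_openin_preimage[OF _ _ S]) auto
      moreover have "{0..1} \<inter> (\<lambda>t. 1 - t) -` ?S = {t \<in> {0..1}. edge_point u v t \<in> U}"
        using 2 edge_point_swap[of u v] by (auto simp: epoint_def)
      ultimately show ?thesis by simp
    qed
  qed
  then show "openin T U"
    using R by (simp add: openin_one_complex complex_open_def)
qed

lemma continuous_epoint: "w \<in> W \<Longrightarrow> continuous_map (top_of_set {0..1}) T (epoint w)"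
  by (auto simp: continuous_map_def openin_T topspace_one_complex epoint_in)

lemma continuous_on_curve: "continuous_on A (curve w)"
  unfolding curve_def Complex_eq by (cases "w \<in> N") (auto intro!: continuous_intros)

lemma continuous_draw: "continuous_map T euclidean draw"
proof -
  have "openin T {x \<in> complex_points X. draw x \<in> V}" if "open V" for V
  proof -
    have "openin (top_of_set {0..1}) {t \<in> {0..1}. epoint w t \<in> {x \<in> complex_points X. draw x \<in> V}}"
      if "w \<in> W" for w
    proof -
      have "{t \<in> {0..1}. epoint w t \<in> {x \<in> complex_points X. draw x \<in> V}} = {0..1} \<inter> curve w -` V"
        using that draw_epoint epoint_in by auto
      then show ?thesis
        using continuous_on_curve \<open>open V\<close> by (simp add: continuous_openin_preimage_gen)
    qed
    then show ?thesis
      by (auto simp: openin_T)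
  qed
  then show ?thesis
    by (auto simp: continuous_map_def topspace_one_complex)
qed

lemma compactin_seg: "w \<in> W \<Longrightarrow> compactin T (seg w)"
  unfolding seg_def by (rule image_compactin[OF _ continuous_epoint]) (auto simp: compactin_subtopology)

section \<open>Exhaustion by finite subgraphs\<close>

definition KK :: "nat \<Rightarrow> ('v \<Rightarrow> real) set" where
  "KK k = (\<Union>w\<in>{w \<in> W. length w \<le> k}. seg w)"

lemma digits_bound: "w \<in> W \<Longrightarrow> set w \<subseteq> {..<L}"
  by (induction w) (auto simp: Cons_in_W N_subset_W)

lemma finite_words: "finite {w \<in> W. length w \<le> k}"
  by (rule finite_subset[OF _ finite_lists_length_le[of "{..<L}" k]]) (use digits_bound in auto)

lemma compactin_KK: "compactin T (KK k)"
  unfolding KK_def by (rule compactin_Union) (use finite_words compactin_seg in auto)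

lemma KK_mono: "k \<le> m \<Longrightarrow> KK k \<subseteq> KK m"
  by (auto simp: KK_def)

lemma seg_subset_KK: "w \<in> W \<Longrightarrow> length w \<le> k \<Longrightarrow> seg w \<subseteq> KK k"
  by (auto simp: KK_def)

text \<open>\<open>KK k\<close> need not be open, since deeper edges leave from its vertices.
  Removing \<open>RR k\<close> instead leaves an open set inside \<open>KK k\<close>; these sets
  form the cover used in \<open>compactin_exhausted\<close>.\<close>

definition RR :: "nat \<Rightarrow> ('v \<Rightarrow> real) set" where
  "RR k = (\<Union>w\<in>{w \<in> W. k < length w}. seg w)"

text \<open>An edge of depth at most \<open>k\<close> meets deeper edges only at its own ends, so at
  most two parameters are removed from it.\<close>

lemma openin_complement_RR: "openin T (complex_points X - RR k)"
proof -
  have "openin (top_of_set {0..1}) {t \<in> {0..1}. epoint w t \<in> complex_points X - RR k}" if w: "w \<in> W" for w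
  proof (cases "k < length w")
    case True
    then have "{t \<in> {0..1}. epoint w t \<in> complex_points X - RR k} = {}"
      using w by (auto simp: RR_def seg_def)
    then show ?thesis by (metis openin_empty)
  next
    case False
    let ?B = "{t \<in> {0..1}. epoint w t \<in> RR k}"
    have "t \<in> {0, 1}" if "t \<in> ?B" for t
    proof (rule ccontr)
      assume "t \<notin> {0, 1}"
      then have "0 < t" "t < 1"
        using that by auto
      moreover from that obtain w' where "w' \<in> W" "k < length w'" "epoint w t \<in> seg w'"
        by (auto simp: RR_def)
      moreover from this obtain t' where "t' \<in> {0..1}" "epoint w t = epoint w' t'"
        unfolding seg_def by blast
      ultimately show False
        using False epoint_interior[OF w, of w' t t'] by metis
    qed
    then have "finite ?B"
      by (meson finite.emptyI finite_insert finite_subset subsetI)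
    then have "openin (top_of_set {0..1}) ({0..1} - ?B)"
      by (intro openin_diff openin_subtopology_self closed_subset finite_imp_closed) auto
    moreover have "{0..1} - ?B = {t \<in> {0..1}. epoint w t \<in> complex_points X - RR k}"
      using w epoint_in by auto
    ultimately show ?thesis by metis
  qed
  then show ?thesis
    by (auto simp: openin_T)
qed

lemma complement_RR_subset: "complex_points X - RR k \<subseteq> KK k"
  by (force simp: complex_points_eq RR_def KK_def)

lemma finite_incident: "finite {w \<in> W. x \<in> seg w}"
proof (cases "x \<in> complex_points X")
  case True
  then obtain w t where wt: "w \<in> W" "t \<in> {0..1}" "x = epoint w t"
    by (rule pointE)
  show ?thesis
  proof (cases "0 < t \<and> t < 1")
    case True
    have "w' = w" if "w' \<in> W" "x \<in> seg w'" for w'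
    proof -
      from that obtain t' where "t' \<in> {0..1}" "x = epoint w' t'"
        by (auto simp: seg_def)
      then show ?thesis
        using epoint_interior[of w w' t t'] True wt that(1) by metis
    qed
    then have "{w \<in> W. x \<in> seg w} \<subseteq> {w}"
      by auto
    then show ?thesis using finite_subset by blast
  next
    case False
    then have "t = 0 \<or> t = 1"
      using wt by auto
    then obtain p where p: "x = vertex_point (\<gamma> p)" "p \<in> points"
      using wt lo_in_points hi_in_points by auto
    have "l w' = p \<or> h w' = p" if w': "w' \<in> W" "x \<in> seg w'" for w'
    proof -
      obtain t' where t': "t' \<in> {0..1}" "x = epoint w' t'"
        using w' by (auto simp: seg_def)
      have "t' = 0 \<or> t' = 1"
      proof (rule ccontr)
        assume "\<not> (t' = 0 \<or> t' = 1)"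
        then have "{v. x v \<noteq> 0} = {\<gamma> (l w'), \<gamma> (h w')}"
          using t' support_edge_point[of "\<gamma> (l w')" "\<gamma> (h w')" t'] \<gamma>_lo_neq_hi[of w'] w' by (auto simp: epoint_def)
        then show False
          using p support_vertex_point[of "\<gamma> p"] \<gamma>_lo_neq_hi[of w'] w' by (auto simp: doubleton_eq_iff)
      qed
      then show ?thesis
        using t' p \<gamma>_eq_iff lo_in_points hi_in_points w' by auto
    qed
    then have "{w \<in> W. x \<in> seg w} \<subseteq> {w \<in> W. l w = p} \<union> {w \<in> W. h w = p}"
      by auto
    then show ?thesis
      using finite_lo finite_hi finite_subset by blast
  qed
next
  case False
  then have "{w \<in> W. x \<in> seg w} = {}"
    by (auto simp: complex_points_eq)
  then show ?thesis by (metis finite.emptyI)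
qed

text \<open>A point lies on finitely many edges and so avoids \<open>RR k\<close> for large
  \<open>k\<close>. Finitely many of these open sets cover \<open>C\<close>, and each lies in some
  \<open>KK k\<close>. Ends therefore need to be examined on the sets \<open>KK k\<close>
  only.\<close>

lemma compactin_exhausted:
  assumes C: "compactin T C" obtains k where "C \<subseteq> KK k"
proof -
  have "\<exists>k. x \<in> complex_points X - RR k" if "x \<in> complex_points X" for x
  proof -
    have "finite (length ` {w \<in> W. x \<in> seg w})"
      using finite_incident by (rule finite_imageI)
    then obtain k where "\<forall>n \<in> length ` {w \<in> W. x \<in> seg w}. n \<le> k"
      unfolding finite_nat_set_iff_bounded_le by blast
    then have "x \<notin> RR k"
      by (force simp: RR_def)
    then show ?thesis using that by blast
  qed
  then have "C \<subseteq> \<Union> (range (\<lambda>k. complex_points X - RR k))"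
    using compactin_subset_topspace[OF C] by (auto simp: topspace_one_complex)
  then obtain \<F> where \<F>: "finite \<F>" "\<F> \<subseteq> range (\<lambda>k. complex_points X - RR k)" "C \<subseteq> \<Union>\<F>"
    using compactinD[OF C, of "range (\<lambda>k. complex_points X - RR k)"] openin_complement_RR by auto
  then obtain I where I: "finite I" "\<F> = (\<lambda>k. complex_points X - RR k) ` I"
    by (meson finite_subset_image)
  obtain k where k: "\<forall>i\<in>I. i \<le> k"
    using I finite_nat_set_iff_bounded_le by metis
  have "C \<subseteq> KK k"
  proof
    fix x assume "x \<in> C"
    then obtain i where "i \<in> I" "x \<in> complex_points X - RR i"
      using \<F>(3) unfolding I(2) by blast
    then show "x \<in> KK k"
      using complement_RR_subset[of i] KK_mono[of i k] k by auto
  qed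
  then show ?thesis using that by blast
qed

end

section \<open>Components and ends\<close>

text \<open>Each member is also closed, its complement being the union of the others, and a nonempty
  connected clopen set is a component.\<close>

lemma connected_components_of_partition:
  assumes "\<Union>\<D> = topspace S" "pairwise disjnt \<D>"
    and D: "\<And>D. D \<in> \<D> \<Longrightarrow> openin S D \<and> connectedin S D \<and> D \<noteq> {}"
  shows "connected_components_of S = \<D>"
proof -
  have "closedin S D" if "D \<in> \<D>" for D
  proof -
    have "topspace S - D = \<Union>(\<D> - {D})"
      using assms(1,2) that by (auto simp: pairwise_def disjnt_iff)
    then show ?thesis
      using D that by (metis DiffD1 closedin_def openin_Union openin_subset)
  qed
  then have *: "connected_component_of_set S x = D" if "D \<in> \<D>" "x \<in> D" for D x
    using that D[of D] connected_component_of_maximal[of S D x]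
      connectedin_clopen_cases[OF connectedin_connected_component_of[of S x], of D]
    by (metis connected_component_of_refl disjnt_iff mem_Collect_eq openin_subset subset_antisym subset_iff)
  show ?thesis
  proof
    show "connected_components_of S \<subseteq> \<D>"
    proof
      fix C assume "C \<in> connected_components_of S"
      then obtain x where "x \<in> topspace S" "C = connected_component_of_set S x"
        by (auto simp: connected_components_of_def)
      then show "C \<in> \<D>"
        using * assms(1) by blast
    qed
    show "\<D> \<subseteq> connected_components_of S"
      using * D assms(1) by (metis UnionI connected_component_in_connected_components_of ex_in_conv subsetI)
  qed
qed

lemma openin_iff_nbhd: "openin X U \<longleftrightarrow> (\<forall>x\<in>U. \<exists>V. openin X V \<and> x \<in> V \<and> V \<subseteq> U)"
  by (metis openin_subopen)

context cell_graph
begin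

text \<open>The Hausdorff property is borrowed from the plane: the image under \<open>draw\<close>
  is compact, hence closed, and \<open>draw\<close> is injective.\<close>

lemma closedin_compactin:
  assumes "compactin T K" shows "closedin T K"
proof -
  have K: "K \<subseteq> complex_points X"
    using compactin_subset_topspace[OF assms] by (simp add: topspace_one_complex)
  have "compact (draw ` K)"
    using image_compactin[OF assms continuous_draw] by simp
  then have "openin T {x \<in> topspace T. draw x \<in> - (draw ` K)}"
    by (intro openin_continuous_map_preimage[OF continuous_draw])
       (simp add: open_Compl compact_imp_closed)
  moreover have "{x \<in> topspace T. draw x \<in> - (draw ` K)} = topspace T - K"
    using inj_draw K by (auto simp: topspace_one_complex inj_on_def)
  ultimately show ?thesis
    using K by (simp add: closedin_def topspace_one_complex)
qed

lemma connectedin_arc: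
  assumes "w \<in> W" "connected J" "J \<subseteq> {0..1}"
  shows "connectedin T (epoint w ` J)"
  by (rule connectedin_continuous_map_image[OF continuous_epoint[OF assms(1)]])
     (use assms in \<open>simp add: connectedin_subtopology\<close>)

text \<open>The complex is locally connected: a short piece of an edge around a point of
  \<open>C\<close> stays in \<open>U\<close>, is connected, and is absorbed by the
  component.\<close>

lemma openin_component:
  assumes U: "openin T U" and C: "C \<in> connected_components_of (subtopology T U)"
  shows "openin T C"
proof -
  have CU: "C \<subseteq> U" "U \<subseteq> complex_points X"
    using connected_components_of_subset[OF C] openin_subset[OF U] by (auto simp: topspace_one_complex)
  have "openin (top_of_set {0..1}) {t \<in> {0..1}. epoint w t \<in> C}" if w: "w \<in> W" for w
  proof -
    have "\<exists>e>0. \<forall>s\<in>{0..1}. dist s t < e \<longrightarrow> epoint w s \<in> C" if t: "t \<in> {0..1}" "epoint w t \<in> C" for t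
    proof -
      have "openin (top_of_set {0..1}) {t \<in> {0..1}. epoint w t \<in> U}"
        using U w by (simp add: openin_T)
      then obtain e where e: "e > 0" "\<And>s. s \<in> {0..1} \<Longrightarrow> dist s t < e \<Longrightarrow> epoint w s \<in> U"
        using t CU unfolding openin_euclidean_subtopology_iff by blast
      let ?J = "{0..1} \<inter> ball t e"
      have "convex ?J"
        by (intro convex_Int) auto
      then have "connectedin T (epoint w ` ?J)"
        by (intro connectedin_arc[OF w] convex_connected) auto
      moreover have "epoint w ` ?J \<subseteq> U"
        using e by (auto simp: dist_commute)
      ultimately have "connectedin (subtopology T U) (epoint w ` ?J)"
        by (simp add: connectedin_subtopology)
      moreover have "\<not> disjnt C (epoint w ` ?J)"
        using t e(1) by (auto simp: disjnt_iff)
      ultimately have "epoint w ` ?J \<subseteq> C"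
        using C connected_components_of_maximal by blast
      then have "\<forall>s\<in>{0..1}. dist s t < e \<longrightarrow> epoint w s \<in> C"
        by (auto simp: dist_commute)
      then show ?thesis
        using e(1) by blast
    qed
    then show ?thesis
      by (auto simp: openin_euclidean_subtopology_iff)
  qed
  then show ?thesis
    using CU by (auto simp: openin_T)
qed

section \<open>Components of the complement of a finite subgraph\<close>

definition DD :: "nat list \<Rightarrow> ('v \<Rightarrow> real) set" where
  "DD w = {x \<in> complex_points X. l w < Re (draw x) \<and> Re (draw x) < h w \<and> x \<notin> KK (length w)}"

lemma openin_DD: "openin T (DD w)"
proof -
  have "open {z. l w < Re z \<and> Re z < h w}"
    by (intro open_Collect_conj open_Collect_less continuous_intros)
  then have "openin T {x \<in> topspace T. draw x \<in> {z. l w < Re z \<and> Re z < h w}}"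
    by (intro openin_continuous_map_preimage[OF continuous_draw]) simp
  then have "openin T ({x \<in> topspace T. draw x \<in> {z. l w < Re z \<and> Re z < h w}} - KK (length w))"
    using closedin_compactin[OF compactin_KK] by (rule openin_diff)
  moreover have "{x \<in> topspace T. draw x \<in> {z. l w < Re z \<and> Re z < h w}} - KK (length w) = DD w"
    by (auto simp: DD_def topspace_one_complex)
  ultimately show ?thesis by simp
qed

lemma vertex_lo_in_seg: "vertex_point (\<gamma> (l w)) \<in> seg w" and vertex_hi_in_seg: "vertex_point (\<gamma> (h w)) \<in> seg w"
  using epoint_0[of w] epoint_1[of w] unfolding seg_def
  by (metis atLeastAtMost_iff image_eqI order_refl zero_le_one)+

text \<open>Forgetting the digits deeper than \<open>k\<close> gives the cell \<open>w\<close>. Its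
  ends are vertices of \<open>KK k\<close>, so the point lies strictly between them.\<close>

lemma outside_KK:
  assumes "x \<in> complex_points X" "x \<notin> KK k"
  obtains v w t where "v \<noteq> []" "length w = k" "w \<in> N" "v @ w \<in> W" "t \<in> {0..1}" "x = epoint (v @ w) t" "x \<in> DD w"
proof -
  obtain w' t where w': "w' \<in> W" "t \<in> {0..1}" "x = epoint w' t"
    using assms pointE by blast
  then have k: "k < length w'"
    using assms(2) by (force simp: KK_def seg_def)
  define v where "v = take (length w' - k) w'"
  define w where "w = drop (length w' - k) w'"
  have vw: "w' = v @ w" "length w = k" "v \<noteq> []"
    using k by (auto simp: v_def w_def)
  then have w: "w \<in> N" "w \<in> W"
    using w' append_in_W N_subset_W by blast+
  have d: "draw x = curve (v @ w) t"
    using w' vw draw_epoint by simp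
  have b: "l w \<le> l (v @ w)" "h (v @ w) \<le> h w" "l (v @ w) \<le> Re (draw x)" "Re (draw x) \<le> h (v @ w)"
    using nested[of v w] Re_curve_bounds[of t "v @ w"] w' vw d by auto
  have "Re (draw x) \<noteq> l w"
  proof
    assume "Re (draw x) = l w"
    then have "Re (draw x) = Re (curve (v @ w) 0)" "l w = l (v @ w)"
      using b by auto
    then have "x = vertex_point (\<gamma> (l w))"
      using d Re_curve_inj[of "v @ w" t 0] w' vw by auto
    then show False
      using assms(2) seg_subset_KK[of w k] w vw vertex_lo_in_seg by auto
  qed
  moreover have "Re (draw x) \<noteq> h w"
  proof
    assume "Re (draw x) = h w"
    then have "Re (draw x) = Re (curve (v @ w) 1)" "h w = h (v @ w)"
      using b by auto
    then have "x = vertex_point (\<gamma> (h w))"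
      using d Re_curve_inj[of "v @ w" t 1] w' vw by auto
    then show False
      using assms(2) seg_subset_KK[of w k] w vw vertex_hi_in_seg by auto
  qed
  ultimately have "x \<in> DD w"
    using b assms vw by (simp add: DD_def)
  then show ?thesis
    using that vw w w' by metis
qed

lemma DD_disjoint:
  assumes "w \<in> W" "w' \<in> W" "length w = length w'" "x \<in> DD w" "x \<in> DD w'"
  shows "w = w'"
  using assms disjoint_same_length[of w w'] by (force simp: DD_def)

lemma Union_DD: "\<Union> (DD ` {w \<in> N. length w = k}) = complex_points X - KK k"
proof
  show "complex_points X - KK k \<subseteq> \<Union> (DD ` {w \<in> N. length w = k})"
    using outside_KK[of _ k] by blast
qed (auto simp: DD_def)

lemma DD_E:
  assumes "w \<in> N" "x \<in> DD w"
  obtains v t where "v \<noteq> []" "v @ w \<in> W" "t \<in> {0..1}" "x = epoint (v @ w) t"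
proof -
  have "x \<in> complex_points X" "x \<notin> KK (length w)"
    using assms by (auto simp: DD_def)
  then obtain v w' t where *: "v \<noteq> []" "length w' = length w" "w' \<in> N" "v @ w' \<in> W" "t \<in> {0..1}"
      "x = epoint (v @ w') t" "x \<in> DD w'"
    by (rule outside_KK)
  then have "w' = w"
    using DD_disjoint assms N_subset_W by metis
  then show ?thesis using * that by metis
qed

text \<open>An edge of depth at most \<open>length w\<close> can meet a deeper edge only at its own
  ends, and no end of such a cell lies strictly between the ends of \<open>w\<close>.\<close>

lemma DD_I:
  assumes "v \<noteq> []" "v @ w \<in> W" "t \<in> {0..1}"
    and x: "l w < Re (curve (v @ w) t)" "Re (curve (v @ w) t) < h w"
  shows "epoint (v @ w) t \<in> DD w"
proof -
  have "epoint (v @ w) t \<notin> KK (length w)"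
  proof
    assume "epoint (v @ w) t \<in> KK (length w)"
    then obtain w' t' where w': "w' \<in> W" "length w' \<le> length w" "t' \<in> {0..1}" "epoint (v @ w) t = epoint w' t'"
      unfolding KK_def seg_def by blast
    have ne: "w' \<noteq> v @ w"
      using w'(2) assms(1) by auto
    have eq: "curve (v @ w) t = curve w' t'"
      using w' assms curve_eq_iff by simp
    have "t' = 0 \<or> t' = 1"
      using curve_interior[of w' "v @ w" t' t] w' assms ne eq by force
    then have p: "Re (curve (v @ w) t) = l w' \<or> Re (curve (v @ w) t) = h w'"
      using eq by auto
    have wW: "w \<in> W"
      using assms append_in_W' by blast
    show False
      using cells_cases[OF w'(1) wW w'(2)]
    proof cases
      case (1 u)
      then show ?thesis
        using nested[of u w'] wW x p by auto
    qed (use x p lo_less_hi[of w'] in auto)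
  qed
  then show ?thesis
    using assms draw_epoint epoint_in by (simp add: DD_def)
qed

lemma DD_Cons_subset: 
  assumes "j # w \<in> W" shows "DD (j # w) \<subseteq> DD w"
  using lo_le_lo_Cons[of w j] hi_Cons_le_hi[of j w] assms KK_mono[of "length w" "Suc (length w)"]
  by (force simp: DD_def Cons_in_W)

abbreviation joined :: "nat list \<Rightarrow> ('v \<Rightarrow> real) \<Rightarrow> ('v \<Rightarrow> real) \<Rightarrow> bool" where
  "joined w \<equiv> connected_component_of (subtopology T (DD w))"

text \<open>The real part is affine along an edge, so the parameters that lie strictly over
  \<open>w\<close> form an interval.\<close>

lemma joined_on_seg:
  assumes "v \<noteq> []" "v @ w \<in> W" "t \<in> {0..1}" "t' \<in> {0..1}"
    and "epoint (v @ w) t \<in> DD w" "epoint (v @ w) t' \<in> DD w"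
  shows "joined w (epoint (v @ w) t) (epoint (v @ w) t')"
proof -
  let ?J = "{s \<in> {0..1}. l w < Re (curve (v @ w) s) \<and> Re (curve (v @ w) s) < h w}"
  let ?f = "\<lambda>s. Re (curve (v @ w) s)"
  have "?J = {0..1} \<inter> ({s. l w < l (v @ w) + s * len L (v @ w)} \<inter> {s. l (v @ w) + s * len L (v @ w) < h w})"
    by (auto simp: Re_curve)
  also have "\<dots> = {0..1} \<inter> ({(l w - l (v @ w)) / len L (v @ w) <..} \<inter> {..< (h w - l (v @ w)) / len L (v @ w)})"
    using len_pos[of "v @ w"] by (auto simp: field_simps)
  finally have "convex ?J"
    by (metis convex_Int convex_real_interval(5) convex_real_interval(3) convex_real_interval(4))
  then have "connectedin T (epoint (v @ w) ` ?J)"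
    by (intro connectedin_arc[OF assms(2)] convex_connected) auto
  moreover have "epoint (v @ w) ` ?J \<subseteq> DD w"
    using DD_I assms by auto
  moreover have "t \<in> ?J" "t' \<in> ?J"
    using assms draw_epoint by (auto simp: DD_def)
  ultimately show ?thesis
    unfolding connected_component_of_def connectedin_subtopology by blast
qed

abbreviation vx :: "real \<Rightarrow> 'v \<Rightarrow> real" where
  "vx p \<equiv> vertex_point (\<gamma> p)"

lemma vx_lo_in_DD: "v \<noteq> [] \<Longrightarrow> v @ w \<in> W \<Longrightarrow> l w < l (v @ w) \<Longrightarrow> vx (l (v @ w)) \<in> DD w"
  using DD_I[of v w 0] lo_less_hi[of "v @ w"] nested[of v w] by auto

lemma vx_hi_in_DD: "v \<noteq> [] \<Longrightarrow> v @ w \<in> W \<Longrightarrow> h (v @ w) < h w \<Longrightarrow> vx (h (v @ w)) \<in> DD w"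
  using DD_I[of v w 1] lo_less_hi[of "v @ w"] nested[of v w] by auto

lemma joined_ends:
  assumes "v \<noteq> []" "v @ w \<in> W" "l w < l (v @ w)" "h (v @ w) < h w"
  shows "joined w (vx (l (v @ w))) (vx (h (v @ w)))"
  using joined_on_seg[of v w 0 1] vx_lo_in_DD[of v w] vx_hi_in_DD[of v w] assms by simp

text \<open>Children \<open>1\<close> to \<open>L - 2\<close> avoid both ends of their parent, so
  they form a path through the inner vertices of a face that stays over the open cell
  \<open>w\<close>, even when the face shares an end with \<open>w\<close>.\<close>

lemma joined_chain:
  assumes u: "v @ w \<in> N" and "0 < i" "i \<le> j" "j < L"
  shows "joined w (vx (l (i # v @ w))) (vx (l (j # v @ w)))"
  using \<open>i \<le> j\<close> \<open>j < L\<close>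
proof (induction j rule: dec_induct)
  case base
  have "l w < l (i # v @ w)"
    using nested[of v w] N_subset_W[OF u] lo_Cons_gt[of i "v @ w"] \<open>0 < i\<close> by auto
  then have "vx (l (i # v @ w)) \<in> DD w"
    using vx_lo_in_DD[of "i # v" w] u base by (auto simp: Cons_in_W)
  then show ?case
    using openin_subset[OF openin_DD] by (auto simp: connected_component_of_refl)
next
  case (step m)
  have W: "m # v @ w \<in> W"
    using u step by (simp add: Cons_in_W)
  have "m < L - 1"
    using \<open>Suc m < L\<close> by linarith
  then have "l w < l (m # v @ w)" "h (m # v @ w) < h w"
    using nested[of v w] N_subset_W[OF u] lo_Cons_gt[of m "v @ w"] hi_Cons_less_hi[of m "v @ w"]
      step(1-2) \<open>0 < i\<close> \<open>Suc m < L\<close> by auto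
  then have "joined w (vx (l (m # v @ w))) (vx (l (Suc m # v @ w)))"
    using joined_ends[of "m # v" w] W by (simp add: lo_Cons_Suc)
  moreover have "joined w (vx (l (i # v @ w))) (vx (l (m # v @ w)))"
    using step.IH \<open>Suc m < L\<close> by simp
  ultimately show ?case
    by (meson connected_component_of_trans)
qed

lemma joined_inner_aux:
  assumes "v @ w \<in> N" "0 < i" "i < L" "joined w x (vx (l (i # v @ w)))" "0 < j" "j < L"
  shows "joined w x (vx (l (j # v @ w)))"
proof (cases "i \<le> j")
  case True
  then show ?thesis
    using joined_chain[of v w i j] assms connected_component_of_trans by metis
next
  case False
  then show ?thesis
    using joined_chain[of v w j i] assms connected_component_of_trans connected_component_of_sym
    by (meson nat_le_linear)
qed

text \<open>The first division point of \<open>w\<close> lies strictly inside because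
  \<open>L \<ge> 2\<close>. It serves as base point for connectedness and as witness that
  \<open>DD w\<close> is nonempty.\<close>

definition base :: "nat list \<Rightarrow> 'v \<Rightarrow> real" where
  "base w = vx (l (1 # w))"

text \<open>Induction on the depth below \<open>w\<close>. If \<open>v\<close> is nonempty, one end
  of \<open>v @ w\<close> lies strictly inside \<open>w\<close> and is joined to the base point by
  induction; the first or last child at that end leads on to the inner vertices of the face.\<close>

lemma joined_base_aux:
  assumes "w \<in> N" "v @ w \<in> W" "v \<noteq> []"
  shows "(l w < l (v @ w) \<longrightarrow> joined w (base w) (vx (l (v @ w)))) \<and>
         (h (v @ w) < h w \<longrightarrow> joined w (base w) (vx (h (v @ w))))"
  using assms(2,3)
proof (induction v)
  case (Cons j v)
  then have u: "v @ w \<in> N" "v @ w \<in> W" and j: "j < L"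
    by (auto simp: Cons_in_W N_subset_W)
  have L1: "0 < L - 1" "L - 1 < L" "1 < L"
    using L_ge2 by auto
  have bd: "l w \<le> l (v @ w)" "h (v @ w) \<le> h w"
    using nested u by auto
  have inner: "joined w (base w) (vx (l (i # v @ w)))" if i: "0 < i" "i < L" for i
  proof (cases "v = []")
    case True
    then show ?thesis
      using joined_chain[of "[]" w 1 i] i u by (simp add: base_def)
  next
    case False
    then have ne: "v @ w \<noteq> w" by auto
    then have "l w \<noteq> l (v @ w) \<or> h (v @ w) \<noteq> h w"
      using cell_eqI[of "v @ w" w] u(2) assms(1) N_subset_W by metis
    then consider "l w < l (v @ w)" | "h (v @ w) < h w"
      using bd by linarith
    then show ?thesis
    proof cases
      case 1
      then have "joined w (base w) (vx (l (0 # v @ w)))"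
        using Cons.IH u False by simp
      moreover have "0 # v @ w \<in> W" "h (0 # v @ w) < h w"
        using u L1 hi_Cons_less_hi[of 0 "v @ w"] bd by (auto simp: Cons_in_W)
      then have "joined w (vx (l (0 # v @ w))) (vx (l (1 # v @ w)))"
        using joined_ends[of "0 # v" w] 1 by (simp add: lo_Cons_Suc)
      ultimately have "joined w (base w) (vx (l (1 # v @ w)))"
        by (rule connected_component_of_trans)
      then show ?thesis
        using joined_inner_aux[of v w 1] u i L1 by auto
    next
      case 2
      then have "joined w (base w) (vx (h ((L - 1) # v @ w)))"
        using Cons.IH u False hi_Cons_last by simp
      moreover have "(L - 1) # v @ w \<in> W" "l w < l ((L - 1) # v @ w)" "h ((L - 1) # v @ w) < h w"
        using u L1 2 lo_Cons_gt[of "L - 1" "v @ w"] bd hi_Cons_last[of "v @ w"] by (auto simp: Cons_in_W)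
      then have "joined w (vx (l ((L - 1) # v @ w))) (vx (h ((L - 1) # v @ w)))"
        using joined_ends[of "(L - 1) # v" w] by simp
      ultimately have "joined w (base w) (vx (l ((L - 1) # v @ w)))"
        by (meson connected_component_of_trans connected_component_of_sym)
      then show ?thesis
        using joined_inner_aux[of v w "L - 1"] u i L1 by auto
    qed
  qed
  have "joined w (base w) (vx (l (j # v @ w)))" if "l w < l (j # v @ w)"
  proof (cases "j = 0")
    case True
    then have "v \<noteq> []" "l w < l (v @ w)"
      using that by auto
    then show ?thesis using True Cons.IH u by simp
  qed (use inner j in auto)
  moreover have "joined w (base w) (vx (h (j # v @ w)))" if "h (j # v @ w) < h w"
  proof (cases "j = L - 1")
    case True
    then have "h (j # v @ w) = h (v @ w)"
      using hi_Cons_last by simp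
    moreover from this have "v \<noteq> []"
      using that by auto
    ultimately show ?thesis using that Cons.IH u by simp
  next
    case False
    then show ?thesis
      using inner[of "Suc j"] j lo_Cons_Suc[of j "v @ w"] by auto
  qed
  ultimately show ?case by auto
qed auto

lemma base_in_DD: "w \<in> N \<Longrightarrow> base w \<in> DD w"
  using vx_lo_in_DD[of "[1]" w] lo_Cons_gt[of 1 w] L_ge2 by (simp add: base_def Cons_in_W)

lemma joined_base:
  assumes "w \<in> N" "x \<in> DD w" shows "joined w (base w) x"
proof -
  obtain v t where x: "v \<noteq> []" "v @ w \<in> W" "t \<in> {0..1}" "x = epoint (v @ w) t"
    using DD_E assms by blast
  have bd: "l w \<le> l (v @ w)" "h (v @ w) \<le> h w"
    using nested x by auto
  have "l w \<noteq> l (v @ w) \<or> h (v @ w) \<noteq> h w"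
    using cell_eqI[of "v @ w" w] x assms(1) N_subset_W by (metis append_self_conv2)
  then consider "l w < l (v @ w)" | "h (v @ w) < h w"
    using bd by linarith
  then show ?thesis
  proof cases
    case 1
    then have "joined w (vx (l (v @ w))) x"
      using joined_on_seg[of v w 0 t] x vx_lo_in_DD[of v w] assms by simp
    then show ?thesis
      using joined_base_aux[of w v] assms x 1 connected_component_of_trans by metis
  next
    case 2
    then have "joined w (vx (h (v @ w))) x"
      using joined_on_seg[of v w 1 t] x vx_hi_in_DD[of v w] assms by simp
    then show ?thesis
      using joined_base_aux[of w v] assms x 2 connected_component_of_trans by metis
  qed
qed

lemma connectedin_DD:
  assumes "w \<in> N" shows "connectedin T (DD w)"
proof -
  have "connected_space (subtopology T (DD w))"
    unfolding connected_space_iff_connected_component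
    using joined_base[OF assms] connected_component_of_trans connected_component_of_sym
    by (metis Int_iff topspace_subtopology)
  then show ?thesis
    using openin_subset[OF openin_DD] by (simp add: connectedin_def)
qed

lemma components_KK:
  "connected_components_of (subtopology T (topspace T - KK k)) = DD ` {w \<in> N. length w = k}"
proof (rule connected_components_of_partition)
  show "\<Union> (DD ` {w \<in> N. length w = k}) = topspace (subtopology T (topspace T - KK k))"
    by (auto simp: Union_DD topspace_one_complex)
  show "pairwise disjnt (DD ` {w \<in> N. length w = k})"
    using DD_disjoint N_subset_W unfolding pairwise_def disjnt_iff by fastforce
  fix D assume "D \<in> DD ` {w \<in> N. length w = k}"
  then obtain w where w: "w \<in> N" "length w = k" "D = DD w"
    by auto
  then have "D \<subseteq> topspace T - KK k"
    by (auto simp: DD_def topspace_one_complex)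
  then show "openin (subtopology T (topspace T - KK k)) D \<and> connectedin (subtopology T (topspace T - KK k)) D \<and> D \<noteq> {}"
    using w openin_DD[of w] connectedin_DD[of w] base_in_DD[of w]
    by (auto simp: connectedin_subtopology openin_subtopology)
qed

end

section \<open>The compactification and its drawing\<close>

context cell_graph
begin

section \<open>Infinite branches of the tree and their limit points\<close>

definition branch :: "(nat \<Rightarrow> nat list) \<Rightarrow> bool" where
  "branch b \<longleftrightarrow> b 0 = [] \<and> (\<forall>k. b k \<in> N \<and> (\<exists>j. b (Suc k) = j # b k))"

definition limit :: "(nat \<Rightarrow> nat list) \<Rightarrow> real" where
  "limit b = (SUP k. l (b k))"

lemma branch_in_N: "branch b \<Longrightarrow> b k \<in> N" and branch_in_W: "branch b \<Longrightarrow> b k \<in> W"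
  by (auto simp: branch_def N_subset_W)

lemma length_branch: "branch b \<Longrightarrow> length (b k) = k"
  by (induction k) (auto simp: branch_def, metis length_Cons)

lemma branch_append:
  assumes "branch b" "k \<le> m" obtains v where "b m = v @ b k"
proof -
  have "\<exists>v. b m = v @ b k"
    using assms(2)
  proof (induction m rule: dec_induct)
    case (step m)
    then obtain v where "b m = v @ b k" by blast
    moreover obtain j where "b (Suc m) = j # b m"
      using assms(1) by (auto simp: branch_def)
    ultimately show ?case by (metis append_Cons)
  qed auto
  then show ?thesis using that by blast
qed

lemma branch_nested:
  assumes "branch b" "k \<le> m" shows "l (b k) \<le> l (b m)" "h (b m) \<le> h (b k)"
proof -
  obtain v where "b m = v @ b k"
    using branch_append assms by blast
  then show "l (b k) \<le> l (b m)" "h (b m) \<le> h (b k)"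
    using nested[of v "b k"] branch_in_W[OF assms(1), of m] by auto
qed

lemma branch_lo_le_hi:
  assumes "branch b" shows "l (b m) \<le> h (b k)"
  using branch_nested[OF assms, of m "max m k"] branch_nested[OF assms, of k "max m k"] lo_less_hi[of "b (max m k)"]
  by auto

lemma lo_le_limit: assumes "branch b" shows "l (b k) \<le> limit b"
  unfolding limit_def by (rule cSUP_upper) (use branch_lo_le_hi[OF assms] in \<open>auto intro!: bdd_aboveI2\<close>)

lemma limit_le_hi: assumes "branch b" shows "limit b \<le> h (b k)"
  unfolding limit_def by (rule cSUP_least) (use branch_lo_le_hi[OF assms] in auto)

lemma infinite_branch_tail: assumes "branch b" shows "infinite (b ` {k..})"
proof
  assume "finite (b ` {k..})"
  then have "finite (length ` b ` {k..})"
    by simp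
  moreover have "length ` b ` {k..} = {k..}"
    using length_branch[OF assms] by (force simp: image_image)
  ultimately have "finite {k..}"
    by metis
  then show False
    using infinite_Ici by blast
qed

text \<open>The inequalities are strict because an endpoint of a cell lies on finitely many cells.\<close>

lemma lo_less_limit: assumes "branch b" shows "l (b k) < limit b"
proof (rule ccontr)
  assume "\<not> l (b k) < limit b"
  then have "l (b m) = limit b" if "k \<le> m" for m
    using branch_nested(1)[OF assms that] lo_le_limit[OF assms, of m] by linarith
  then have "b ` {k..} \<subseteq> {w \<in> W. l w = limit b}"
    using branch_in_W[OF assms] by auto
  then show False
    using infinite_branch_tail[OF assms] finite_lo finite_subset by blast
qed

lemma limit_less_hi: assumes "branch b" shows "limit b < h (b k)"
proof (rule ccontr)
  assume "\<not> limit b < h (b k)"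
  then have "h (b m) = limit b" if "k \<le> m" for m
    using branch_nested(2)[OF assms that] limit_le_hi[OF assms, of m] by linarith
  then have "b ` {k..} \<subseteq> {w \<in> W. h w = limit b}"
    using branch_in_W[OF assms] by auto
  then show False
    using infinite_branch_tail[OF assms] finite_hi finite_subset by blast
qed

lemma small_cell: assumes "0 < \<epsilon>" obtains k where "\<And>w. length w = k \<Longrightarrow> len L w < \<epsilon>"
proof -
  have "1 / real L < 1"
    using L_ge2 by simp
  then obtain k where "(1 / real L) ^ k < \<epsilon>"
    using real_arch_pow_inv[OF assms] by blast
  then show ?thesis
    using that[of k] by (simp add: len_def power_divide)
qed

lemma limit_unique:
  assumes b: "branch b" and x: "\<And>k. l (b k) \<le> x \<and> x \<le> h (b k)" shows "x = limit b"
proof (rule ccontr)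
  assume "x \<noteq> limit b"
  then obtain k where k: "\<And>w. length w = k \<Longrightarrow> len L w < \<bar>x - limit b\<bar>"
    using small_cell[of "\<bar>x - limit b\<bar>"] by auto
  have "\<bar>x - limit b\<bar> \<le> len L (b k)"
    using x[of k] lo_le_limit[OF b, of k] limit_le_hi[OF b, of k] unfolding hi_def by linarith
  then show False
    using k[OF length_branch[OF b]] by simp
qed

text \<open>Different cells of one depth may share an end, but a limit lies strictly inside each
  cell of its branch.\<close>

lemma limit_inj:
  assumes "branch b" "branch b'" "limit b = limit b'" shows "b = b'"
proof
  fix k
  show "b k = b' k"
    using disjoint_same_length[of "b k" "b' k"] length_branch branch_in_W assms
      lo_less_limit[OF assms(1), of k] limit_less_hi[OF assms(1), of k]
      lo_less_limit[OF assms(2), of k] limit_less_hi[OF assms(2), of k] by fastforce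
qed

section \<open>Ends correspond to branches\<close>

definition components_off :: "('v \<Rightarrow> real) set \<Rightarrow> ('v \<Rightarrow> real) set set" where
  "components_off K = connected_components_of (subtopology T (topspace T - K))"

lemma components_off_eq:
  "C \<in> components_off K \<Longrightarrow> C' \<in> components_off K \<Longrightarrow> x \<in> C \<Longrightarrow> x \<in> C' \<Longrightarrow> C = C'"
  using connected_components_of_overlap[of C "subtopology T (topspace T - K)" C']
  unfolding components_off_def by blast

lemma components_off_KK: "components_off (KK k) = DD ` {w \<in> N. length w = k}"
  by (simp add: components_off_def components_KK)

lemma end_component: "e \<in> ends_of T \<Longrightarrow> compactin T K \<Longrightarrow> e K \<in> components_off K"
  by (auto simp: ends_of_def components_off_def)

lemma end_antimono: "e \<in> ends_of T \<Longrightarrow> compactin T K \<Longrightarrow> compactin T K' \<Longrightarrow> K \<subseteq> K' \<Longrightarrow> e K' \<subseteq> e K"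
  by (auto simp: ends_of_def)

text \<open>Recording the end on the exhausting sets \<open>KK k\<close> loses nothing, and there
  its choices of components are choices of cells.\<close>

definition follows :: "(('v \<Rightarrow> real) set \<Rightarrow> ('v \<Rightarrow> real) set) \<Rightarrow> (nat \<Rightarrow> nat list) \<Rightarrow> bool" where
  "follows e b \<longleftrightarrow> branch b \<and> (\<forall>k. e (KK k) = DD (b k))"

lemma DD_inj: "w \<in> N \<Longrightarrow> w' \<in> N \<Longrightarrow> length w = length w' \<Longrightarrow> DD w = DD w' \<Longrightarrow> w = w'"
  using DD_disjoint[of w w' "base w"] base_in_DD N_subset_W by auto

lemma DD_parent:
  assumes "w' \<in> N" "w \<in> N" "length w' = Suc (length w)" "x \<in> DD w'" "x \<in> DD w"
  obtains j where "w' = j # w"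
proof -
  from assms obtain j u where u: "w' = j # u" "length u = length w"
    by (auto simp: length_Suc_conv)
  then have "u \<in> N" "x \<in> DD u"
    using assms N_ConsD[of j u] DD_Cons_subset[of j u] by (auto simp: Cons_in_W)
  then have "u = w"
    using DD_disjoint u assms N_subset_W by metis
  then show ?thesis using u that by auto
qed

lemma end_follows:
  assumes e: "e \<in> ends_of T" obtains b where "follows e b"
proof -
  have "\<forall>k. \<exists>w. w \<in> N \<and> length w = k \<and> e (KK k) = DD w"
    using end_component[OF e compactin_KK] by (auto simp: components_off_KK)
  then obtain b where b: "\<And>k. b k \<in> N" "\<And>k. length (b k) = k" "\<And>k. e (KK k) = DD (b k)"
    by metis
  have "\<exists>j. b (Suc k) = j # b k" for k
  proof -
    have "e (KK (Suc k)) \<subseteq> e (KK k)"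
      by (intro end_antimono[OF e] compactin_KK KK_mono) auto
    \<comment> \<open>The base point of the deeper cell witnesses that the two components meet, so
      the deeper cell is a child of the other.\<close>
    then have "base (b (Suc k)) \<in> DD (b k)"
      using base_in_DD[OF b(1)[of "Suc k"]] b(3) by auto
    then show ?thesis
      using DD_parent[of "b (Suc k)" "b k"] base_in_DD b by (metis Suc_eq_plus1)
  qed
  moreover have "b 0 = []"
    using b(2)[of 0] by (simp only: length_0_conv)
  ultimately have "follows e b"
    using b by (auto simp: follows_def branch_def)
  then show ?thesis using that by blast
qed

lemma follows_unique:
  assumes "follows e b" "follows e b'" shows "b = b'"
  using assms DD_inj branch_in_N length_branch unfolding follows_def by (metis ext)

text \<open>Once \<open>K \<subseteq> KK k\<close>, the component \<open>e K\<close> is the one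
  containing \<open>DD (b k)\<close>. On sets that are not compact both ends have the value
  \<open>undefined\<close>.\<close>

lemma end_determined:
  assumes "e \<in> ends_of T" "e' \<in> ends_of T" "follows e b" "follows e' b"
  shows "e = e'"
proof
  fix K show "e K = e' K"
  proof (cases "compactin T K")
    case True
    then obtain k where k: "K \<subseteq> KK k"
      by (rule compactin_exhausted)
    then have "DD (b k) \<subseteq> e K" "DD (b k) \<subseteq> e' K"
      using end_antimono[OF _ True compactin_KK k] assms unfolding follows_def by metis+
    moreover have "base (b k) \<in> DD (b k)"
      using base_in_DD branch_in_N assms by (auto simp: follows_def)
    ultimately show ?thesis
      using components_off_eq end_component True assms by (meson subsetD)
  next
    case False
    then have "e K = undefined" "e' K = undefined"
      using assms by (auto simp: ends_of_def PiE_def extensional_def)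
    then show ?thesis by simp
  qed
qed

lemma DD_branch_antimono:
  assumes "branch b" "k \<le> m" shows "DD (b m) \<subseteq> DD (b k)"
  using assms(2)
proof (induction m rule: dec_induct)
  case (step m)
  obtain j where "b (Suc m) = j # b m"
    using assms(1) by (auto simp: branch_def)
  then show ?case
    using DD_Cons_subset[of j "b m"] branch_in_W[OF assms(1), of "Suc m"] step by auto
qed auto

text \<open>The end sends \<open>K\<close> to the component containing \<open>DD (b k)\<close> for
  some \<open>k\<close> with \<open>K \<subseteq> KK k\<close>. It is unique because the sets
  \<open>DD (b k)\<close> decrease and are nonempty, which is the content of
  \<open>common\<close>.\<close>

lemma end_of_branch:
  assumes b: "branch b"
  obtains e where "e \<in> ends_of T" "follows e b"
proof -
  let ?P = "\<lambda>K C. C \<in> components_off K \<and> (\<exists>k. K \<subseteq> KK k \<and> DD (b k) \<subseteq> C)"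
  have common: "\<exists>x. x \<in> C \<and> x \<in> C'" if "DD (b k) \<subseteq> C" "DD (b m) \<subseteq> C'" for C C' k m
    using that DD_branch_antimono[OF b, of k "max k m"] DD_branch_antimono[OF b, of m "max k m"]
      base_in_DD[OF branch_in_N[OF b], of "max k m"] by fastforce
  have ex: "\<exists>C. ?P K C" if "compactin T K" for K
  proof -
    obtain k where k: "K \<subseteq> KK k"
      using compactin_exhausted \<open>compactin T K\<close> by blast
    have "DD (b k) \<subseteq> topspace T - K"
      using k length_branch[OF b, of k] by (auto simp: DD_def topspace_one_complex)
    then have "connectedin (subtopology T (topspace T - K)) (DD (b k))"
      using connectedin_DD[OF branch_in_N[OF b]] by (simp add: connectedin_subtopology)
    moreover have "topspace (subtopology T (topspace T - K)) \<noteq> {}"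
      using \<open>DD (b k) \<subseteq> topspace T - K\<close> base_in_DD[OF branch_in_N[OF b], of k] by auto
    then have "subtopology T (topspace T - K) \<noteq> trivial_topology"
      unfolding null_topspace_iff_trivial .
    ultimately show ?thesis
      using exists_connected_component_of_superset k unfolding components_off_def by blast
  qed
  have uniq: "C = C'" if "?P K C" "?P K C'" for K C C'
    using that common components_off_eq by metis
  \<comment> \<open>The restriction puts \<open>undefined\<close> off the compact sets, as
    \<open>\<Pi>\<^sub>E\<close> in \<open>ends_of\<close> demands.\<close>
  define e where "e = (\<lambda>K\<in>{K. compactin T K}. THE C. ?P K C)"
  have e: "?P K (e K)" if "compactin T K" for K
    using theI'[of "?P K"] ex[OF that] uniq that unfolding e_def by (simp add: Ex1_def) blast
  have "e K' \<subseteq> e K" if "compactin T K" "compactin T K'" "K \<subseteq> K'" for K K'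
  proof -
    have "connectedin T (e K')" "e K' \<subseteq> topspace T - K'"
      using e[OF that(2)] connectedin_connected_components_of unfolding components_off_def
      by (metis connectedin_subtopology)+
    then have "connectedin (subtopology T (topspace T - K)) (e K')"
      using that(3) by (auto simp: connectedin_subtopology)
    moreover have "\<not> disjnt (e K) (e K')"
      using e[OF that(1)] e[OF that(2)] common unfolding disjnt_iff by metis
    ultimately show ?thesis
      using connected_components_of_maximal e[OF that(1)] unfolding components_off_def by blast
  qed
  moreover have "e \<in> (\<Pi>\<^sub>E K\<in>{K. compactin T K}. components_off K)"
    using e by (auto simp: e_def)
  ultimately have "e \<in> ends_of T"
    by (auto simp: ends_of_def components_off_def)
  moreover have "e (KK k) = DD (b k)" for k
  proof -
    have "?P (KK k) (DD (b k))"
      using branch_in_N[OF b] length_branch[OF b] by (auto simp: components_off_KK)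
    then show ?thesis
      by (rule uniq[OF e[OF compactin_KK]])
  qed
  ultimately show ?thesis
    using that b by (auto simp: follows_def)
qed

definition end_pos :: "(('v \<Rightarrow> real) set \<Rightarrow> ('v \<Rightarrow> real) set) \<Rightarrow> real" where
  "end_pos e = limit (SOME b. follows e b)"

lemma end_pos_eq: "follows e b \<Longrightarrow> end_pos e = limit b"
  unfolding end_pos_def using someI[of "follows e" b] follows_unique by metis

text \<open>The part of the compactification beyond the arc over the cell \<open>w\<close>.\<close>

definition AA :: "nat list \<Rightarrow> (('v \<Rightarrow> real) + (('v \<Rightarrow> real) set \<Rightarrow> ('v \<Rightarrow> real) set)) set" where
  "AA w = Inl ` DD w \<union> Inr ` {e \<in> ends_of T. e (KK (length w)) = DD w}"

text \<open>Agreement on the larger set \<open>KK (length w)\<close> forces agreement on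
  \<open>K\<close>, since \<open>DD w\<close> is nonempty and lies in a single component off
  \<open>K\<close>.\<close>

lemma AA_subset_basic:
  assumes "e \<in> ends_of T" "e0 \<in> ends_of T" "compactin T K" "e K = e0 K" "K \<subseteq> KK (length w)"
    and w: "w \<in> N" "e (KK (length w)) = DD w"
  shows "AA w \<subseteq> Inl ` e0 K \<union> Inr ` {e' \<in> ends_of T. e' K = e0 K}"
proof -
  have 1: "DD w \<subseteq> e0 K"
    using end_antimono[OF assms(1,3) compactin_KK assms(5)] assms by simp
  have 2: "e' K = e0 K" if e': "e' \<in> ends_of T" "e' (KK (length w)) = DD w" for e'
  proof -
    have "DD w \<subseteq> e' K"
      using end_antimono[OF e'(1) assms(3) compactin_KK assms(5)] e' by simp
    then show ?thesis
      using 1 base_in_DD[OF w(1)] components_off_eq end_component e' assms by (meson subsetD)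
  qed
  show ?thesis
    using 1 2 unfolding AA_def by blast
qed

lemma openin_AA:
  assumes "e \<in> ends_of T" "e (KK (length w)) = DD w"
  shows "openin (freudenthal T) (AA w)"
proof -
  have "AA w = Inl ` e (KK (length w)) \<union> Inr ` {e' \<in> ends_of T. e' (KK (length w)) = e (KK (length w))}"
    using assms by (auto simp: AA_def)
  then have "AA w \<in> {Inl ` e K \<union> Inr ` {e' \<in> ends_of T. e' K = e K} | e K. e \<in> ends_of T \<and> compactin T K}"
    using assms(1) compactin_KK[of "length w"]
    by (intro CollectI exI[of _ e] exI[of _ "KK (length w)"] conjI)
  then show ?thesis
    unfolding freudenthal_def by (intro topology_generated_by_Basis) simp
qed

lemma AA_antimono:
  assumes "e \<in> ends_of T" "follows e b" "k \<le> m"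
  shows "AA (b m) \<subseteq> AA (b k)"
proof -
  have b: "branch b" "e (KK k) = DD (b k)" "e (KK m) = DD (b m)" "length (b k) = k" "length (b m) = m"
    using assms length_branch by (auto simp: follows_def)
  have "AA (b m) \<subseteq> Inl ` e (KK k) \<union> Inr ` {e' \<in> ends_of T. e' (KK k) = e (KK k)}"
    using assms b KK_mono branch_in_N[OF b(1)]
    by (intro AA_subset_basic[OF assms(1) assms(1) compactin_KK refl]) auto
  then show ?thesis
    using b by (simp add: AA_def)
qed

text \<open>Together with \<open>openin_AA\<close>, the sets \<open>AA (b k)\<close> form a
  neighbourhood basis at \<open>e\<close>. The topology is given by a subbasis, hence the induction;
  finite intersections are handled by nestedness.\<close>

lemma end_nbhd:
  assumes "openin (freudenthal T) U" "Inr e \<in> U" "e \<in> ends_of T" "follows e b"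
  shows "\<exists>k. AA (b k) \<subseteq> U"
proof -
  let ?\<S> = "{Inl ` U | U. openin T U} \<union>
      {Inl ` e K \<union> Inr ` {e' \<in> ends_of T. e' K = e K} | e K. e \<in> ends_of T \<and> compactin T K}"
  have "generate_topology_on ?\<S> U"
    using assms(1) unfolding freudenthal_def openin_topology_generated_by_iff .
  then show ?thesis
    using assms(2)
  proof (induction rule: generate_topology_on.induct)
    case (Int a c)
    then obtain k m where "AA (b k) \<subseteq> a" "AA (b m) \<subseteq> c"
      by auto
    then have "AA (b (max k m)) \<subseteq> a \<inter> c"
      using AA_antimono[OF assms(3,4), of k "max k m"] AA_antimono[OF assms(3,4), of m "max k m"] by auto
    then show ?case by blast
  next
    case (UN \<K>)
    then show ?case by blast
  next
    case (Basis s)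
    then obtain e0 K where s: "s = Inl ` e0 K \<union> Inr ` {e' \<in> ends_of T. e' K = e0 K}"
        "e0 \<in> ends_of T" "compactin T K"
      by auto
    then have "e K = e0 K"
      using Basis by auto
    obtain k where k: "K \<subseteq> KK k"
      using compactin_exhausted s by blast
    have "AA (b k) \<subseteq> s"
      unfolding s(1) using assms(4) k length_branch[of b k] branch_in_N[of b k]
      by (intro AA_subset_basic[OF assms(3) s(2,3) \<open>e K = e0 K\<close>]) (auto simp: follows_def)
    then show ?case by blast
  qed auto
qed

lemma openin_Inl: "openin T U \<Longrightarrow> openin (freudenthal T) (Inl ` U)"
  unfolding freudenthal_def by (intro topology_generated_by_Basis) blast

text \<open>A basic neighbourhood of an end traces a component of an open set on the complex, so
  local connectedness is what makes it open.\<close>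

lemma continuous_Inl: "continuous_map T (freudenthal T) Inl"
  unfolding freudenthal_def
proof (rule continuous_on_generated_topo)
  let ?\<S> = "{Inl ` U | U. openin T U} \<union>
      {Inl ` e K \<union> Inr ` {e' \<in> ends_of T. e' K = e K} | e K. e \<in> ends_of T \<and> compactin T K}"
  fix U assume "U \<in> ?\<S>"
  then consider V where "U = Inl ` V" "openin T V"
    | e K where "U = Inl ` e K \<union> Inr ` {e' \<in> ends_of T. e' K = e K}" "e \<in> ends_of T" "compactin T K"
    by blast
  then show "openin T (Inl -` U \<inter> topspace T)"
  proof cases
    case 1
    then have "Inl -` U \<inter> topspace T = V"
      using openin_subset by auto
    then show ?thesis using 1 by simp
  next
    case 2
    have "openin T (topspace T - K)"
      using closedin_compactin[OF 2(3)] by (simp add: closedin_def)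
    then have "openin T (e K)"
      using openin_component end_component[OF 2(2,3)] unfolding components_off_def by blast
    moreover from this have "Inl -` U \<inter> topspace T = e K"
      using openin_subset 2 by auto
    ultimately show ?thesis by simp
  qed
next
  show "Inl ` topspace T \<subseteq> \<Union> ({Inl ` U | U. openin T U} \<union>
      {Inl ` e K \<union> Inr ` {e' \<in> ends_of T. e' K = e K} | e K. e \<in> ends_of T \<and> compactin T K})"
    using openin_topspace[of T] by blast
qed

text \<open>The branching step for Koenig's lemma: apart from a compact piece, only the finitely
  many subdivided children remain.\<close>

lemma AA_split:
  assumes w: "w \<in> N"
  shows "AA w \<subseteq> Inl ` KK (Suc (length w)) \<union> (\<Union>j\<in>{j. j # w \<in> N}. AA (j # w))"
proof
  fix y assume "y \<in> AA w"
  then consider x where "y = Inl x" "x \<in> DD w" | e where "y = Inr e" "e \<in> ends_of T" "e (KK (length w)) = DD w"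
    by (auto simp: AA_def)
  then show "y \<in> Inl ` KK (Suc (length w)) \<union> (\<Union>j\<in>{j. j # w \<in> N}. AA (j # w))"
  proof cases
    case 1
    show ?thesis
    proof (cases "x \<in> KK (Suc (length w))")
      case False
      then obtain w' where w': "w' \<in> N" "length w' = Suc (length w)" "x \<in> DD w'"
        using outside_KK[of x "Suc (length w)"] 1 by (auto simp: DD_def)
      then obtain j where "w' = j # w"
        using DD_parent[of w' w x] w 1 by metis
      then show ?thesis
        using w' 1 by (auto simp: AA_def)
    qed (use 1 in auto)
  next
    case 2
    obtain b where b: "follows e b"
      using end_follows 2 by blast
    then have "b (length w) = w"
      using 2 DD_inj w branch_in_N length_branch unfolding follows_def by metis
    then obtain j where j: "b (Suc (length w)) = j # w"
      using b by (auto simp: follows_def branch_def) metis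
    then have "j # w \<in> N" "e (KK (Suc (length w))) = DD (j # w)"
      using b branch_in_N unfolding follows_def by metis+
    then show ?thesis
      using 2 by (auto simp: AA_def)
  qed
qed

text \<open>Koenig's lemma: if \<open>AA w\<close> has no finite subcover, neither has
  \<open>AA\<close> of some child, because the rest is compact. The branch so obtained has an end,
  and a member of the cover around this end contains some \<open>AA (b k)\<close>, a
  contradiction.\<close>

lemma compact_space_freudenthal: "compact_space (freudenthal T)"
  unfolding compact_space_alt
proof (intro allI impI)
  fix \<U> assume \<U>: "(\<forall>U\<in>\<U>. openin (freudenthal T) U) \<and> topspace (freudenthal T) \<subseteq> \<Union>\<U>"
  define fin where "fin S \<longleftrightarrow> (\<exists>\<F>. finite \<F> \<and> \<F> \<subseteq> \<U> \<and> S \<subseteq> \<Union>\<F>)" for S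
  have fin_Un: "fin (S \<union> S')" if "fin S" "fin S'" for S S'
  proof -
    from that obtain \<F> \<F>' where "finite \<F>" "\<F> \<subseteq> \<U>" "S \<subseteq> \<Union>\<F>" "finite \<F>'" "\<F>' \<subseteq> \<U>" "S' \<subseteq> \<Union>\<F>'"
      by (auto simp: fin_def)
    then show ?thesis
      unfolding fin_def by (intro exI[of _ "\<F> \<union> \<F>'"]) auto
  qed
  have fin_UN: "fin (\<Union>i\<in>I. S i)" if "finite I" "\<And>i. i \<in> I \<Longrightarrow> fin (S i)" for I :: "nat set" and S
    using that
  proof (induction I)
    case empty
    then show ?case unfolding fin_def by (intro exI[of _ "{}"]) auto
  next
    case (insert i I)
    then show ?case using fin_Un by simp
  qed
  have fin_mono: "fin S'" if "fin S" "S' \<subseteq> S" for S S'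
    using that unfolding fin_def by blast
  have fin_KK: "fin (Inl ` KK k)" for k
  proof -
    have "compactin (freudenthal T) (Inl ` KK k)"
      using image_compactin[OF compactin_KK continuous_Inl] .
    moreover from this have "Inl ` KK k \<subseteq> \<Union>\<U>"
      using \<U> compactin_subset_topspace[of "freudenthal T" "Inl ` KK k"] by (meson subset_trans)
    ultimately show ?thesis
      using \<U> unfolding fin_def compactin_def by blast
  qed
  have step: "\<exists>j. j # w \<in> N \<and> \<not> fin (AA (j # w))" if w: "w \<in> N" "\<not> fin (AA w)" for w
  proof (rule ccontr)
    assume "\<not> ?thesis"
    moreover have "finite {j. j # w \<in> N}"
      by (rule finite_subset[of _ "{..<L}"]) (auto dest: N_ConsD)
    ultimately have "fin (\<Union>j\<in>{j. j # w \<in> N}. AA (j # w))"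
      by (intro fin_UN) auto
    then have "fin (AA w)"
      using fin_mono[OF fin_Un[OF fin_KK] AA_split[OF w(1)]] by blast
    then show False using w by blast
  qed
  have "fin (AA [])"
  proof (rule ccontr)
    assume nf: "\<not> fin (AA [])"
    define b where "b = rec_nat [] (\<lambda>_ w. (SOME j. j # w \<in> N \<and> \<not> fin (AA (j # w))) # w)"
    have b0: "b 0 = []" and bS: "\<And>k. b (Suc k) = (SOME j. j # b k \<in> N \<and> \<not> fin (AA (j # b k))) # b k"
      by (simp_all add: b_def)
    have bad: "b k \<in> N \<and> \<not> fin (AA (b k))" for k
    proof (induction k)
      case 0
      then show ?case using nf Nil_in_N by (simp add: b0)
    next
      case (Suc k)
      then show ?case
        unfolding bS by (intro someI_ex[of "\<lambda>j. j # b k \<in> N \<and> \<not> fin (AA (j # b k))"] step) auto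
    qed
    then have "branch b"
      using b0 bS by (auto simp: branch_def)
    then obtain e where e: "e \<in> ends_of T" "follows e b"
      by (rule end_of_branch)
    then obtain U where "U \<in> \<U>" "Inr e \<in> U"
      using \<U> by (auto simp: topspace_freudenthal)
    then obtain k where "AA (b k) \<subseteq> U"
      using end_nbhd \<U> e by blast
    then have "fin (AA (b k))"
      unfolding fin_def using \<open>U \<in> \<U>\<close> by (intro exI[of _ "{U}"]) auto
    then show False using bad by blast
  qed
  moreover have "topspace (freudenthal T) \<subseteq> Inl ` KK 0 \<union> AA []"
  proof -
    have "x \<in> KK 0 \<or> x \<in> DD []" if "x \<in> complex_points X" for x
      using outside_KK[of x 0] that by auto
    moreover have "e (KK 0) = DD []" if "e \<in> ends_of T" for e
      using end_component[OF that compactin_KK, of 0] by (auto simp: components_off_KK)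
    ultimately have "Inl x \<in> Inl ` KK 0 \<union> AA []" if "x \<in> complex_points X" for x
      using that unfolding AA_def by blast
    moreover have "Inr ` ends_of T \<subseteq> AA []"
      using \<open>\<And>e. e \<in> ends_of T \<Longrightarrow> e (KK 0) = DD []\<close> unfolding AA_def by auto
    ultimately show ?thesis
      by (auto simp: topspace_freudenthal topspace_one_complex)
  qed
  ultimately have "fin (topspace (freudenthal T))"
    using fin_mono fin_Un fin_KK by meson
  then show "\<exists>\<F>. finite \<F> \<and> \<F> \<subseteq> \<U> \<and> topspace (freudenthal T) \<subseteq> \<Union>\<F>"
    by (simp add: fin_def)
qed

end

text \<open>A compact convex model of the disk in which one boundary arc is a straight segment.\<close>

definition lens :: "complex set" where
  "lens = {z. 0 \<le> Im z \<and> Im z \<le> Re z * (1 - Re z)}"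

definition lens_inner :: "complex set" where
  "lens_inner = {z. 0 < Im z \<and> Im z < Re z * (1 - Re z)}"

lemma lens_Re: assumes "z \<in> lens" shows "0 \<le> Re z" "Re z \<le> 1"
proof -
  have "0 \<le> Re z * (1 - Re z)"
    using assms by (auto simp: lens_def)
  then show "0 \<le> Re z" "Re z \<le> 1"
    by (auto simp: zero_le_mult_iff)
qed

lemma convex_lens: "convex lens"
proof (rule convexI)
  fix x y :: complex and u v :: real
  assume xy: "x \<in> lens" "y \<in> lens" and uv: "0 \<le> u" "0 \<le> v" "u + v = 1"
  have v: "v = 1 - u"
    using uv by simp
  have "u * Im x + v * Im y \<le> u * (Re x * (1 - Re x)) + v * (Re y * (1 - Re y))"
    using xy uv by (intro add_mono mult_left_mono) (auto simp: lens_def)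
  \<comment> \<open>Concavity of \<open>x * (1 - x)\<close> in explicit form; the subtracted term is
    the defect.\<close>
  also have "\<dots> = (u * Re x + v * Re y) * (1 - (u * Re x + v * Re y)) - u * v * (Re x - Re y)\<^sup>2"
    unfolding v by (simp add: algebra_simps power2_eq_square)
  also have "\<dots> \<le> (u * Re x + v * Re y) * (1 - (u * Re x + v * Re y))"
    using uv by simp
  finally have "u * Im x + v * Im y \<le> (u * Re x + v * Re y) * (1 - (u * Re x + v * Re y))" .
  then show "u *\<^sub>R x + v *\<^sub>R y \<in> lens"
    using xy uv by (auto simp: lens_def)
qed

lemma compact_lens: "compact lens"
proof (rule compact_eq_bounded_closed[THEN iffD2, OF conjI])
  show "closed lens"
    unfolding lens_def by (intro closed_Collect_conj closed_Collect_le continuous_intros)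
  have "cmod z \<le> 2" if "z \<in> lens" for z
  proof -
    have "Re z * (1 - Re z) \<le> 1 * 1"
      using lens_Re[OF that] by (intro mult_mono) auto
    then have "\<bar>Re z\<bar> + \<bar>Im z\<bar> \<le> 2"
      using lens_Re[OF that] that by (auto simp: lens_def)
    then show ?thesis
      using cmod_le[of z] by linarith
  qed
  then show "bounded lens"
    by (auto simp: bounded_iff)
qed

lemma interior_lens: "interior lens = lens_inner"
proof
  have "open lens_inner"
    unfolding lens_inner_def by (intro open_Collect_conj open_Collect_less continuous_intros)
  then show "lens_inner \<subseteq> interior lens"
    by (intro interior_maximal) (auto simp: lens_def lens_inner_def)
  show "interior lens \<subseteq> lens_inner"
  proof
    fix z assume z: "z \<in> interior lens"
    then obtain e where e: "e > 0" "ball z e \<subseteq> lens"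
      by (auto simp: mem_interior)
    \<comment> \<open>Shifting down makes the first inequality of the lens strict at
      \<open>z\<close>, shifting up the second.\<close>
    have "z - \<i> * (e / 2) \<in> ball z e" "z + \<i> * (e / 2) \<in> ball z e"
      using e(1) by (auto simp: dist_norm norm_mult)
    then have "z - \<i> * (e / 2) \<in> lens" "z + \<i> * (e / 2) \<in> lens"
      using e by auto
    then show "z \<in> lens_inner"
      using e(1) by (auto simp: lens_def lens_inner_def)
  qed
qed

text \<open>Invariance of domain. Applied in both directions it lets \<open>lens_disk\<close> match
  the boundary of the lens with the circle.\<close>

lemma homeomorphism_interior:
  fixes f :: "'a::euclidean_space \<Rightarrow> 'a"
  assumes "homeomorphism S S' f g" shows "f ` interior S \<subseteq> interior S'"
proof (rule interior_maximal)
  show "f ` interior S \<subseteq> S'"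
    using assms interior_subset by (auto simp: homeomorphism_def)
  have "inj_on f S"
    using assms by (metis homeomorphism_def inj_on_inverseI)
  then show "open (f ` interior S)"
    using assms inj_on_subset[OF _ interior_subset] continuous_on_subset[OF _ interior_subset]
    by (intro invariance_of_domain) (auto simp: homeomorphism_def)
qed

lemma lens_disk:
  obtains f g where "homeomorphism lens (cball (0::complex) 1) f g"
    "\<And>z. z \<in> lens \<Longrightarrow> f z \<in> sphere 0 1 \<longleftrightarrow> z \<notin> lens_inner"
proof -
  have "Complex (1/2) (1/8) \<in> lens_inner"
    by (simp add: lens_inner_def)
  then have "interior lens \<noteq> {}"
    using interior_lens by auto
  then have "lens homeomorphic cball (0::complex) 1"
    using homeomorphic_convex_compact_cball[OF convex_lens compact_lens, of 1] by simp
  then obtain f g where fg: "homeomorphism lens (cball (0::complex) 1) f g"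
    by (auto simp: homeomorphic_def)
  have "f z \<in> sphere 0 1 \<longleftrightarrow> z \<notin> lens_inner" if z: "z \<in> lens" for z
  proof -
    have "f z \<in> ball 0 1" if "z \<in> lens_inner"
      using homeomorphism_interior[OF fg] that interior_lens by auto
    moreover have "z \<in> lens_inner" if "f z \<in> ball 0 1"
      using homeomorphism_interior[OF homeomorphism_symD[OF fg]] that interior_lens z fg
      by (auto simp: homeomorphism_def) (metis image_eqI mem_ball_0 subsetD)
    moreover have "f z \<in> cball 0 1"
      using fg z by (auto simp: homeomorphism_def)
    then have "f z \<in> sphere 0 1 \<longleftrightarrow> f z \<notin> ball 0 1"
      using order_less_le by auto
    ultimately show ?thesis by blast
  qed
  then show ?thesis using fg that by blast
qed

context cell_graph
begin

section \<open>The drawing of the compactification in the lens\<close>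

definition place :: "('v \<Rightarrow> real) + (('v \<Rightarrow> real) set \<Rightarrow> ('v \<Rightarrow> real) set) \<Rightarrow> complex" where
  "place = case_sum draw (\<lambda>e. complex_of_real (end_pos e))"

lemma place_Inl [simp]: "place (Inl x) = draw x" and place_Inr [simp]: "place (Inr e) = complex_of_real (end_pos e)"
  by (simp_all add: place_def)

lemma end_pos_bounds:
  assumes "follows e b" shows "l (b k) < end_pos e" "end_pos e < h (b k)"
  using lo_less_limit limit_less_hi end_pos_eq[OF assms] assms by (auto simp: follows_def)

text \<open>A crude bound, one factor of the height being at most \<open>len L w\<close> and the
  other at most 1; it only has to tend to 0 along a branch.\<close>

lemma draw_DD:
  assumes "w \<in> N" "x \<in> DD w"
  shows "0 \<le> Im (draw x)" "Im (draw x) \<le> len L w"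
proof -
  obtain v t where x: "v @ w \<in> W" "t \<in> {0..1}" "x = epoint (v @ w) t"
    using DD_E assms by blast
  then have d: "draw x = curve (v @ w) t"
    using draw_epoint by simp
  show "0 \<le> Im (draw x)"
    using d Im_curve_nonneg x by simp
  have r: "l (v @ w) \<le> Re (draw x)" "Re (draw x) \<le> h (v @ w)" "l w \<le> l (v @ w)" "h (v @ w) \<le> h w" "h (v @ w) \<le> 1" "0 \<le> l (v @ w)"
    using d Re_curve_bounds[of t "v @ w"] x nested[of v w] hi_le_1[of "v @ w"] lo_nonneg[of "v @ w"] by auto
  then have "(Re (draw x) - l (v @ w)) * (h (v @ w) - Re (draw x)) \<le> len L w * 1"
    by (intro mult_mono) (auto simp: hi_def)
  then show "Im (draw x) \<le> len L w"
    using d len_pos[of w] by (auto simp: Im_curve)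
qed

text \<open>The factor 2 accounts for one cell length in each coordinate.\<close>

lemma place_AA_close:
  assumes b: "follows e b" and y: "y \<in> AA (b k)"
  shows "cmod (place y - place (Inr e)) \<le> 2 * len L (b k)"
proof -
  have k: "b k \<in> N" "length (b k) = k"
    using b branch_in_N length_branch by (auto simp: follows_def)
  have "l (b k) \<le> Re (place y) \<and> Re (place y) \<le> h (b k) \<and> 0 \<le> Im (place y) \<and> Im (place y) \<le> len L (b k)"
  proof -
    from y consider x where "y = Inl x" "x \<in> DD (b k)"
      | e' where "y = Inr e'" "e' \<in> ends_of T" "e' (KK k) = DD (b k)"
      using k by (auto simp: AA_def)
    then show ?thesis
    proof cases
      case 1
      then show ?thesis using draw_DD k by (auto simp: DD_def)
    next
      case 2
      obtain b' where b': "follows e' b'"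
        using end_follows 2 by blast
      then have "b' k = b k"
        using 2 k DD_inj branch_in_N length_branch unfolding follows_def by metis
      then show ?thesis
        using 2 end_pos_bounds[OF b', of k] len_pos[of "b k"] by auto
    qed
  qed
  then have "\<bar>Re (place y - place (Inr e))\<bar> \<le> len L (b k)" "\<bar>Im (place y - place (Inr e))\<bar> \<le> len L (b k)"
    using end_pos_bounds[OF b, of k] by (auto simp: hi_def)
  then show ?thesis
    using cmod_le[of "place y - place (Inr e)"] by linarith
qed

lemma continuous_place: "continuous_map (freudenthal T) euclidean place"
proof -
  have "openin (freudenthal T) {y \<in> topspace (freudenthal T). place y \<in> V}" if V: "open V" for V
    unfolding openin_iff_nbhd[of _ "{y \<in> topspace (freudenthal T). place y \<in> V}"]
  proof
    fix y assume y: "y \<in> {y \<in> topspace (freudenthal T). place y \<in> V}"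
    then consider x where "y = Inl x" "x \<in> topspace T" | e where "y = Inr e" "e \<in> ends_of T"
      by (auto simp: topspace_freudenthal)
    then show "\<exists>U. openin (freudenthal T) U \<and> y \<in> U \<and> U \<subseteq> {y \<in> topspace (freudenthal T). place y \<in> V}"
    proof cases
      case 1
      have "openin T {x \<in> topspace T. draw x \<in> V}"
        using V by (intro openin_continuous_map_preimage[OF continuous_draw]) simp
      then have "openin (freudenthal T) (Inl ` {x \<in> topspace T. draw x \<in> V})"
        by (rule openin_Inl)
      then show ?thesis
        using 1 y by (intro exI[of _ "Inl ` {x \<in> topspace T. draw x \<in> V}"]) (auto simp: topspace_freudenthal)
    next
      case 2
      obtain \<epsilon> where \<epsilon>: "\<epsilon> > 0" "\<And>z. dist z (place y) < \<epsilon> \<Longrightarrow> z \<in> V"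
        using V y by (auto simp: open_dist)
      obtain b where b: "follows e b"
        using end_follows 2 by blast
      obtain k where k: "\<And>w. length w = k \<Longrightarrow> len L w < \<epsilon> / 2"
        using small_cell[of "\<epsilon> / 2"] \<epsilon>(1) by auto
      have bk: "length (b k) = k" "e (KK k) = DD (b k)"
        using b length_branch by (auto simp: follows_def)
      have o: "openin (freudenthal T) (AA (b k))"
        using openin_AA[of e "b k"] 2 bk by simp
      have "place y' \<in> V" if "y' \<in> AA (b k)" for y'
        using place_AA_close[OF b that] k[OF bk(1)] \<epsilon>(2)[of "place y'"] 2 by (simp add: dist_norm)
      moreover have "y \<in> AA (b k)"
        using 2 bk by (auto simp: AA_def)
      ultimately show ?thesis
        using o openin_subset[OF o] by (intro exI[of _ "AA (b k)"]) auto
    qed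
  qed
  then show ?thesis
    by (auto simp: continuous_map_def)
qed

text \<open>An arc over a subdivided cell touches the axis only at its ends, and these are ends of
  flat cells by \<open>flat_at_point\<close>.\<close>

lemma draw_on_axis:
  assumes x: "x \<in> complex_points X" "Im (draw x) = 0"
  obtains w t where "w \<in> W - N" "t \<in> {0..1}" "x = epoint w t"
proof -
  obtain w t where wt: "w \<in> W" "t \<in> {0..1}" "x = epoint w t"
    using x pointE by blast
  show ?thesis
  proof (cases "w \<in> N")
    case False
    then show ?thesis using wt that by blast
  next
    case True
    then have "(Re (curve w t) - l w) * (h w - Re (curve w t)) = 0"
      using x wt draw_epoint Im_curve by simp
    then have "Re (curve w t) = Re (curve w 0) \<or> Re (curve w t) = Re (curve w 1)"
      by auto
    then have "t = 0 \<or> t = 1"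
      using Re_curve_inj by blast
    then obtain p where p: "p \<in> points" "x = vx p"
      using wt lo_in_points[of w] hi_in_points[of w] epoint_0[of w] epoint_1[of w] by metis
    then obtain w' where w': "w' \<in> W - N" "p = l w' \<or> p = h w'"
      using flat_at_point by blast
    then have "x = epoint w' 0 \<or> x = epoint w' 1"
      using p by auto
    then show ?thesis
      using that[of w' 0] that[of w' 1] w' by auto
  qed
qed

text \<open>At the depth of \<open>w\<close> the branch passes through a cell of \<open>N\<close>,
  so through a cell other than \<open>w\<close>, and its limit lies strictly inside that
  cell.\<close>

lemma branch_avoids_flat:
  assumes b: "branch b" and w: "w \<in> W - N"
  shows "limit b < l w \<or> h w < limit b"
proof -
  let ?u = "b (length w)"
  have u: "?u \<in> N" "?u \<in> W" "length ?u = length w"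
    using b branch_in_N branch_in_W length_branch by auto
  moreover have "?u \<noteq> w"
    using u w by auto
  ultimately have "h ?u \<le> l w \<or> h w \<le> l ?u"
    using disjoint_same_length[of ?u w] w by auto
  then show ?thesis
    using lo_less_limit[OF b, of "length w"] limit_less_hi[OF b, of "length w"] by auto
qed

lemma draw_neq_end:
  assumes "x \<in> complex_points X" "e \<in> ends_of T"
  shows "draw x \<noteq> complex_of_real (end_pos e)"
proof
  assume eq: "draw x = complex_of_real (end_pos e)"
  then obtain w t where w: "w \<in> W - N" "t \<in> {0..1}" "x = epoint w t"
    using draw_on_axis[of x] assms by auto
  obtain b where b: "follows e b"
    using end_follows assms by blast
  have "l w \<le> end_pos e" "end_pos e \<le> h w"
    using Re_curve_bounds[OF w(2), of w] draw_epoint[of w t] w eq by auto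
  then show False
    using branch_avoids_flat[OF _ w(1), of b] b end_pos_eq[OF b] by (auto simp: follows_def)
qed

lemma inj_place: "inj_on place (topspace (freudenthal T))"
proof -
  have "e = e'" if ee: "e \<in> ends_of T" "e' \<in> ends_of T" "end_pos e = end_pos e'" for e e'
  proof -
    obtain b b' where b: "follows e b" "follows e' b'"
      using end_follows ee by metis
    then have "b = b'"
      using limit_inj[of b b'] end_pos_eq[OF b(1)] end_pos_eq[OF b(2)] ee(3) by (auto simp: follows_def)
    then show ?thesis
      using end_determined ee b by blast
  qed
  then have inj_end: "inj_on (\<lambda>e. complex_of_real (end_pos e)) (ends_of T)"
    by (auto intro: inj_onI)
  show ?thesis
  proof (rule inj_onI)
    fix y y' assume "y \<in> topspace (freudenthal T)" "y' \<in> topspace (freudenthal T)" "place y = place y'"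
    then show "y = y'"
      using inj_onD[OF inj_draw] inj_onD[OF inj_end] draw_neq_end
      by (cases y; cases y') (auto simp: topspace_freudenthal topspace_one_complex, metis+)
  qed
qed

lemma draw_in_lens:
  assumes "x \<in> complex_points X" shows "draw x \<in> lens"
proof -
  obtain w t where wt: "w \<in> W" "t \<in> {0..1}" "x = epoint w t"
    using assms pointE by blast
  let ?z = "curve w t"
  have r: "l w \<le> Re ?z" "Re ?z \<le> h w" "0 \<le> l w" "h w \<le> 1"
    using Re_curve_bounds[of t w] wt lo_nonneg hi_le_1 by auto
  then have "(Re ?z - l w) * (h w - Re ?z) \<le> Re ?z * (1 - Re ?z)"
    by (intro mult_mono) auto
  moreover have "0 \<le> Re ?z * (1 - Re ?z)"
    using r by (intro mult_nonneg_nonneg) auto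
  ultimately show ?thesis
    using wt draw_epoint Im_curve_nonneg[of t w] by (auto simp: lens_def Im_curve)
qed

lemma place_in_lens: "y \<in> topspace (freudenthal T) \<Longrightarrow> place y \<in> lens"
proof -
  assume "y \<in> topspace (freudenthal T)"
  then consider x where "y = Inl x" "x \<in> complex_points X" | e where "y = Inr e" "e \<in> ends_of T"
    by (auto simp: topspace_freudenthal topspace_one_complex)
  then show "place y \<in> lens"
  proof cases
    case 2
    then obtain b where b: "follows e b"
      using end_follows by blast
    then have "b 0 = []"
      by (auto simp: follows_def branch_def)
    then have "0 < end_pos e" "end_pos e < 1"
      using end_pos_bounds[OF b, of 0] by auto
    then show ?thesis
      using 2 by (auto simp: lens_def)
  qed (use draw_in_lens in auto)
qed

lemma child_at:
  assumes "l w \<le> x" "x \<le> h w"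
  obtains j where "j < L" "l (j # w) \<le> x" "x \<le> h (j # w)"
proof -
  have "\<exists>j<L. l (j # w) \<le> x \<and> x \<le> h (j # w)" if "0 < m" "m \<le> L" "x \<le> h ((m - 1) # w)" for m
    using that
  proof (induction m)
    case (Suc m)
    show ?case
    proof (cases "l (m # w) \<le> x")
      case False
      then have "m \<noteq> 0"
        using assms(1) by (metis lo_Cons_0)
      then have "x \<le> h ((m - 1) # w)"
        using False lo_Cons_Suc[of "m - 1" w] by auto
      then show ?thesis using Suc \<open>m \<noteq> 0\<close> by auto
    next
      case True
      then show ?thesis using Suc.prems by (intro exI[of _ m]) simp
    qed
  qed auto
  from this[of L] show ?thesis
    using that assms hi_Cons_last[of w] L_ge2 by auto
qed

text \<open>A point in no flat cell can be followed through subdivided cells forever, and is the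
  limit of the resulting branch.\<close>

lemma axis_covered:
  assumes x: "0 \<le> x" "x \<le> 1"
  shows "complex_of_real x \<in> place ` topspace (freudenthal T)"
proof (cases "\<exists>w\<in>W - N. l w \<le> x \<and> x \<le> h w")
  case True
  then obtain w where w: "w \<in> W" "w \<notin> N" "l w \<le> x" "x \<le> h w" by auto
  define t where "t = (x - l w) / len L w"
  have t: "t \<in> {0..1}"
    using w len_pos[of w] by (auto simp: t_def hi_def)
  have "curve w t = complex_of_real x"
    using w len_pos[of w] by (simp add: curve_def t_def complex_eq_iff)
  then have "place (Inl (epoint w t)) = complex_of_real x"
    using draw_epoint w t by simp
  moreover have "Inl (epoint w t) \<in> topspace (freudenthal T)"
    using epoint_in[OF w(1) t] by (simp add: topspace_freudenthal topspace_one_complex)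
  ultimately show ?thesis by (metis image_eqI)
next
  case False
  have step: "\<exists>j. j # w \<in> N \<and> l (j # w) \<le> x \<and> x \<le> h (j # w)" if w: "w \<in> N" "l w \<le> x \<and> x \<le> h w" for w
  proof -
    obtain j where "j < L" "l (j # w) \<le> x" "x \<le> h (j # w)"
      using child_at w by blast
    then show ?thesis using False w(1) by (auto simp: Cons_in_W)
  qed
  define b where "b = rec_nat [] (\<lambda>_ w. (SOME j. j # w \<in> N \<and> l (j # w) \<le> x \<and> x \<le> h (j # w)) # w)"
  have b0: "b 0 = []" and bS: "\<And>k. b (Suc k) = (SOME j. j # b k \<in> N \<and> l (j # b k) \<le> x \<and> x \<le> h (j # b k)) # b k"
    by (simp_all add: b_def)
  have bN: "b k \<in> N \<and> l (b k) \<le> x \<and> x \<le> h (b k)" for k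
  proof (induction k)
    case 0
    then show ?case using x Nil_in_N by (simp add: b0)
  next
    case (Suc k)
    then show ?case
      unfolding bS by (intro someI_ex[of "\<lambda>j. j # b k \<in> N \<and> l (j # b k) \<le> x \<and> x \<le> h (j # b k)"] step) auto
  qed
  then have b: "branch b"
    using b0 bS by (auto simp: branch_def)
  then obtain e where e: "e \<in> ends_of T" "follows e b"
    by (rule end_of_branch)
  have "end_pos e = x"
    using limit_unique[OF b, of x] bN end_pos_eq[OF e(2)] by auto
  then have "place (Inr e) = complex_of_real x"
    by simp
  moreover have "Inr e \<in> topspace (freudenthal T)"
    using e by (simp add: topspace_freudenthal)
  ultimately show ?thesis by (metis image_eqI)
qed

text \<open>The lower boundary is the axis, the upper one is the arc over the root cell, which
  explains the equation chosen for the lens.\<close>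

lemma lens_boundary_covered:
  assumes z: "z \<in> lens" "z \<notin> lens_inner"
  shows "z \<in> place ` topspace (freudenthal T)"
proof (cases "Im z = 0")
  case True
  then have "z = complex_of_real (Re z)"
    by (simp add: complex_eq_iff)
  then show ?thesis
    using axis_covered[of "Re z"] lens_Re[OF z(1)] by simp
next
  case False
  then have "Im z = Re z * (1 - Re z)"
    using z by (auto simp: lens_def lens_inner_def)
  then have "curve [] (Re z) = z"
    using Nil_in_N by (simp add: curve_def complex_eq_iff len_def)
  then have "place (Inl (epoint [] (Re z))) = z"
    using draw_epoint[of "[]" "Re z"] lens_Re[OF z(1)] by simp
  moreover have "Inl (epoint [] (Re z)) \<in> topspace (freudenthal T)"
    using epoint_in[of "[]" "Re z"] lens_Re[OF z(1)] by (simp add: topspace_freudenthal topspace_one_complex)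
  ultimately show ?thesis by (metis image_eqI)
qed

section \<open>The graph conditions and outerplanarity\<close>

lemma simple_graph_X: "simple_graph X"
proof -
  have "{\<gamma> (l w), \<gamma> (h w)} \<subseteq> verts X" if "w \<in> W" for w
    using that lo_in_points hi_in_points by (auto simp: verts_X)
  moreover have "card {\<gamma> (l w), \<gamma> (h w)} = 2" if "w \<in> W" for w
    using \<gamma>_lo_neq_hi[OF that] by simp
  ultimately show ?thesis
    unfolding simple_graph_def edges_X by blast
qed

lemma locally_finite_X: "locally_finite_graph X"
  unfolding locally_finite_graph_def
proof
  fix v assume "v \<in> verts X"
  then obtain p where p: "p \<in> points" "v = \<gamma> p"
    by (auto simp: verts_X)
  have "{e \<in> edges X. v \<in> e} \<subseteq> (\<lambda>w. {\<gamma> (l w), \<gamma> (h w)}) ` ({w \<in> W. l w = p} \<union> {w \<in> W. h w = p})"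
    using p \<gamma>_eq_iff lo_in_points hi_in_points by (auto simp: edges_X)
  then show "finite {e \<in> edges X. v \<in> e}"
    using finite_lo finite_hi by (meson finite_UnI finite_imageI finite_subset)
qed

lemma connected_X: "connected_graph X"
proof -
  let ?R = "{(u, v). {u, v} \<in> edges X}"
  have sym: "sym (?R\<^sup>*)"
    by (intro sym_rtrancl) (auto simp: sym_def insert_commute)
  have edge: "(\<gamma> (l w), \<gamma> (h w)) \<in> ?R" if "w \<in> W" for w
    using that by (auto simp: edges_X)
  have ends: "(\<gamma> 0, \<gamma> (l w)) \<in> ?R\<^sup>* \<and> (\<gamma> 0, \<gamma> (h w)) \<in> ?R\<^sup>*" if "w \<in> W" for w
    using that
  proof (induction w)
    case Nil
    then show ?case using edge[of "[]"] by auto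
  next
    case (Cons i w)
    then have w: "w \<in> N" "(\<gamma> 0, \<gamma> (l w)) \<in> ?R\<^sup>*" "i < L"
      by (auto simp: Cons_in_W N_subset_W)
    have "(\<gamma> 0, \<gamma> (l (j # w))) \<in> ?R\<^sup>*" if "j < L" for j
      using that
    proof (induction j)
      case (Suc j)
      then show ?case
        using edge[of "j # w"] w by (auto simp: Cons_in_W lo_Cons_Suc intro: rtrancl_into_rtrancl)
    qed (use w in simp)
    then show ?case
      using edge[OF Cons.prems] w(3) by (meson rtrancl.rtrancl_into_rtrancl)
  qed
  have "(\<gamma> 0, x) \<in> ?R\<^sup>*" if "x \<in> verts X" for x
    using that ends by (auto simp: verts_X points_def)
  moreover have "verts X \<noteq> {}"
    using lo_in_points[of "[]"] by (auto simp: verts_X)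
  ultimately show ?thesis
    unfolding connected_graph_def using sym by (meson rtrancl_trans symD)
qed

text \<open>A continuous injection of a compact space into the disk is a closed map, hence an
  embedding. The Hamiltonian circle can therefore be taken as the preimage \<open>H\<close> of the
  boundary circle, which is covered by \<open>lens_boundary_covered\<close>.\<close>

theorem outerplanar_X: "outerplanar X"
proof -
  let ?F = "freudenthal T" and ?B = "cball (0::complex) 1"
  obtain f g where fg: "homeomorphism lens ?B f g"
    and bd: "\<And>z. z \<in> lens \<Longrightarrow> f z \<in> sphere 0 1 \<longleftrightarrow> z \<notin> lens_inner"
    by (rule lens_disk) blast
  have "continuous_map ?F (top_of_set lens) place"
    using continuous_place place_in_lens by (auto simp: continuous_map_in_subtopology)
  moreover have "continuous_map (top_of_set lens) (top_of_set ?B) f"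
    using fg by (auto simp: homeomorphism_def)
  ultimately have cont: "continuous_map ?F (top_of_set ?B) (f \<circ> place)"
    by (rule continuous_map_compose)
  have "inj_on f lens"
    using fg by (metis homeomorphism_def inj_on_inverseI)
  then have inj: "inj_on (f \<circ> place) (topspace ?F)"
    using inj_place place_in_lens by (intro comp_inj_on) (auto intro: inj_on_subset)
  have "closed_map ?F (top_of_set ?B) (f \<circ> place)"
    by (rule continuous_imp_closed_map[OF cont compact_space_freudenthal])
       (simp add: Hausdorff_space_subtopology)
  then have emb: "embedding_map ?F (top_of_set ?B) (f \<circ> place)"
    using cont inj by (intro injective_closed_imp_embedding_map)
  define H where "H = {y \<in> topspace ?F. (f \<circ> place) y \<in> sphere 0 1}"
  have H: "(f \<circ> place) ` H = sphere 0 1"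
  proof
    show "sphere 0 1 \<subseteq> (f \<circ> place) ` H"
    proof
      fix u :: complex assume u: "u \<in> sphere 0 1"
      then have g: "g u \<in> lens" "f (g u) = u"
        using fg by (auto simp: homeomorphism_def)
      then have "g u \<notin> lens_inner"
        using bd u by metis
      then obtain y where "y \<in> topspace ?F" "place y = g u"
        using lens_boundary_covered g by (metis imageE)
      then have "y \<in> H" "u = (f \<circ> place) y"
        using g u by (auto simp: H_def)
      then show "u \<in> (f \<circ> place) ` H"
        by blast
    qed
  qed (auto simp: H_def)
  have "homeomorphic_map (subtopology ?F H)
      (subtopology (subtopology (top_of_set ?B) ((f \<circ> place) ` topspace ?F)) (sphere 0 1)) (f \<circ> place)"
    using emb unfolding embedding_map_def
    by (rule homeomorphic_map_subtopologies_alt) (auto simp: H_def)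
  moreover have "subtopology (subtopology (top_of_set ?B) ((f \<circ> place) ` topspace ?F)) (sphere 0 1) = top_of_set (sphere 0 1)"
  proof -
    have "sphere 0 1 \<subseteq> (f \<circ> place) ` topspace ?F"
      using H by (auto simp: H_def)
    then have "?B \<inter> (f \<circ> place) ` topspace ?F \<inter> sphere 0 1 = sphere 0 1"
      using sphere_cball by blast
    then show ?thesis
      by (simp add: subtopology_subtopology)
  qed
  ultimately have "subtopology ?F H homeomorphic_space top_of_set (sphere (0::complex) 1)"
    using homeomorphic_map_imp_homeomorphic_space by metis
  moreover have "Inl (vertex_point v) \<in> H" if v: "v \<in> verts X" for v
  proof -
    obtain p where p: "p \<in> points" "v = \<gamma> p"
      using v by (auto simp: verts_X)
    then obtain w where w: "w \<in> W" "p = l w \<or> p = h w"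
      by (auto simp: points_def)
    then have "vertex_point v = epoint w 0 \<and> p = l w \<or> vertex_point v = epoint w 1 \<and> p = h w"
      using p by auto
    then have "draw (vertex_point v) = complex_of_real p" "vertex_point v \<in> complex_points X"
      using draw_epoint[OF w(1), of 0] draw_epoint[OF w(1), of 1] epoint_in[OF w(1), of 0] epoint_in[OF w(1), of 1] by auto
    then show ?thesis
      using bd[of "complex_of_real p"] draw_in_lens[of "vertex_point v"]
      by (auto simp: H_def topspace_freudenthal topspace_one_complex lens_inner_def)
  qed
  ultimately have "hamiltonian_circle X H"
    by (auto simp: hamiltonian_circle_def H_def)
  then show ?thesis
    unfolding outerplanar_def using simple_graph_X locally_finite_X connected_X emb H by blast
qed

end

section \<open>Words of the surface relator\<close>

text \<open>At every vertex the incident edges are numbered \<open>0, \<dots>, M\<close> in the order of the drawing, \<open>0\<close> being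
  the edge towards \<open>g s\<close> and \<open>M\<close> the one towards \<open>g s\<^sup>-\<^sup>1\<close>. A dart \<open>(r, e)\<close> is the edge of rank \<open>r\<close> at a
  vertex whose ranks run clockwise (\<open>e = 1\<close>) or counterclockwise (\<open>e = -1\<close>). The edge of rank \<open>r\<close>
  has rank \<open>bar r\<close> at its other end, and \<open>sg r\<close> tells whether the orientation changes along it.\<close>

definition turn :: "int \<times> int \<Rightarrow> int \<times> int" where
  "turn q = (fst q + snd q, snd q)"

definition cross :: "(int \<Rightarrow> int) \<Rightarrow> (int \<Rightarrow> int) \<Rightarrow> int \<times> int \<Rightarrow> int \<times> int" where
  "cross bar sg q = (bar (fst q), snd q * sg (fst q))"

definition mirror :: "(int \<Rightarrow> int) \<Rightarrow> (int \<Rightarrow> int) \<Rightarrow> int \<times> int \<Rightarrow> int \<times> int" where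
  "mirror bar sg q = (bar (fst q), - (snd q * sg (fst q)))"

lemma list_prod_Nil [simp]: "list_prod G [] = \<one>\<^bsub>G\<^esub>"
  and list_prod_Cons [simp]: "list_prod G (x # xs) = x \<otimes>\<^bsub>G\<^esub> list_prod G xs"
  by (simp_all add: list_prod_def)

lemma (in monoid) list_prod_closed: "set xs \<subseteq> carrier G \<Longrightarrow> list_prod G xs \<in> carrier G"
  by (induction xs) auto

lemma (in monoid) list_prod_append:
  "set xs \<subseteq> carrier G \<Longrightarrow> set ys \<subseteq> carrier G \<Longrightarrow> list_prod G (xs @ ys) = list_prod G xs \<otimes> list_prod G ys"
  by (induction xs) (auto simp: m_assoc list_prod_closed)

text \<open>The sequence \<open>d\<close> lists the darts met on the way around one face; \<open>s\<close> is the word read along them.\<close>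

locale ribbon = group G for G (structure) +
  fixes A :: "'a set" and s :: 'a and L :: nat and bar sg :: "int \<Rightarrow> int"
    and ltr :: "int \<Rightarrow> 'a \<times> bool" and d :: "nat \<Rightarrow> int \<times> int"
  assumes two_le_L: "2 \<le> L"
    and free: "free_basis G A"
    and ltr_bij: "bij_betw ltr {1..int L} (A \<times> UNIV)"
    and ltr_bar: "r \<in> {1..int L} \<Longrightarrow> ltr (bar r) = (fst (ltr r), \<not> snd (ltr r))"
    and bar_tree: "r \<in> {1..int L} \<Longrightarrow> bar r \<in> {1..int L}"
    and bar_0: "bar 0 = int L + 1" and bar_M: "bar (int L + 1) = 0"
    and sg_0: "sg 0 = 1" and sg_M: "sg (int L + 1) = 1"
    and sg_tree: "r \<in> {1..int L} \<Longrightarrow> (sg r = 1 \<or> sg r = -1) \<and> sg (bar r) = sg r"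
    and d_0: "d 0 = (1, 1)" and d_L: "d L = (int L + 1, 1)"
    and d_tree: "i < L \<Longrightarrow> fst (d i) \<in> {1..int L} \<and> (snd (d i) = 1 \<or> snd (d i) = -1)"
    and d_Suc: "i < L \<Longrightarrow> turn (cross bar sg (d i)) = d (Suc i)"
    and d_cover: "r \<in> {1..int L} \<Longrightarrow> e = 1 \<or> e = -1 \<Longrightarrow> \<exists>i<L. (r, e) = d i \<or> (r, e) = mirror bar sg (d i)"
    and s_eq: "s = list_prod G (map (\<lambda>i. letter_val G (ltr (fst (d i)))) [0..<L])"
begin

abbreviation M :: int where "M \<equiv> int L + 1"
abbreviation "cr \<equiv> cross bar sg"
abbreviation "mir \<equiv> mirror bar sg"

text \<open>The face permutation of a ribbon graph: walk along the edge, then take the neighbouring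
  edge in the rotation. Its orbits are the boundary walks of the polygons.\<close>

definition phi :: "int \<times> int \<Rightarrow> int \<times> int" where
  "phi q = turn (cr q)"

definition lab :: "int \<Rightarrow> 'a" where
  "lab r = (if r = 0 then s else if r = M then inv s else letter_val G (ltr r))"

lemma rank_cases:
  assumes "0 \<le> r" "r \<le> M" obtains "r = 0" | "r = M" | "r \<in> {1..int L}"
  using assms by fastforce

lemma bar_bar: assumes "0 \<le> r" "r \<le> M" shows "bar (bar r) = r"
  using assms
proof (cases rule: rank_cases)
  case 3
  then have "ltr (bar (bar r)) = ltr r" "bar (bar r) \<in> {1..int L}"
    using ltr_bar[of r] ltr_bar[of "bar r"] bar_tree[of r] bar_tree[of "bar r"] by (auto simp: prod_eq_iff)
  then show ?thesis
    using 3 ltr_bij by (meson bij_betw_imp_inj_on inj_onD)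
qed (auto simp: bar_0 bar_M)

lemma bar_range: assumes "0 \<le> r" "r \<le> M" shows "0 \<le> bar r" "bar r \<le> M"
  using assms by (cases rule: rank_cases; use bar_tree[of r] in \<open>force simp: bar_0 bar_M\<close>)+

lemma sg_unit: assumes "0 \<le> r" "r \<le> M" shows "sg r = 1 \<or> sg r = -1" "sg (bar r) = sg r"
  using assms by (cases rule: rank_cases; use sg_tree[of r] in \<open>force simp: bar_0 bar_M sg_0 sg_M\<close>)+

definition darts :: "(int \<times> int) set" where
  "darts = {(r, e). 0 \<le> r \<and> r \<le> M \<and> (e = 1 \<or> e = -1)}"

lemma cr_cr: "q \<in> darts \<Longrightarrow> cr (cr q) = q"
  using bar_bar sg_unit by (force simp: cross_def darts_def)

lemma cr_darts: "q \<in> darts \<Longrightarrow> cr q \<in> darts"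
  using bar_range sg_unit by (force simp: cross_def darts_def)

lemma mir_darts: "q \<in> darts \<Longrightarrow> mir q \<in> darts"
  using bar_range sg_unit by (force simp: mirror_def darts_def)

lemma ltr_closed: assumes "r \<in> {1..int L}" shows "letter_val G (ltr r) \<in> carrier G"
proof -
  have "ltr r \<in> A \<times> UNIV"
    using assms ltr_bij by (meson bij_betwE)
  then have "fst (ltr r) \<in> carrier G"
    using free by (auto simp: free_basis_def)
  then show ?thesis
    by (simp add: letter_val_def)
qed

lemma s_closed: "s \<in> carrier G"
  unfolding s_eq by (rule list_prod_closed) (use ltr_closed d_tree in auto)

lemma lab_closed: assumes "0 \<le> r" "r \<le> M" shows "lab r \<in> carrier G"
  using assms by (cases rule: rank_cases) (use s_closed ltr_closed in \<open>auto simp: lab_def\<close>)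

lemma lab_closed': "q \<in> darts \<Longrightarrow> lab (fst q) \<in> carrier G"
  using lab_closed by (auto simp: darts_def)

lemma lab_bar: assumes "0 \<le> r" "r \<le> M" shows "lab (bar r) = inv (lab r)"
  using assms
proof (cases rule: rank_cases)
  case 3
  then have "lab (bar r) = letter_val G (ltr (bar r))" "lab r = letter_val G (ltr r)"
    using bar_tree[of r] by (auto simp: lab_def)
  moreover have "ltr r \<in> A \<times> UNIV"
    using 3 ltr_bij by (meson bij_betwE)
  then have "fst (ltr r) \<in> carrier G"
    using free by (auto simp: free_basis_def)
  ultimately show ?thesis
    using ltr_bar[OF 3] by (simp add: letter_val_def)
qed (use s_closed in \<open>auto simp: lab_def bar_0 bar_M\<close>)

lemma lab_cr: "q \<in> darts \<Longrightarrow> lab (fst (cr q)) = inv (lab (fst q))"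
  using lab_bar by (auto simp: cross_def darts_def)

lemma lab_mir: "q \<in> darts \<Longrightarrow> lab (fst (mir q)) = inv (lab (fst q))"
  using lab_bar by (auto simp: mirror_def darts_def)

section \<open>Polygons as orbits of the face permutation\<close>

definition dm :: "nat \<Rightarrow> int \<times> int" where
  "dm k = d (k mod Suc L)"

lemma dm_darts: "dm k \<in> darts"
proof (cases "k mod Suc L = L")
  case False
  then have "k mod Suc L < L"
    using mod_less_divisor[of "Suc L" k] by linarith
  then show ?thesis
    using d_tree[of "k mod Suc L"] by (auto simp: dm_def darts_def case_prod_beta)
qed (auto simp: dm_def d_L darts_def)

lemma dm_periodic: "dm (k + Suc L) = dm k"
  by (simp add: dm_def del: add_Suc_right)

text \<open>The step from index \<open>L\<close> back to index \<open>0\<close> crosses the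
  \<open>s\<close>-edge: \<open>(M, 1)\<close> is taken to \<open>(0, 1)\<close> and turned to
  \<open>(1, 1)\<close>. So a polygon has \<open>L + 1\<close> sides.\<close>

lemma phi_dm: "phi (dm k) = dm (Suc k)"
proof (cases "k mod Suc L = L")
  case True
  then have "Suc k mod Suc L = 0"
    by (simp add: mod_Suc)
  then show ?thesis
    using True by (simp add: dm_def phi_def d_L d_0 cross_def turn_def bar_M sg_M)
next
  case False
  then have "k mod Suc L < L"
    using mod_less_divisor[of "Suc L" k] by linarith
  then show ?thesis
    using d_Suc[of "k mod Suc L"] False by (simp add: dm_def phi_def mod_Suc)
qed

text \<open>Mirrored darts traverse a face in the opposite direction.\<close>

lemma phi_mir: assumes "q \<in> darts" "phi q \<in> darts" shows "phi (mir (phi q)) = mir q"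
proof -
  have "cr (mir (phi q)) = (fst (phi q), - snd (phi q))"
    using assms(2) bar_bar sg_unit by (force simp: cross_def mirror_def darts_def)
  then show ?thesis
    by (simp add: phi_def turn_def cross_def mirror_def)
qed

lemma phi_mir_dm: "phi (mir (dm (Suc k))) = mir (dm k)"
  using phi_mir[of "dm k"] by (simp add: phi_dm dm_darts)

lemma funpow_phi_dm: "(phi ^^ j) (dm i) = dm (i + j)"
  by (induction j) (auto simp: phi_dm)

lemma funpow_phi_mir: "(phi ^^ j) (mir (dm (i + j))) = mir (dm i)"
proof (induction j arbitrary: i)
  case (Suc j)
  then show ?case using Suc[of "Suc i"] by (simp add: phi_mir_dm)
qed auto

text \<open>The two excluded darts are the two readings of the side of an \<open>s\<close>-edge on
  which there is no polygon.\<close>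

definition proper :: "(int \<times> int) set" where
  "proper = darts - {(0, 1), (M, -1)}"

text \<open>By \<open>d_cover\<close> every boundary walk is that of \<open>d\<close>, read forwards
  or backwards. Adding a full period in the mirrored case leaves room for \<open>Suc L\<close> steps
  back within the natural numbers.\<close>

lemma proper_cases:
  assumes "q \<in> proper" obtains i where "q = dm i" | i where "q = mir (dm (i + Suc L))"
proof -
  obtain r e where q: "q = (r, e)" "0 \<le> r" "r \<le> M" "e = 1 \<or> e = -1" "(r, e) \<noteq> (0, 1)" "(r, e) \<noteq> (M, -1)"
    using assms by (auto simp: proper_def darts_def)
  have "\<exists>i\<le>L. q = d i \<or> q = mir (d i)"
    using q(2,3)
  proof (cases rule: rank_cases)
    case 1
    then have "q = mir (d L)"
      using q by (auto simp: mirror_def d_L bar_M sg_M)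
    then show ?thesis by blast
  next
    case 2
    then have "q = d L"
      using q by (auto simp: d_L)
    then show ?thesis by blast
  next
    case 3
    then show ?thesis
      using d_cover[of r e] q less_imp_le by metis
  qed
  then obtain i where "i \<le> L" "q = dm i \<or> q = mir (dm i)"
    by (auto simp: dm_def)
  then show ?thesis
    using that dm_periodic by metis
qed

text \<open>The two readings of an \<open>s\<close>-edge from the side of its polygon; nothing lies
  beyond this edge.\<close>

definition flat :: "int \<times> int \<Rightarrow> bool" where
  "flat q \<longleftrightarrow> q = (M, 1) \<or> q = (0, -1)"

lemma tree_index: "k mod Suc L \<noteq> L \<Longrightarrow> fst (dm k) \<in> {1..int L}"
  using d_tree[of "k mod Suc L"] mod_less_divisor[of "Suc L" k] unfolding dm_def by linarith

lemma flat_dm: "flat (dm k) \<longleftrightarrow> k mod Suc L = L"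
proof (cases "k mod Suc L = L")
  case False
  then show ?thesis using tree_index[OF False] by (auto simp: flat_def)
qed (simp add: flat_def dm_def d_L)

lemma flat_mir: "flat (mir (dm k)) \<longleftrightarrow> k mod Suc L = L"
proof (cases "k mod Suc L = L")
  case False
  then have "bar (fst (dm k)) \<in> {1..int L}"
    using tree_index bar_tree by blast
  then show ?thesis using False by (auto simp: flat_def mirror_def)
qed (simp add: flat_def dm_def d_L mirror_def bar_M sg_M)

lemma dm_proper: "dm k \<in> proper"
proof (cases "k mod Suc L = L")
  case False
  then show ?thesis using tree_index[OF False] dm_darts[of k] by (auto simp: proper_def)
qed (use dm_darts[of k] in \<open>auto simp: proper_def dm_def d_L\<close>)

lemma mir_dm_proper: "mir (dm k) \<in> proper"
proof (cases "k mod Suc L = L")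
  case False
  then have "fst (mir (dm k)) \<in> {1..int L}"
    using tree_index bar_tree by (simp add: mirror_def)
  then show ?thesis using mir_darts[OF dm_darts[of k]] by (auto simp: proper_def)
next
  case True
  then show ?thesis using mir_darts[OF dm_darts[of k]]
    by (auto simp: proper_def dm_def d_L mirror_def bar_M sg_M)
qed

lemma phi_proper: assumes "q \<in> proper" shows "phi q \<in> proper"
  using assms
proof (cases rule: proper_cases)
  case (2 i)
  then show ?thesis using phi_mir_dm[of "i + L"] mir_dm_proper by simp
qed (use phi_dm dm_proper in simp)

lemma funpow_proper: "q \<in> proper \<Longrightarrow> (phi ^^ j) q \<in> proper"
  by (induction j) (auto simp: phi_proper)

lemma phi_period: assumes "q \<in> proper" shows "(phi ^^ Suc L) q = q"
  using assms
proof (cases rule: proper_cases)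
  case (1 i)
  then show ?thesis using funpow_phi_dm[of "Suc L" i] dm_periodic by simp
next
  case (2 i)
  then show ?thesis using funpow_phi_mir[of "Suc L" i] dm_periodic by metis
qed

lemma mod_Suc_inj:
  assumes "(i + a) mod Suc L = (i + b) mod Suc L" "a \<le> L" "b \<le> L" shows "a = b"
proof -
  have "[i + a = i + b] (mod Suc L)" 
    using assms(1) by (simp add: cong_def)
  then have "[a = b] (mod Suc L)"
    by (simp add: cong_add_lcancel_nat)
  then show ?thesis
    using assms(2,3) by (simp add: cong_def)
qed

text \<open>A polygon has a single \<open>s\<close>-side, at index \<open>L\<close> modulo
  \<open>Suc L\<close>, and the indices up to \<open>L\<close> make up one period.\<close>

lemma flat_unique:
  assumes q: "q \<in> proper" and "flat ((phi ^^ i) q)" "flat ((phi ^^ j) q)" "i \<le> L" "j \<le> L"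
  shows "i = j"
  using q
proof (cases rule: proper_cases)
  case (1 k)
  then have "(k + i) mod Suc L = (k + j) mod Suc L"
    using assms flat_dm by (simp add: funpow_phi_dm)
  then show ?thesis using mod_Suc_inj assms by blast
next
  case (2 k)
  have *: "(phi ^^ m) q = mir (dm (k + (Suc L - m)))" if "m \<le> L" for m
    using funpow_phi_mir[of m "k + (Suc L - m)"] that 2 by (simp del: funpow.simps)
  then have "(Suc k + (L - i)) mod Suc L = (Suc k + (L - j)) mod Suc L"
    using assms flat_mir by (simp add: Suc_diff_le)
  then have "L - i = L - j"
    by (rule mod_Suc_inj) auto
  then show ?thesis using assms by linarith
qed

section \<open>Group elements read along the sides of a polygon\<close>

primrec chain :: "int \<times> int \<Rightarrow> nat \<Rightarrow> 'a" where
  "chain q 0 = \<one>"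
| "chain q (Suc j) = chain q j \<otimes> lab (fst ((phi ^^ j) q))"

lemma proper_darts: "q \<in> proper \<Longrightarrow> q \<in> darts"
  by (simp add: proper_def)

lemma lab_funpow: "q \<in> proper \<Longrightarrow> lab (fst ((phi ^^ j) q)) \<in> carrier G"
  using funpow_proper proper_darts lab_closed' by blast

lemma chain_closed: "q \<in> proper \<Longrightarrow> chain q j \<in> carrier G"
  by (induction j) (auto simp: lab_funpow)

lemma chain_add: "q \<in> proper \<Longrightarrow> chain q (i + j) = chain q i \<otimes> chain ((phi ^^ i) q) j"
proof (induction j)
  case (Suc j)
  have "(phi ^^ j) ((phi ^^ i) q) = (phi ^^ (i + j)) q"
    by (metis add.commute comp_apply funpow_add)
  then show ?case
    using Suc chain_closed lab_funpow funpow_proper by (simp add: m_assoc)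
qed (simp add: chain_closed)

lemma chain_front: "q \<in> proper \<Longrightarrow> chain q (Suc j) = lab (fst q) \<otimes> chain (phi q) j"
  using chain_add[of q 1 j] lab_funpow[of q 0] by simp

lemma chain_face: "j \<le> L \<Longrightarrow> chain (dm 0) j = list_prod G (map (\<lambda>i. letter_val G (ltr (fst (d i)))) [0..<j])"
proof (induction j)
  case (Suc j)
  have "lab (fst (dm j)) = letter_val G (ltr (fst (d j)))"
    using Suc.prems d_tree[of j] by (auto simp: lab_def dm_def)
  moreover have "letter_val G (ltr (fst (d i))) \<in> carrier G" if "i < L" for i
    using d_tree ltr_closed that by blast
  then have "set (map (\<lambda>i. letter_val G (ltr (fst (d i)))) [0..<j]) \<subseteq> carrier G"
      "letter_val G (ltr (fst (d j))) \<in> carrier G"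
    using Suc.prems by auto
  ultimately show ?case
    using Suc by (simp add: funpow_phi_dm list_prod_append)
qed auto

text \<open>From \<open>dm 0\<close> on, the word is \<open>s\<close> followed by its inverse. Any
  other start gives a cyclic shift of it, hence a conjugate.\<close>

lemma chain_dm_period: "chain (dm i) (Suc L) = \<one>"
proof -
  have "lab (fst ((phi ^^ L) (dm 0))) = inv s"
    unfolding funpow_phi_dm by (simp add: dm_def d_L lab_def)
  then have 0: "chain (dm 0) (Suc L) = \<one>"
    using chain_face[of L] s_closed by (simp add: s_eq[symmetric])
  have "chain (dm 0) i \<otimes> chain (dm i) (Suc L) = chain (dm 0) (i + Suc L)"
    using chain_add[OF dm_proper, of 0 i "Suc L"] unfolding funpow_phi_dm by simp
  also have "\<dots> = chain (dm 0) (Suc L + i)"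
    by (simp only: add.commute)
  also have "\<dots> = \<one> \<otimes> chain (dm 0) i"
    unfolding chain_add[OF dm_proper] phi_period[OF dm_proper] 0 ..
  finally have "chain (dm 0) i \<otimes> chain (dm i) (Suc L) = chain (dm 0) i"
    unfolding l_one[OF chain_closed[OF dm_proper]] .
  then show ?thesis
    unfolding l_cancel_one[OF chain_closed[OF dm_proper] chain_closed[OF dm_proper]] .
qed

text \<open>Reading backwards inverts the word. The sides read are those of index
  \<open>i + j\<close> down to \<open>Suc i\<close>, whence the shift by one.\<close>

lemma chain_mir: "chain (mir (dm (i + j))) j = inv (chain (dm (Suc i)) j)"
proof (induction j)
  case (Suc j)
  have "chain (mir (dm (i + Suc j))) (Suc j) = inv (lab (fst (dm (Suc i + j)))) \<otimes> inv (chain (dm (Suc i)) j)"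
    using chain_front[OF mir_dm_proper, of "i + Suc j" j] Suc lab_mir[OF dm_darts]
    by (simp add: phi_mir_dm del: chain.simps(2))
  also have "\<dots> = inv (chain (dm (Suc i)) (Suc j))"
    using chain_closed[OF dm_proper] lab_closed'[OF dm_darts] by (simp add: inv_mult_group funpow_phi_dm)
  finally show ?case .
qed auto

lemma chain_period: assumes "q \<in> proper" shows "chain q (Suc L) = \<one>"
  using assms
proof (cases rule: proper_cases)
  case (2 i)
  then show ?thesis
    using chain_mir[of i "Suc L"] chain_dm_period[of "Suc i"] by (simp del: chain.simps)
qed (use chain_dm_period in simp)

text \<open>These are the darts on whose far side there is a further polygon, the one containing
  \<open>turn q\<close>.\<close>

definition passable :: "(int \<times> int) set" where
  "passable = {q \<in> darts. turn q \<in> darts}"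

lemma turn_passable: "q \<in> passable \<Longrightarrow> turn q \<in> proper"
  by (auto simp: passable_def proper_def turn_def darts_def)

lemma cr_passable: assumes "q \<in> passable" shows "cr q \<in> proper"
proof -
  obtain r e where q: "q = (r, e)" "0 \<le> r" "r \<le> M" "e = 1 \<or> e = -1" "0 \<le> r + e" "r + e \<le> M"
    using assms by (auto simp: passable_def turn_def darts_def)
  have "cr q \<noteq> (0, 1)"
  proof
    assume *: "cr q = (0, 1)"
    then have "r = M"
      using bar_bar[OF q(2,3)] q by (simp add: cross_def bar_0)
    then show False
      using * q by (auto simp: cross_def sg_M)
  qed
  moreover have "cr q \<noteq> (M, -1)"
  proof
    assume *: "cr q = (M, -1)"
    then have "r = 0"
      using bar_bar[OF q(2,3)] q by (simp add: cross_def bar_M)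
    then show False
      using * q by (auto simp: cross_def sg_0)
  qed
  moreover have "cr q \<in> darts"
    using assms cr_darts by (simp add: passable_def)
  ultimately show ?thesis
    by (simp add: proper_def)
qed

lemma phi_cr: "q \<in> passable \<Longrightarrow> phi (cr q) = turn q"
  by (simp add: phi_def passable_def cr_cr)

text \<open>In the polygon entered through \<open>q\<close>, the walk starting with
  \<open>turn q\<close> comes back to the entrance edge as its last side. The \<open>L\<close> sides
  before it are the children.\<close>

lemma last_child: assumes "q \<in> passable" shows "(phi ^^ L) (turn q) = cr q"
  using phi_period[OF cr_passable[OF assms]] phi_cr[OF assms] by (simp add: funpow_swap1)

text \<open>The word around the entered polygon is trivial and its side \<open>cr q\<close>
  contributes the inverse of the label of \<open>q\<close>. So both ways between the ends of the
  edge give the same group element.\<close>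

lemma chain_passable: assumes "q \<in> passable" shows "chain (turn q) L = lab (fst q)"
proof -
  have "inv (lab (fst q)) \<otimes> chain (turn q) L = \<one>"
    using chain_front[OF cr_passable[OF assms], of L] chain_period[OF cr_passable[OF assms]] phi_cr[OF assms] assms
    by (simp add: lab_cr passable_def del: chain.simps)
  moreover have "lab (fst q) \<in> carrier G" "chain (turn q) L \<in> carrier G"
    using assms lab_closed' chain_closed turn_passable by (auto simp: passable_def)
  ultimately show ?thesis
    by (metis inv_closed inv_equality inv_inv)
qed

lemma not_flat_passable: "q \<in> proper \<Longrightarrow> \<not> flat q \<Longrightarrow> q \<in> passable"
  by (auto simp: passable_def proper_def flat_def turn_def darts_def)

lemma flat_not_passable: "flat q \<Longrightarrow> q \<notin> passable"
  by (auto simp: passable_def flat_def turn_def darts_def)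

section \<open>The tree of cells given by the polygons\<close>

primrec ty :: "nat list \<Rightarrow> int \<times> int" where
  "ty [] = (0, 1)"
| "ty (j # w) = (phi ^^ j) (turn (ty w))"

text \<open>A cell is subdivided exactly if a polygon lies beyond its edge. The root, of type
  \<open>(0, 1)\<close>, is the \<open>s\<close>-edge of the first polygon, entered from its free
  side.\<close>

primrec cell :: "nat list \<Rightarrow> bool" where
  "cell [] = True"
| "cell (j # w) \<longleftrightarrow> cell w \<and> j < L \<and> \<not> flat (ty (j # w))"

definition N :: "nat list set" where
  "N = {w. cell w}"

lemma N_Cons: "j # w \<in> N \<longleftrightarrow> w \<in> N \<and> j < L \<and> \<not> flat (ty (j # w))"
  by (simp add: N_def)

lemma ty_passable: "w \<in> N \<Longrightarrow> ty w \<in> passable"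
proof (induction w)
  case Nil
  then show ?case by (simp add: passable_def turn_def darts_def)
next
  case (Cons j w)
  then show ?case
    using turn_passable funpow_proper not_flat_passable by (simp add: N_Cons)
qed

lemma ty_Cons_proper: "w \<in> N \<Longrightarrow> ty (j # w) \<in> proper"
  using ty_passable turn_passable funpow_proper by simp

text \<open>The counterpart at the right end of \<open>ty (0 # w) = turn (ty w)\<close>: there the
  last child comes just before its parent in the rotation.\<close>

lemma cr_ty_last:
  assumes "w \<in> N" shows "turn (cr (ty ((L - 1) # w))) = cr (ty w)"
proof -
  have "turn (cr (ty ((L - 1) # w))) = (phi ^^ Suc (L - 1)) (turn (ty w))"
    by (simp add: phi_def)
  then show ?thesis
    using last_child[OF ty_passable[OF assms]] two_le_L by simp
qed

lemma passable_darts: "q \<in> passable \<Longrightarrow> q \<in> darts"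
  by (simp add: passable_def)

text \<open>Leftmost children all meet at the left end of the cell, and their ranks there move by
  one in a fixed direction; among the \<open>L + 2\<close> ranks this cannot go on for
  \<open>L + 2\<close> steps. For rightmost children the ranks are taken at the right end, that is
  after \<open>cr\<close>.\<close>

sublocale cell_tree L N
proof
  show "2 \<le> L" by (rule two_le_L)
  show "[] \<in> N" by (simp add: N_def)
  show "w \<in> N \<and> j < L" if "j # w \<in> N" for j w
    using that by (simp add: N_Cons)
  show "\<exists>k. replicate k 0 @ w \<notin> N" if w: "w \<in> N" for w
  proof (rule ccontr)
    assume "\<not> ?thesis"
    then have all: "replicate k 0 @ w \<in> N" for k by blast
    have tyk: "ty (replicate k 0 @ w) = (fst (ty w) + int k * snd (ty w), snd (ty w))" for k
      by (induction k) (auto simp: turn_def algebra_simps)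
    then have "(fst (ty w) + int (L + 2) * snd (ty w), snd (ty w)) \<in> darts"
      using passable_darts[OF ty_passable[OF all[of "L + 2"]]] unfolding tyk by blast
    moreover have "ty w \<in> darts"
      using passable_darts ty_passable w by blast
    ultimately show False
      by (auto simp: darts_def case_prod_beta)
  qed
  show "\<exists>k. replicate k (L - 1) @ w \<notin> N" if w: "w \<in> N" for w
  proof (rule ccontr)
    assume "\<not> ?thesis"
    then have all: "replicate k (L - 1) @ w \<in> N" for k by blast
    define q where "q = cr (ty w)"
    have tyk: "cr (ty (replicate k (L - 1) @ w)) = (fst q - int k * snd q, snd q)" for k
    proof (induction k)
      case (Suc k)
      have "turn (cr (ty (replicate (Suc k) (L - 1) @ w))) = cr (ty (replicate k (L - 1) @ w))"
        using cr_ty_last[OF all[of k]] by simp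
      then show ?case
        unfolding Suc by (simp add: turn_def prod_eq_iff algebra_simps)
    qed (simp add: q_def)
    then have "(fst q - int (L + 2) * snd q, snd q) \<in> darts"
      using cr_darts[OF passable_darts[OF ty_passable[OF all[of "L + 2"]]]] unfolding tyk by blast
    moreover have "q \<in> darts"
      using cr_darts passable_darts ty_passable w q_def by blast
    ultimately show False
      by (auto simp: darts_def case_prod_beta)
  qed
qed

end

section \<open>The vertices of the drawing are the elements of the group\<close>

context ribbon
begin

primrec gl :: "nat list \<Rightarrow> 'a" where
  "gl [] = \<one>"
| "gl (j # w) = gl w \<otimes> chain (turn (ty w)) j"

definition gr :: "nat list \<Rightarrow> 'a" where
  "gr w = gl w \<otimes> lab (fst (ty w))"

lemma ty_darts: "w \<in> W \<Longrightarrow> ty w \<in> darts"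
  using ty_Cons_proper proper_darts by (cases w) (auto simp: Cons_in_W darts_def simp del: ty.simps(2))

lemma gl_closed: "w \<in> W \<Longrightarrow> gl w \<in> carrier G"
proof (induction w)
  case (Cons j w)
  then show ?case
    using chain_closed turn_passable ty_passable N_subset_W by (auto simp: Cons_in_W)
qed auto

lemma lab_ty_closed: "w \<in> W \<Longrightarrow> lab (fst (ty w)) \<in> carrier G"
  using ty_darts lab_closed' by blast

lemma gr_child: assumes "w \<in> N" shows "gr (j # w) = gl (Suc j # w)"
  using chain_closed[OF turn_passable[OF ty_passable[OF assms]]] lab_funpow[OF turn_passable[OF ty_passable[OF assms]]]
    gl_closed[OF N_subset_W[OF assms]] by (simp add: gr_def m_assoc)

text \<open>Here the relation given by the polygon enters: walking along all \<open>L\<close>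
  children ends where the parent edge ends.\<close>

lemma gr_last: assumes "w \<in> N" shows "gr ((L - 1) # w) = gr w"
  using gr_child[OF assms, of "L - 1"] chain_passable[OF ty_passable[OF assms]] two_le_L by (simp add: gr_def)

text \<open>A flag is a cell with one of its two endpoints, \<open>True\<close> standing for the left one.\<close>

definition valid :: "nat list \<times> bool \<Rightarrow> bool" where
  "valid f \<longleftrightarrow> fst f \<in> W"

definition pos :: "nat list \<times> bool \<Rightarrow> real" where
  "pos f = (if snd f then l (fst f) else h (fst f))"

definition grp :: "nat list \<times> bool \<Rightarrow> 'a" where
  "grp f = (if snd f then gl (fst f) else gr (fst f))"

definition fty :: "nat list \<times> bool \<Rightarrow> int \<times> int" where
  "fty f = (if snd f then ty (fst f) else cr (ty (fst f)))"

definition opp :: "nat list \<times> bool \<Rightarrow> nat list \<times> bool" where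
  "opp f = (fst f, \<not> snd f)"

text \<open>The clockwise next flag at the same point.\<close>

fun cw :: "nat list \<times> bool \<Rightarrow> nat list \<times> bool" where
  "cw (w, True) = (0 # w, True)"
| "cw ([], False) = ([], False)"
| "cw (j # w, False) = (if Suc j < L then (Suc j # w, True) else (w, False))"

text \<open>Rotation stops after the last edge in clockwise order. In particular
  \<open>([], False)\<close>, where \<open>cw\<close> has a default value, is excluded, its dart
  being \<open>(M, 1)\<close>.\<close>

definition can_cw :: "nat list \<times> bool \<Rightarrow> bool" where
  "can_cw f \<longleftrightarrow> valid f \<and> turn (fty f) \<in> darts"

lemma fty_darts: "valid f \<Longrightarrow> fty f \<in> darts"
  using ty_darts cr_darts by (simp add: valid_def fty_def)

lemma N_iff_passable: "w \<in> W \<Longrightarrow> w \<in> N \<longleftrightarrow> ty w \<in> passable"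
proof (cases w)
  case Nil
  then show ?thesis using Nil_in_N ty_passable by blast
next
  case (Cons j u)
  assume "w \<in> W"
  then show ?thesis
    using Cons flat_not_passable[of "ty w"] not_flat_passable[OF ty_Cons_proper[of u j]] ty_passable[of w]
    by (auto simp: Cons_in_W N_Cons simp del: ty.simps)
qed

text \<open>There are three moves: to the first child, to the next sibling, and from the last child
  to its parent. The label is kept in the second by \<open>gr_child\<close> and in the third by
  \<open>gr_last\<close>.\<close>

lemma cw_props:
  assumes "can_cw f"
  shows "valid (cw f)" "pos (cw f) = pos f" "fty (cw f) = turn (fty f)" "grp (cw f) = grp f"
proof -
  have "valid (cw f) \<and> pos (cw f) = pos f \<and> fty (cw f) = turn (fty f) \<and> grp (cw f) = grp f"
    using assms
  proof (cases f rule: cw.cases)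
    case (1 w)
    then have w: "w \<in> W" "ty w \<in> passable"
      using assms ty_darts by (auto simp: can_cw_def valid_def fty_def passable_def)
    then have "w \<in> N"
      using N_iff_passable by blast
    then show ?thesis
      using 1 two_le_L gl_closed[OF w(1)] by (simp add: valid_def pos_def fty_def grp_def Cons_in_W)
  next
    case 2
    then show ?thesis
      using assms by (auto simp: can_cw_def fty_def cross_def turn_def darts_def bar_0 sg_0)
  next
    case (3 j w)
    then have w: "w \<in> N" "j < L"
      using assms by (auto simp: can_cw_def valid_def Cons_in_W)
    show ?thesis
    proof (cases "Suc j < L")
      case True
      then show ?thesis
        using 3 w gr_child[OF w(1)] by (simp add: valid_def pos_def fty_def grp_def Cons_in_W lo_Cons_Suc phi_def)
    next
      case False
      then have "j = L - 1"
        using w by simp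
      then show ?thesis
        using 3 False w gr_last[OF w(1)] cr_ty_last[OF w(1)] hi_Cons_last[of w]
        by (simp add: valid_def pos_def fty_def grp_def N_subset_W del: ty.simps)
    qed
  qed
  then show "valid (cw f)" "pos (cw f) = pos f" "fty (cw f) = turn (fty f)" "grp (cw f) = grp f"
    by auto
qed

lemma cw_inj:
  assumes "can_cw f" "can_cw f'" "cw f = cw f'" shows "f = f'"
proof -
  have ne: "f \<noteq> ([], False)" if "can_cw f" for f
    using that by (auto simp: can_cw_def fty_def cross_def turn_def darts_def bar_0 sg_0)
  have lt: "j < L" if "can_cw (j # w, False)" for j w
    using that by (auto simp: can_cw_def valid_def Cons_in_W)
  show ?thesis
  proof (cases f rule: cw.cases)
    case (1 w)
    then show ?thesis
      by (cases f' rule: cw.cases) (use assms(3) ne[OF assms(2)] in \<open>auto split: if_splits\<close>)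
  next
    case 2
    then show ?thesis using ne[OF assms(1)] by simp
  next
    case (3 j w)
    then have j: "j < L"
      using lt assms(1) by simp
    show ?thesis
    proof (cases f' rule: cw.cases)
      case (1 w')
      then show ?thesis using assms(3) 3 by (auto split: if_splits)
    next
      case 2
      then show ?thesis using ne[OF assms(2)] by simp
    next
      case (3 j' w')
      then have "j' < L"
        using lt assms(2) by simp
      then show ?thesis
        using assms(3) 3 \<open>f = (j # w, False)\<close> j by (auto split: if_splits)
    qed
  qed
qed

text \<open>The cases invert the moves of \<open>cw\<close>. Where nothing precedes, at the left end
  of the root or the right end of a flat cell, the preceding rank is out of range.\<close>

lemma ccw_ex:
  assumes f: "valid f" and prev: "(fst (fty f) - snd (fty f), snd (fty f)) \<in> darts"
  obtains f' where "can_cw f'" "cw f' = f"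
proof -
  have can: "can_cw f'" if "valid f'" "turn (fty f') = fty f" for f'
    using that fty_darts[OF f] by (simp add: can_cw_def)
  obtain w b where fwb: "f = (w, b)" by force
  then have wW: "w \<in> W"
    using f by (simp add: valid_def)
  show ?thesis
  proof (cases b)
    case True
    show ?thesis
    proof (cases w)
      case Nil
      then show ?thesis using True fwb prev by (simp add: fty_def darts_def)
    next
      case (Cons j u)
      then have u: "u \<in> N" "j < L"
        using wW by (auto simp: Cons_in_W)
      show ?thesis
      proof (cases j)
        case 0
        have "can_cw (u, True)"
          using can[of "(u, True)"] 0 Cons True fwb u N_subset_W by (simp add: valid_def fty_def)
        then show ?thesis using that[of "(u, True)"] 0 Cons True fwb by simp
      next
        case (Suc i)
        have "can_cw (i # u, False)"
          using can[of "(i # u, False)"] Suc Cons True fwb u by (simp add: valid_def fty_def Cons_in_W phi_def)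
        then show ?thesis using that[of "(i # u, False)"] Suc Cons True fwb u by simp
      qed
    qed
  next
    case False
    show ?thesis
    proof (cases "w \<in> N")
      case True
      have "can_cw ((L - 1) # w, False)"
        using can[of "((L - 1) # w, False)"] True False fwb cr_ty_last[OF True] two_le_L
        by (simp add: valid_def fty_def Cons_in_W del: ty.simps)
      then show ?thesis using that[of "((L - 1) # w, False)"] False fwb two_le_L by simp
    next
      case F: False
      then have "flat (ty w)"
        using wW Nil_in_N N_Cons by (cases w) (auto simp: Cons_in_W simp del: ty.simps)
      then show ?thesis
        using False fwb prev by (auto simp: flat_def fty_def cross_def darts_def bar_0 bar_M sg_0 sg_M)
    qed
  qed
qed

text \<open>Clockwise rotation goes from the edges on the left over the top to those on the right,
  so it ends with the lowest edge on the right, a flat one. At the point 1 nothing lies on the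
  right, and it ends with the root.\<close>

lemma end_flag:
  assumes "valid f" "\<not> can_cw f"
  shows "f = ([], False) \<or> snd f \<and> fst f \<in> W - N"
proof (cases "snd f")
  case True
  then show ?thesis
    using assms N_iff_passable[of "fst f"] by (auto simp: can_cw_def valid_def fty_def passable_def dest: ty_darts)
next
  case False
  show ?thesis
  proof (cases "fst f")
    case Nil
    then show ?thesis using False by (cases f) auto
  next
    case (Cons j u)
    then have u: "u \<in> N"
      using assms by (simp add: valid_def Cons_in_W)
    then have "turn (cr (ty (j # u))) \<in> darts"
      using phi_proper[OF ty_Cons_proper[OF u, of j]] by (simp add: phi_def proper_def del: ty.simps)
    then show ?thesis
      using assms Cons False by (simp add: can_cw_def fty_def)
  qed
qed

text \<open>Flat cells with a common left end coincide, since neither contains the other, and no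
  cell starts at 1, where the root ends.\<close>

lemma end_flag_unique:
  assumes "valid f" "\<not> can_cw f" "valid f'" "\<not> can_cw f'" "pos f = pos f'"
  shows "f = f'"
proof -
  have less: "l w < 1" if "w \<in> W" for w
    using lo_less_hi[of w] hi_le_1[OF that] by simp
  have uniq: "w = w'" if w: "w \<in> W - N" "w' \<in> W - N" "l w = l w'" for w w'
  proof (rule ccontr)
    assume "w \<noteq> w'"
    then have "(\<exists>v. v \<noteq> [] \<and> w = v @ w') \<or> h w \<le> l w' \<or> h w' \<le> l w"
      using flat_minimal[of w w'] w by auto
    then show False
      using w append_in_W lo_less_hi[of w] lo_less_hi[of w'] by auto
  qed
  have ne: "l w \<noteq> 1" if "w \<in> W" for w
    using less[OF that] by simp
  consider "f = ([], False)" "f' = ([], False)" | "f = ([], False)" "snd f'" "fst f' \<in> W - N"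
    | "snd f" "fst f \<in> W - N" "f' = ([], False)" | "snd f" "fst f \<in> W - N" "snd f'" "fst f' \<in> W - N"
    using end_flag[OF assms(1,2)] end_flag[OF assms(3,4)] by blast
  then show ?thesis
  proof cases
    case 2
    then show ?thesis using assms(5) ne[of "fst f'"] by (simp add: pos_def)
  next
    case 3
    then show ?thesis using assms(5) ne[of "fst f"] by (simp add: pos_def)
  next
    case 4
    then show ?thesis using assms(5) uniq[of "fst f" "fst f'"] by (simp add: pos_def prod_eq_iff)
  qed simp
qed

definition togo :: "nat list \<times> bool \<Rightarrow> nat" where
  "togo f = nat (if snd (fty f) = 1 then M - fst (fty f) else fst (fty f))"

lemma togo_cw: "can_cw f \<Longrightarrow> togo (cw f) < togo f"
  using cw_props[of f] fty_darts[of f] by (auto simp: togo_def can_cw_def turn_def darts_def case_prod_beta)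

lemma reach_end:
  "valid f \<Longrightarrow> \<exists>g. valid g \<and> \<not> can_cw g \<and> pos g = pos f \<and> grp g = grp f \<and> snd (fty g) = snd (fty f)"
proof (induction "togo f" arbitrary: f rule: less_induct)
  case less
  show ?case
  proof (cases "can_cw f")
    case True
    then show ?thesis
      using less.hyps[OF togo_cw[OF True]] cw_props[OF True] by (auto simp: turn_def)
  qed (use less in blast)
qed

text \<open>All flags at a point rotate to the same last flag, and rotation keeps label and
  orientation. This makes the label a function of the point.\<close>

lemma same_pos:
  assumes "valid f" "valid f'" "pos f = pos f'"
  shows "grp f = grp f'" "snd (fty f) = snd (fty f')"
  using reach_end[OF assms(1)] reach_end[OF assms(2)] end_flag_unique assms(3) by metis+

text \<open>Flags with equal darts stay in step while rotating, they reach the same last flag, and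
  \<open>cw\<close> is injective.\<close>

lemma flag_unique_aux:
  "valid f \<Longrightarrow> valid f' \<Longrightarrow> pos f = pos f' \<Longrightarrow> fty f = fty f' \<Longrightarrow> f = f'"
proof (induction "togo f" arbitrary: f f' rule: less_induct)
  case less
  show ?case
  proof (cases "can_cw f")
    case True
    then have True': "can_cw f'"
      using less.prems by (simp add: can_cw_def)
    then have "cw f = cw f'"
      using less.hyps[OF togo_cw[OF True]] cw_props[OF True] cw_props[OF True'] less.prems by metis
    then show ?thesis using cw_inj True True' by blast
  next
    case False
    then have "\<not> can_cw f'"
      using less.prems by (simp add: can_cw_def)
    then show ?thesis using end_flag_unique False less.prems by blast
  qed
qed

lemma flag_unique:
  "valid f \<Longrightarrow> valid f' \<Longrightarrow> pos f = pos f' \<Longrightarrow> fst (fty f) = fst (fty f') \<Longrightarrow> f = f'"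
  using flag_unique_aux same_pos by (metis prod_eqI)

lemma flag_shift:
  assumes "valid f" "(fst (fty f) + i, snd (fty f)) \<in> darts" "i = 1 \<or> i = -1"
  obtains g where "valid g" "pos g = pos f" "fst (fty g) = fst (fty f) + i"
proof (cases "i = snd (fty f)")
  case True
  then have "can_cw f"
    using assms by (simp add: can_cw_def turn_def)
  then show ?thesis
    using that[of "cw f"] cw_props[of f] True by (simp add: turn_def)
next
  case False
  then have i: "i = - snd (fty f)"
    using fty_darts[OF assms(1)] assms(3) by (auto simp: darts_def)
  then obtain g where g: "can_cw g" "cw g = f"
    using ccw_ex[of f] assms by auto
  then show ?thesis
    using that[of g] cw_props[OF g(1)] i by (auto simp: can_cw_def turn_def)
qed

text \<open>Rotation in both directions passes through neighbouring ranks, so none is missed. With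
  \<open>flag_unique\<close>, every point has exactly one edge of each rank, as a vertex of the
  Cayley graph should.\<close>

lemma flag_ex:
  assumes "valid f" "0 \<le> r" "r \<le> M"
  obtains g where "valid g" "pos g = pos f" "fst (fty g) = r"
proof -
  have "\<exists>g. valid g \<and> pos g = pos f \<and> fst (fty g) = r"
    using assms(1)
  proof (induction "nat \<bar>r - fst (fty f)\<bar>" arbitrary: f)
    case 0
    then show ?case by (intro exI[of _ f]) auto
  next
    case (Suc n)
    define i :: int where "i = (if fst (fty f) < r then 1 else -1)"
    have "(fst (fty f) + i, snd (fty f)) \<in> darts"
      using fty_darts[OF Suc.prems] Suc(2) assms(2,3) by (auto simp: i_def darts_def split: if_splits)
    moreover have "i = 1 \<or> i = -1"
      by (simp add: i_def)
    ultimately obtain g where g: "valid g" "pos g = pos f" "fst (fty g) = fst (fty f) + i"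
      by (rule flag_shift[OF Suc.prems])
    moreover have "n = nat \<bar>r - fst (fty g)\<bar>"
      using Suc(2) g(3) by (auto simp: i_def)
    ultimately show ?case
      using Suc(1)[of g] by auto
  qed
  then show ?thesis using that by blast
qed

lemma opp_props:
  assumes "valid f"
  shows "valid (opp f)" "opp (opp f) = f" "fst (fty (opp f)) = bar (fst (fty f))"
    "grp (opp f) = grp f \<otimes> lab (fst (fty f))"
proof -
  have w: "fst f \<in> W"
    using assms by (simp add: valid_def)
  note c = gl_closed[OF w] lab_ty_closed[OF w] lab_cr[OF ty_darts[OF w]]
  show "valid (opp f)" "opp (opp f) = f"
    using assms by (auto simp: opp_def valid_def)
  show "fst (fty (opp f)) = bar (fst (fty f))"
    using bar_bar[of "fst (ty (fst f))"] ty_darts[OF w] by (auto simp: opp_def fty_def cross_def darts_def)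
  show "grp (opp f) = grp f \<otimes> lab (fst (fty f))"
    using c by (simp add: opp_def grp_def gr_def fty_def m_assoc)
qed

lemma grp_closed: "valid f \<Longrightarrow> grp f \<in> carrier G"
  using gl_closed lab_ty_closed by (simp add: valid_def grp_def gr_def)

lemma points_iff: "p \<in> points \<longleftrightarrow> (\<exists>f. valid f \<and> pos f = p)"
proof
  assume "p \<in> points"
  then obtain w where "w \<in> W" "p = l w \<or> p = h w"
    by (auto simp: points_def)
  then show "\<exists>f. valid f \<and> pos f = p"
    by (metis fst_conv pos_def snd_conv valid_def)
qed (auto simp: points_def valid_def pos_def)

section \<open>Labels of points and paths along basis edges\<close>

definition \<gamma> :: "real \<Rightarrow> 'a" where
  "\<gamma> p = grp (SOME f. valid f \<and> pos f = p)"

lemma \<gamma>_pos: assumes "valid f" shows "\<gamma> (pos f) = grp f"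
  unfolding \<gamma>_def using someI[of "\<lambda>g. valid g \<and> pos g = pos f" f] same_pos(1) assms by blast

text \<open>Only ranks \<open>1\<close> to \<open>L\<close> are allowed: their labels are basis
  letters and inverses, so paths spell words to which freeness applies.\<close>

primrec path :: "real \<Rightarrow> int list \<Rightarrow> real \<Rightarrow> bool" where
  "path p [] q \<longleftrightarrow> p = q"
| "path p (r # x) q \<longleftrightarrow> (\<exists>f. valid f \<and> pos f = p \<and> fst (fty f) = r \<and> r \<in> {1..int L} \<and> path (pos (opp f)) x q)"

lemma path_det: "path p x q \<Longrightarrow> path p x q' \<Longrightarrow> q = q'"
proof (induction x arbitrary: p)
  case (Cons r x)
  then show ?case using flag_unique by fastforce
qed auto

lemma path_append: "path p (x @ y) q \<longleftrightarrow> (\<exists>p'. path p x p' \<and> path p' y q)"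
  by (induction x arbitrary: p) auto

lemma path_ranks: "path p x q \<Longrightarrow> set x \<subseteq> {1..int L}"
  by (induction x arbitrary: p) auto

lemma path_cancel: assumes "path p (r # bar r # x) q" shows "path p x q"
proof -
  from assms obtain f f' where f: "valid f" "pos f = p" "fst (fty f) = r" "valid f'" "pos f' = pos (opp f)"
      "fst (fty f') = bar r" "path (pos (opp f')) x q"
    by auto
  then have "f' = opp f"
    using flag_unique opp_props[OF f(1)] by simp
  then show ?thesis
    using f opp_props[OF f(1)] by simp
qed

lemma path_value:
  "p \<in> points \<Longrightarrow> path p x q \<Longrightarrow> q \<in> points \<and> \<gamma> q = \<gamma> p \<otimes> list_prod G (map lab x)"
proof (induction x arbitrary: p)
  case Nil
  then obtain f where "valid f" "pos f = p"
    using points_iff by blast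
  then have "\<gamma> p \<in> carrier G"
    using \<gamma>_pos[of f] grp_closed[of f] by simp
  then show ?case
    using Nil by simp
next
  case (Cons r x)
  then obtain f where f: "valid f" "pos f = p" "fst (fty f) = r" "r \<in> {1..int L}" "path (pos (opp f)) x q"
    by auto
  then have "q \<in> points \<and> \<gamma> q = \<gamma> (pos (opp f)) \<otimes> list_prod G (map lab x)"
    using Cons.IH points_iff opp_props(1) by blast
  moreover have "\<gamma> (pos (opp f)) = \<gamma> p \<otimes> lab r" "\<gamma> p \<in> carrier G"
    using \<gamma>_pos[OF f(1)] \<gamma>_pos[OF opp_props(1)[OF f(1)]] opp_props(4)[OF f(1)] grp_closed[OF f(1)] f(2,3) by simp_all
  moreover have "lab r \<in> carrier G" "list_prod G (map lab x) \<in> carrier G"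
    using f(4) path_ranks[OF f(5)] by (force intro!: lab_closed list_prod_closed)+
  ultimately show ?case
    by (simp add: m_assoc)
qed

lemma path_ex: "p \<in> points \<Longrightarrow> set x \<subseteq> {1..int L} \<Longrightarrow> \<exists>q. path p x q"
proof (induction x arbitrary: p)
  case (Cons r x)
  then obtain f where "valid f" "pos f = p"
    using points_iff by blast
  then obtain g where g: "valid g" "pos g = p" "fst (fty g) = r"
    using flag_ex[of f r] Cons.prems(2) by auto
  then have "pos (opp g) \<in> points"
    using points_iff opp_props(1) by blast
  then obtain q where "path (pos (opp g)) x q"
    using Cons.IH[of "pos (opp g)"] Cons.prems(2) by auto
  moreover have "r \<in> {1..int L}"
    using Cons.prems(2) by simp
  ultimately show ?case
    unfolding path.simps using g by blast
qed auto

text \<open>Reachability without \<open>s\<close>-edges, so that every point gets a word in the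
  basis.\<close>

definition reached :: "real \<Rightarrow> bool" where
  "reached q \<longleftrightarrow> (\<exists>x. path 0 x q)"

lemma reached_step:
  assumes "valid f" "reached (pos f)" "fst (fty f) \<in> {1..int L}" shows "reached (pos (opp f))"
proof -
  obtain x where x: "path 0 x (pos f)"
    using assms by (auto simp: reached_def)
  have "path (pos f) [fst (fty f)] (pos (opp f))"
    unfolding path.simps using assms by blast
  then have "path 0 (x @ [fst (fty f)]) (pos (opp f))"
    using x path_append by blast
  then show ?thesis
    unfolding reached_def by blast
qed

lemma not_flat_rank: "q \<in> proper \<Longrightarrow> \<not> flat q \<Longrightarrow> fst q \<in> {1..int L}"
  by (force simp: proper_def flat_def darts_def)

lemma reached_iff:
  assumes "w \<in> N" "j < L" "\<not> flat (ty (j # w))"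
  shows "reached (l (j # w)) \<longleftrightarrow> reached (h (j # w))"
proof -
  have r: "fst (ty (j # w)) \<in> {1..int L}"
    using not_flat_rank ty_Cons_proper assms by blast
  have v: "valid (j # w, True)" "valid (j # w, False)"
    using assms by (auto simp: valid_def Cons_in_W)
  show ?thesis
    using reached_step[OF v(1)] reached_step[OF v(2)] r bar_tree[OF r]
    by (auto simp: pos_def opp_def fty_def cross_def simp del: ty.simps)
qed

text \<open>A face has at most one edge labelled by \<open>s\<close>, so from its two outer vertices all its vertices are
  reached without using that edge.\<close>

lemma reached_children:
  assumes w: "w \<in> N" and r: "reached (l w)" "reached (h w)" and j: "j < L"
  shows "reached (l (j # w)) \<and> reached (h (j # w))"
proof -
  have up: "reached (l (i # w))" if "i < L" "\<And>k. k < i \<Longrightarrow> \<not> flat (ty (k # w))" for i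
    using that
  proof (induction i)
    case (Suc i)
    then have "reached (l (i # w))" by auto
    then show ?case
      using reached_iff[OF w, of i] Suc.prems by (simp add: lo_Cons_Suc)
  qed (use r in simp)
  have down: "reached (h ((L - Suc i) # w))" if "i < L" "\<And>k. L - Suc i < k \<Longrightarrow> k < L \<Longrightarrow> \<not> flat (ty (k # w))" for i
    using that
  proof (induction i)
    case 0
    then show ?case using r hi_Cons_last[of w] by simp
  next
    case (Suc i)
    define k where "k = L - Suc i"
    have k: "L - Suc (Suc i) < k" "k < L" "Suc (L - Suc (Suc i)) = k"
      using Suc.prems(1) by (auto simp: k_def)
    have "reached (h (k # w))"
      unfolding k_def using Suc by auto
    then have "reached (l (k # w))"
      using reached_iff[OF w k(2)] Suc.prems(2)[OF k(1,2)] by blast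
    then show ?case
      using lo_Cons_Suc[of "L - Suc (Suc i)" w] k(3) by simp
  qed
  have uniq: "i = k" if "i < L" "k < L" "flat (ty (i # w))" "flat (ty (k # w))" for i k
    using flat_unique[OF turn_passable[OF ty_passable[OF w]], of i k] that by simp
  have left: "reached (l (i # w))" if i: "i < L" for i
  proof (cases "\<exists>k<i. flat (ty (k # w))")
    case False
    then show ?thesis using up i by blast
  next
    case True
    then obtain k where k: "k < i" "flat (ty (k # w))" by blast
    have "\<not> flat (ty (m # w))" if "i \<le> m" "m < L" for m
      using uniq[of k m] k that by auto
    \<comment> \<open>\<open>down\<close> counts children from the right: its index
      \<open>L - Suc (i - 1)\<close> belongs to child \<open>i - 1\<close>, whose right end is the
      left end of child \<open>i\<close>.\<close>
    then have "reached (h ((L - Suc (L - Suc (i - 1))) # w))"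
      using k(1) i by (intro down) auto
    moreover have "L - Suc (L - Suc (i - 1)) = i - 1"
      using k(1) i by auto
    ultimately show ?thesis
      using lo_Cons_Suc[of "i - 1" w] k(1) by simp
  qed
  have "reached (h (j # w))"
  proof (cases "Suc j < L")
    case True
    then show ?thesis using left[OF True] lo_Cons_Suc[of j w] by simp
  next
    case False
    then have "j = L - 1" using j by simp
    then show ?thesis using r hi_Cons_last[of w] by simp
  qed
  then show ?thesis using left[OF j] by blast
qed

text \<open>The outer edge of the root face is labelled by \<open>s\<close>, so the other edges of this face carry basis letters.\<close>

lemma reached_root: "reached (h [])"
proof -
  have nf: "\<not> flat (ty [j])" if "j < L" for j
    using that flat_dm[of j] funpow_phi_dm[of j 0] by (simp add: turn_def dm_def d_0)
  have "reached (l [j])" if "j < L" for j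
    using that
  proof (induction j)
    case 0
    have "path 0 [] 0" by simp
    then have "reached 0" unfolding reached_def by blast
    then show ?case by simp
  next
    case (Suc j)
    then show ?case
      using reached_iff[OF Nil_in_N, of j] nf[of j] by (simp add: lo_Cons_Suc del: ty.simps)
  qed
  then have "reached (h [L - 1])"
    using reached_iff[OF Nil_in_N, of "L - 1"] nf[of "L - 1"] two_le_L by simp
  then show ?thesis
    using hi_Cons_last[of "[]"] by simp
qed

lemma reached_ends: "w \<in> W \<Longrightarrow> reached (l w) \<and> reached (h w)"
proof (induction w)
  case Nil
  have "path 0 [] 0" by simp
  then have "reached 0" unfolding reached_def by blast
  then show ?case using reached_root by simp
next
  case (Cons j w)
  then show ?case
    using reached_children[of w j] N_subset_W by (auto simp: Cons_in_W)
qed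

lemma reached_points: "p \<in> points \<Longrightarrow> reached p"
  using reached_ends by (auto simp: points_def)

lemma not_successively_split:
  "\<not> successively P x \<Longrightarrow> \<exists>y a b z. x = y @ a # b # z \<and> \<not> P a b"
proof (induction x rule: induct_list012)
  case (3 a b z)
  show ?case
  proof (cases "P a b")
    case True
    then obtain y c d z' where "b # z = y @ c # d # z'" "\<not> P c d"
      using 3 by auto
    then have "a # b # z = (a # y) @ c # d # z' \<and> \<not> P c d" by simp
    then show ?thesis by blast
  next
    case False
    then show ?thesis by (metis append_Nil)
  qed
qed auto

text \<open>A shortest path is reduced, since by \<open>path_cancel\<close> an edge followed by its
  reverse can be removed.\<close>

lemma reduced_path:
  assumes "reached q"
  obtains x where "path 0 x q" "successively (\<lambda>a b. b \<noteq> bar a) x"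
proof -
  define x where "x = arg_min length (\<lambda>x. path 0 x q)"
  have x: "path 0 x q" and least: "\<And>y. path 0 y q \<Longrightarrow> length x \<le> length y"
    using assms arg_min_nat_lemma[of "\<lambda>x. path 0 x q"] unfolding x_def reached_def by auto
  have "successively (\<lambda>a b. b \<noteq> bar a) x"
  proof (rule ccontr)
    assume "\<not> ?thesis"
    then obtain y a z where "x = y @ a # bar a # z"
      using not_successively_split[of "\<lambda>a b. b \<noteq> bar a" x] by auto
    then have "path 0 (y @ z) q" "length (y @ z) < length x"
      using x path_append path_cancel by (auto simp del: path.simps)
    then show False
      using least[of "y @ z"] by simp
  qed
  then show ?thesis using that x by blast
qed

lemma reduced_word_ltr:
  assumes "set x \<subseteq> {1..int L}" "successively (\<lambda>a b. b \<noteq> bar a) x"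
  shows "map ltr x \<in> {w \<in> lists (A \<times> UNIV). reduced_word w}"
proof -
  have "\<not> (fst (ltr a) = fst (ltr b) \<and> snd (ltr a) \<noteq> snd (ltr b))"
    if "b \<noteq> bar a" "a \<in> {1..int L}" "b \<in> {1..int L}" for a b
  proof
    assume "fst (ltr a) = fst (ltr b) \<and> snd (ltr a) \<noteq> snd (ltr b)"
    then have "ltr (bar a) = ltr b"
      using ltr_bar[OF that(2)] by (auto simp: prod_eq_iff)
    then have "bar a = b"
      using inj_onD[OF bij_betw_imp_inj_on[OF ltr_bij]] bar_tree[OF that(2)] that(3) by blast
    then show False
      using that(1) by simp
  qed
  then have "successively (\<lambda>a b. \<not> (fst (ltr a) = fst (ltr b) \<and> snd (ltr a) \<noteq> snd (ltr b))) x"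
    using assms by (intro successively_mono[OF assms(2)]) blast
  moreover have "ltr ` set x \<subseteq> A \<times> UNIV"
    using ltr_bij assms(1) by (auto simp: bij_betw_def)
  then have "map ltr x \<in> lists (A \<times> UNIV)"
    by (simp add: lists_eq_set)
  ultimately show ?thesis
    unfolding mem_Collect_eq reduced_word_def successively_map by blast
qed

lemma lab_ltr: "set x \<subseteq> {1..int L} \<Longrightarrow> map lab x = map (letter_val G) (map ltr x)"
  by (auto simp: lab_def)

lemma zero_in_points: "0 \<in> points"
  unfolding points_def using Nil_in_W lo_Nil by (metis UnI1 image_eqI)

lemma \<gamma>_0: "\<gamma> 0 = \<one>"
  using \<gamma>_pos[of "([], True)"] by (simp add: valid_def pos_def grp_def)

text \<open>Both labels are values of reduced words in the free basis, so equal labels give equal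
  words, and a word determines its path from the point 0.\<close>

lemma inj_\<gamma>: "inj_on \<gamma> points"
proof (rule inj_onI)
  fix q q' assume q: "q \<in> points" "q' \<in> points" "\<gamma> q = \<gamma> q'"
  obtain x where x: "path 0 x q" "successively (\<lambda>a b. b \<noteq> bar a) x"
    using reduced_path reached_points q by metis
  obtain x' where x': "path 0 x' q'" "successively (\<lambda>a b. b \<noteq> bar a) x'"
    using reduced_path reached_points q by metis
  note xs = path_ranks[OF x(1)] and xs' = path_ranks[OF x'(1)]
  have c: "list_prod G (map lab y) \<in> carrier G" if "set y \<subseteq> {1..int L}" for y
    using that by (force intro!: lab_closed list_prod_closed)
  have "list_prod G (map lab x) = list_prod G (map lab x')"
    using path_value[OF zero_in_points x(1)] path_value[OF zero_in_points x'(1)] q(3) c[OF xs] c[OF xs']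
    by (simp add: \<gamma>_0)
  then have "map ltr x = map ltr x'"
    using free reduced_word_ltr[OF xs x(2)] reduced_word_ltr[OF xs' x'(2)]
    unfolding free_basis_def lab_ltr[OF xs] lab_ltr[OF xs'] by (meson bij_betw_imp_inj_on inj_onD)
  moreover have "inj_on ltr (set x \<union> set x')"
    using ltr_bij xs xs' by (meson Un_least bij_betw_imp_inj_on inj_on_subset)
  ultimately have "x = x'"
    by (rule map_inj_on)
  then show "q = q'"
    using path_det x(1) x'(1) by blast
qed

lemma image_\<gamma>: "\<gamma> ` points = carrier G"
proof
  show "\<gamma> ` points \<subseteq> carrier G"
    using points_iff \<gamma>_pos grp_closed by auto
  show "carrier G \<subseteq> \<gamma> ` points"
  proof
    fix g assume "g \<in> carrier G"
    then obtain u where u: "u \<in> lists (A \<times> UNIV)" "g = list_prod G (map (letter_val G) u)"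
      using free unfolding free_basis_def bij_betw_def by blast
    have "ltr ` {1..int L} = A \<times> UNIV"
      using ltr_bij by (simp add: bij_betw_def)
    then have "u \<in> map ltr ` lists {1..int L}"
      using u(1) unfolding lists_image[symmetric] by simp
    then obtain x where x: "set x \<subseteq> {1..int L}" "u = map ltr x"
      by (auto simp: lists_eq_set)
    obtain q where q: "path 0 x q"
      using path_ex[OF zero_in_points x(1)] by blast
    have "\<gamma> q = g" "q \<in> points"
      using path_value[OF zero_in_points q] u(2) lab_ltr[OF x(1)] x \<open>g \<in> carrier G\<close> by (auto simp: \<gamma>_0)
    then show "g \<in> \<gamma> ` points" by blast
  qed
qed

text \<open>By \<open>flag_ex\<close> the edge of rank \<open>r\<close> is present at the point
  labelled \<open>x\<close>, and its other end is labelled \<open>x \<otimes> lab r\<close>.\<close>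

lemma edges_Cay:
  "edges (Cay G (lab ` {0..M})) = (\<lambda>w. {\<gamma> (l w), \<gamma> (h w)}) ` W"
proof
  have edge: "{\<gamma> (pos f), \<gamma> (pos (opp f))} = {\<gamma> (l (fst f)), \<gamma> (h (fst f))}" for f
    by (auto simp: pos_def opp_def)
  show "edges (Cay G (lab ` {0..M})) \<subseteq> (\<lambda>w. {\<gamma> (l w), \<gamma> (h w)}) ` W"
  proof
    fix e assume "e \<in> edges (Cay G (lab ` {0..M}))"
    then obtain x y r where e: "e = {x, y}" "x \<in> carrier G" "y \<in> carrier G" "inv x \<otimes> y = lab r" "0 \<le> r" "r \<le> M"
      by (auto simp: Cay_def)
    from e(2) obtain p where p: "p \<in> points" "\<gamma> p = x"
      unfolding image_\<gamma>[symmetric] by blast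
    from p(1) obtain f where "valid f" "pos f = p"
      unfolding points_iff by blast
    then have f: "valid f" "\<gamma> (pos f) = x"
      using p(2) by simp_all
    obtain g where g: "valid g" "pos g = pos f" "fst (fty g) = r"
      by (rule flag_ex[OF f(1) e(5,6)])
    then have gx: "\<gamma> (pos g) = x"
      using f(2) by simp
    have "y = x \<otimes> lab r"
      using e(2,3) unfolding e(4)[symmetric] by (simp add: m_assoc[symmetric])
    then have "y = \<gamma> (pos (opp g))"
      using gx \<gamma>_pos[OF g(1)] \<gamma>_pos[OF opp_props(1)[OF g(1)]] opp_props(4)[OF g(1)] g(3) by simp
    then have "e = {\<gamma> (l (fst g)), \<gamma> (h (fst g))}"
      using e(1) gx edge[of g] by simp
    then show "e \<in> (\<lambda>w. {\<gamma> (l w), \<gamma> (h w)}) ` W"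
      using g(1) by (auto simp: valid_def)
  qed
  show "(\<lambda>w. {\<gamma> (l w), \<gamma> (h w)}) ` W \<subseteq> edges (Cay G (lab ` {0..M}))"
  proof clarify
    fix w assume w: "w \<in> W"
    have "\<gamma> (l w) = gl w" "\<gamma> (h w) = gr w"
      using \<gamma>_pos[of "(w, True)"] \<gamma>_pos[of "(w, False)"] w by (simp_all add: valid_def pos_def grp_def)
    moreover have "inv (gl w) \<otimes> gr w = lab (fst (ty w))"
      using gl_closed[OF w] lab_ty_closed[OF w] by (simp add: gr_def m_assoc[symmetric])
    moreover have "fst (ty w) \<in> {0..M}"
      using ty_darts[OF w] by (auto simp: darts_def)
    moreover have "gr w \<in> carrier G"
      using gl_closed[OF w] lab_ty_closed[OF w] by (simp add: gr_def)
    ultimately show "{\<gamma> (l w), \<gamma> (h w)} \<in> edges (Cay G (lab ` {0..M}))"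
      using gl_closed[OF w] unfolding Cay_def ugraph.simps
      by (intro CollectI exI[of _ "gl w"] exI[of _ "gr w"]) auto
  qed
qed

theorem outerplanar_Cay: "outerplanar (Cay G (lab ` {0..M}))"
proof -
  interpret cell_graph L N "Cay G (lab ` {0..M})" \<gamma>
    by unfold_locales (use inj_\<gamma> image_\<gamma> edges_Cay in \<open>auto simp: Cay_def\<close>)
  show ?thesis by (rule outerplanar_X)
qed

lemma labels: "lab ` {0..M} = A \<union> (\<lambda>x. inv x) ` A \<union> {s, inv s}"
proof -
  have "{0..M} = insert 0 (insert M {1..int L})"
    by auto
  moreover have "lab 0 = s" "lab M = inv s"
    by (simp_all add: lab_def)
  moreover have "lab ` {1..int L} = letter_val G ` ltr ` {1..int L}"
    unfolding image_image by (rule image_cong) (auto simp: lab_def)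
  moreover have "ltr ` {1..int L} = A \<times> UNIV"
    using ltr_bij by (simp add: bij_betw_def)
  moreover have "letter_val G ` (A \<times> UNIV) = A \<union> (\<lambda>x. inv x) ` A"
    by (force simp: letter_val_def image_iff)
  ultimately show ?thesis
    by (simp add: insert_commute)
qed

end

section \<open>The two surface words\<close>

lemma (in monoid) list_prod_concat_map:
  "(\<And>y. y \<in> set ys \<Longrightarrow> set (f y) \<subseteq> carrier G) \<Longrightarrow>
    list_prod G (concat (map f ys)) = list_prod G (map (\<lambda>y. list_prod G (f y)) ys)"
proof (induction ys)
  case (Cons y ys)
  then have "set (concat (map f ys)) \<subseteq> carrier G"
    by fastforce
  then show ?case
    using Cons list_prod_append[of "f y" "concat (map f ys)"] by simp
qed simp

lemma map_upt_concat: "map f [0..<c * m] = concat (map (\<lambda>b. map (\<lambda>i. f (c * b + i)) [0..<c]) [0..<m])"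
proof (induction m)
  case (Suc m)
  have "[0..<c * Suc m] = [0..<c * m] @ map (\<lambda>i. c * m + i) [0..<c]"
    using upt_add_eq_append[of 0 "c * m" c] map_add_upt[of "c * m" c] by (simp add: add.commute)
  then show ?case
    using Suc by (simp add: comp_def)
qed simp

text \<open>The ranks of \<open>a\<^sub>i\<close> and its inverse are \<open>2 i - 1\<close> and \<open>2 i\<close>.\<close>

lemma outerplanar_squares:
  fixes G :: "('g, 'm) monoid_scheme" and a :: "nat \<Rightarrow> 'g"
  assumes n: "n \<ge> 1" and G: "group G" and inj: "inj_on a {1..n}" and free: "free_basis G (a ` {1..n})"
    and s: "s = list_prod G (map (\<lambda>i. a i [^]\<^bsub>G\<^esub> (2::nat)) [1..<n + 1])"
  shows "outerplanar (Cay G (a ` {1..n} \<union> (\<lambda>x. inv\<^bsub>G\<^esub> x) ` a ` {1..n} \<union> {s, inv\<^bsub>G\<^esub> s}))"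
proof -
  interpret group G by (rule G)
  define bar :: "int \<Rightarrow> int" where
    "bar r = (if r = 0 then int (2 * n) + 1 else if r = int (2 * n) + 1 then 0 else if odd r then r + 1 else r - 1)" for r
  \<comment> \<open>Both occurrences of a letter in \<open>s\<close> have the same sign, so every
    basis edge is crossed with a twist.\<close>
  define sg :: "int \<Rightarrow> int" where
    "sg r = (if r = 0 \<or> r = int (2 * n) + 1 then 1 else -1)" for r
  define ltr :: "int \<Rightarrow> 'g \<times> bool" where
    "ltr r = (a (nat ((r + 1) div 2)), odd r)" for r
  \<comment> \<open>Each odd rank is met twice, first clockwise and then counterclockwise: the twist
    reverses the turn after the crossing, which leads back to the same rank.\<close>
  define d :: "nat \<Rightarrow> int \<times> int" where
    "d i = (if even i then (int i + 1, 1) else (int i, -1))" for i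
  have a: "a i \<in> carrier G" if "1 \<le> i" "i \<le> n" for i
    using free that by (auto simp: free_basis_def)
  have index: "nat ((t + 1) div 2) \<in> {1..n}" if "t \<in> {1..int (2 * n)}" for t
  proof -
    have "1 \<le> t" "t \<le> 2 * int n"
      using that by simp_all
    then have "1 \<le> (t + 1) div 2" "(t + 1) div 2 \<le> int n"
      by presburger+
    then show ?thesis by (simp add: nat_le_iff le_nat_iff)
  qed
  interpret ribbon G "a ` {1..n}" s "2 * n" bar sg ltr d
  proof
    show "2 \<le> 2 * n" using n by simp
    show "free_basis G (a ` {1..n})" by (rule free)
    show "bij_betw ltr {1..int (2 * n)} (a ` {1..n} \<times> UNIV)"
    proof (rule bij_betw_imageI)
      show "inj_on ltr {1..int (2 * n)}"
      proof (rule inj_onI)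
        fix r r' assume r: "r \<in> {1..int (2 * n)}" "r' \<in> {1..int (2 * n)}" "ltr r = ltr r'"
        then have "nat ((r + 1) div 2) = nat ((r' + 1) div 2)"
          using index by (intro inj_onD[OF inj]) (simp_all add: ltr_def)
        then have "(r + 1) div 2 = (r' + 1) div 2" "odd r = odd r'"
          using r by (auto simp: ltr_def)
        then show "r = r'" by presburger
      qed
      show "ltr ` {1..int (2 * n)} = a ` {1..n} \<times> UNIV"
      proof
        have "ltr t \<in> a ` {1..n} \<times> UNIV" if "t \<in> {1..int (2 * n)}" for t
          unfolding ltr_def by (intro SigmaI imageI index[OF that] UNIV_I)
        then show "ltr ` {1..int (2 * n)} \<subseteq> a ` {1..n} \<times> UNIV"
          by blast
        have "(a i, b) \<in> ltr ` {1..int (2 * n)}" if "i \<in> {1..n}" for i b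
        proof -
          have "ltr (if b then 2 * int i - 1 else 2 * int i) = (a i, b)"
            by (cases b) (simp_all add: ltr_def)
          moreover have "(if b then 2 * int i - 1 else 2 * int i) \<in> {1..int (2 * n)}"
            using that by auto
          ultimately show ?thesis by (rule image_eqI[OF sym])
        qed
        then show "a ` {1..n} \<times> UNIV \<subseteq> ltr ` {1..int (2 * n)}"
          by auto
      qed
    qed
    show "ltr (bar r) = (fst (ltr r), \<not> snd (ltr r))" if "r \<in> {1..int (2 * n)}" for r
    proof -
      have "(if odd r then r + 1 else r - 1) = bar r"
        using that by (auto simp: bar_def)
      moreover have "((if odd r then r + 1 else r - 1) + 1) div 2 = (r + 1) div 2"
          "odd (if odd r then r + 1 else r - 1) \<longleftrightarrow> even r"
        by (auto elim!: oddE)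
      ultimately show ?thesis
        unfolding ltr_def by simp
    qed
    show bar_index: "bar r \<in> {1..int (2 * n)}" if "r \<in> {1..int (2 * n)}" for r
      using that unfolding bar_def by (auto, presburger+)
    show "bar 0 = int (2 * n) + 1" "bar (int (2 * n) + 1) = 0" "sg 0 = 1" "sg (int (2 * n) + 1) = 1"
      by (auto simp: bar_def sg_def)
    show "(sg r = 1 \<or> sg r = -1) \<and> sg (bar r) = sg r" if "r \<in> {1..int (2 * n)}" for r
    proof -
      have "sg t = -1" if "t \<in> {1..int (2 * n)}" for t
        using that by (auto simp: sg_def)
      then show ?thesis
        using that bar_index by simp
    qed
    show "d 0 = (1, 1)" "d (2 * n) = (int (2 * n) + 1, 1)"
      by (auto simp: d_def)
    show "fst (d i) \<in> {1..int (2 * n)} \<and> (snd (d i) = 1 \<or> snd (d i) = -1)" if "i < 2 * n" for i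
      using that unfolding d_def by (auto, presburger+)
    show "turn (cross bar sg (d i)) = d (Suc i)" if "i < 2 * n" for i
    proof (cases "even i")
      case True
      then have "int i + 1 \<noteq> int (2 * n) + 1"
        using that by simp
      then show ?thesis
        using True by (simp add: turn_def cross_def d_def bar_def sg_def)
    next
      case False
      then have "int i \<noteq> 0" "int i \<noteq> int (2 * n) + 1" "odd (int i)"
        using that by (auto intro: odd_pos)
      then show ?thesis
        using False by (simp add: turn_def cross_def d_def bar_def sg_def)
    qed
    show "\<exists>i<2 * n. (r, e) = d i \<or> (r, e) = mirror bar sg (d i)"
      if r: "r \<in> {1..int (2 * n)}" "e = 1 \<or> e = -1" for r e
    proof -
      define k where "k = nat ((r - 1) div 2)"
      have k: "k < n" "r = 2 * int k + 1 \<or> r = 2 * int k + 2"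
        using r(1) by (auto simp: k_def)
      have e: "d (2 * k) = (2 * int k + 1, 1)" "d (2 * k + 1) = (2 * int k + 1, -1)"
        by (auto simp: d_def)
      have m: "mirror bar sg (2 * int k + 1, e) = (2 * int k + 2, e)" for e
        using k(1) by (simp add: mirror_def bar_def sg_def)
      have "2 * k < 2 * n" "2 * k + 1 < 2 * n"
        using k(1) by auto
      then show ?thesis
        using k(2) r(2) e m by metis
    qed
    have word: "map (\<lambda>i. letter_val G (ltr (fst (d i)))) [0..<2 * n] = concat (map (\<lambda>b. [a (b + 1), a (b + 1)]) [0..<n])"
      unfolding map_upt_concat by (rule arg_cong[of _ _ concat]) (simp add: upt_rec d_def ltr_def letter_val_def nat_add_distrib)
    have closed: "set [a (b + 1), a (b + 1)] \<subseteq> carrier G" if "b \<in> set [0..<n]" for b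
      using a[of "b + 1"] that by simp
    have "list_prod G (map (\<lambda>i. letter_val G (ltr (fst (d i)))) [0..<2 * n]) =
        list_prod G (map (\<lambda>b. list_prod G [a (b + 1), a (b + 1)]) [0..<n])"
      unfolding word by (rule list_prod_concat_map) (rule closed)
    also have "map (\<lambda>b. list_prod G [a (b + 1), a (b + 1)]) [0..<n] = map (\<lambda>b. a (b + 1) [^]\<^bsub>G\<^esub> (2::nat)) [0..<n]"
      using a by (auto simp: numeral_2_eq_2)
    also have "\<dots> = map (\<lambda>i. a i [^]\<^bsub>G\<^esub> (2::nat)) (map (\<lambda>i. i + 1) [0..<n])"
      by (simp add: comp_def)
    also have "map (\<lambda>i. i + 1) [0..<n] = [1..<n + 1]"
      by (rule map_add_upt)
    finally show "s = list_prod G (map (\<lambda>i. letter_val G (ltr (fst (d i)))) [0..<2 * n])"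
      by (simp add: s)
  qed
  show ?thesis
    using outerplanar_Cay unfolding labels .
qed

text \<open>Around a vertex the letters come in blocks \<open>x, y\<^sup>-\<^sup>1, x\<^sup>-\<^sup>1, y\<close>, one for each commutator \<open>[x, y]\<close>.\<close>

lemma outerplanar_commutators:
  fixes G :: "('g, 'm) monoid_scheme" and a :: "nat \<Rightarrow> 'g"
  assumes m: "m \<ge> 1" and G: "group G" and inj: "inj_on a {1..2 * m}" and free: "free_basis G (a ` {1..2 * m})"
    and s: "s = list_prod G (map (\<lambda>j. commutator G (a (2 * j - 1)) (a (2 * j))) [1..<m + 1])"
  shows "outerplanar (Cay G (a ` {1..2 * m} \<union> (\<lambda>x. inv\<^bsub>G\<^esub> x) ` a ` {1..2 * m} \<union> {s, inv\<^bsub>G\<^esub> s}))"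
proof -
  interpret group G by (rule G)
  define bar :: "int \<Rightarrow> int" where
    "bar r = (if r = 0 then int (4 * m) + 1 else if r = int (4 * m) + 1 then 0
       else if (r - 1) mod 4 < 2 then r + 2 else r - 2)" for r
  \<comment> \<open>Every letter occurs in \<open>s\<close> with both signs; the surface is
    orientable and no edge is twisted.\<close>
  define sg :: "int \<Rightarrow> int" where "sg r = 1" for r
  define ltr :: "int \<Rightarrow> 'g \<times> bool" where
    "ltr r = (a (nat (2 * ((r - 1) div 4) + (if odd r then 1 else 2))), (r - 1) mod 4 \<in> {0, 3})" for r
  \<comment> \<open>Within a block the ranks are met in the order 1, 4, 3, 2: crossing exchanges 1
    with 3 and 2 with 4, and turning adds 1.\<close>
  define d :: "nat \<Rightarrow> int \<times> int" where
    "d i = (int i + (if even i then 1 else if i mod 4 = 1 then 3 else -1), 1)" for i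
  have a: "a i \<in> carrier G" if "1 \<le> i" "i \<le> 2 * m" for i
    using free that by (auto simp: free_basis_def)
  have split: "\<exists>k<m. r = 4 * int k + 1 \<or> r = 4 * int k + 2 \<or> r = 4 * int k + 3 \<or> r = 4 * int k + 4"
    if "r \<in> {1..int (4 * m)}" for r
  proof -
    have "r = 4 * int (nat ((r - 1) div 4)) + (r - 1) mod 4 + 1" "nat ((r - 1) div 4) < m"
      using that by auto
    moreover have "(r - 1) mod 4 \<in> {0, 1, 2, 3}"
      by auto
    ultimately show ?thesis
      by (intro exI[of _ "nat ((r - 1) div 4)"]) auto
  qed
  have mods: "(4 * int k + 1) mod 4 = 1" "(4 * int k + 2) mod 4 = 2" "(4 * int k + 3) mod 4 = 3"
      "(4 * int k + 1) div 4 = int k" "(4 * int k + 2) div 4 = int k" "(4 * int k + 3) div 4 = int k" for k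
    by presburger+
  have bar: "bar (4 * int k + 1) = 4 * int k + 3" "bar (4 * int k + 2) = 4 * int k + 4"
      "bar (4 * int k + 3) = 4 * int k + 1" "bar (4 * int k + 4) = 4 * int k + 2" if "k < m" for k
    using that mods[of k] by (auto simp: bar_def)
  have ltr: "ltr (4 * int k + 1) = (a (2 * k + 1), True)" "ltr (4 * int k + 2) = (a (2 * k + 2), False)"
      "ltr (4 * int k + 3) = (a (2 * k + 1), False)" "ltr (4 * int k + 4) = (a (2 * k + 2), True)" for k
    using mods[of k] by (auto simp: ltr_def nat_add_distrib nat_mult_distrib)
  have d: "d (4 * k) = (4 * int k + 1, 1)" "d (4 * k + 1) = (4 * int k + 4, 1)"
      "d (4 * k + 2) = (4 * int k + 3, 1)" "d (4 * k + 3) = (4 * int k + 2, 1)" for k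
    by (auto simp: d_def)
  have dsplit: "\<exists>k<m. i = 4 * k \<or> i = 4 * k + 1 \<or> i = 4 * k + 2 \<or> i = 4 * k + 3" if "i < 4 * m" for i
    using that by (intro exI[of _ "i div 4"]) presburger
  interpret ribbon G "a ` {1..2 * m}" s "4 * m" bar sg ltr d
  proof
    show "2 \<le> 4 * m" using m by simp
    show "free_basis G (a ` {1..2 * m})" by (rule free)
    show "bij_betw ltr {1..int (4 * m)} (a ` {1..2 * m} \<times> UNIV)"
    proof (rule bij_betw_imageI)
      show "inj_on ltr {1..int (4 * m)}"
      proof (rule inj_onI)
        fix r r' assume r: "r \<in> {1..int (4 * m)}" "r' \<in> {1..int (4 * m)}" "ltr r = ltr r'"
        then obtain k k' where k: "k < m" "r = 4 * int k + 1 \<or> r = 4 * int k + 2 \<or> r = 4 * int k + 3 \<or> r = 4 * int k + 4"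
          "k' < m" "r' = 4 * int k' + 1 \<or> r' = 4 * int k' + 2 \<or> r' = 4 * int k' + 3 \<or> r' = 4 * int k' + 4"
          using split[of r] split[of r'] by blast
        have a_eq: "a i = a j \<longleftrightarrow> i = j" if "1 \<le> i" "i \<le> 2 * m" "1 \<le> j" "j \<le> 2 * m" for i j
          using inj_on_eq_iff[OF inj, of i j] that by simp
        have parity: "2 * k + 1 \<noteq> 2 * k' + 2" "2 * k + 2 \<noteq> 2 * k' + 1"
          by presburger+
        have "a (2 * k + 1) = a (2 * k' + 1) \<longleftrightarrow> k = k'" "a (2 * k + 2) = a (2 * k' + 2) \<longleftrightarrow> k = k'"
            "a (2 * k + 1) \<noteq> a (2 * k' + 2)" "a (2 * k + 2) \<noteq> a (2 * k' + 1)"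
          using k(1,3) a_eq[of "2 * k + 1" "2 * k' + 1"] a_eq[of "2 * k + 2" "2 * k' + 1"]
            a_eq[of "2 * k + 1" "2 * k' + 2"] a_eq[of "2 * k + 2" "2 * k' + 2"] parity by simp_all
        then show "r = r'"
          using k(2,4) r(3) ltr[of k] ltr[of k'] by (elim disjE) (simp_all only: prod.inject, simp_all)
      qed
      show "ltr ` {1..int (4 * m)} = a ` {1..2 * m} \<times> UNIV"
      proof
        have "ltr r \<in> a ` {1..2 * m} \<times> UNIV" if "r \<in> {1..int (4 * m)}" for r
          using split[OF that] by (auto simp: ltr)
        then show "ltr ` {1..int (4 * m)} \<subseteq> a ` {1..2 * m} \<times> UNIV"
          by blast
        have "(a i, b) \<in> ltr ` {1..int (4 * m)}" if i: "i \<in> {1..2 * m}" for i b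
        proof -
          define k where "k = (i - 1) div 2"
          have k: "k < m" "i = 2 * k + 1 \<or> i = 2 * k + 2"
            using i by (auto simp: k_def)
          then have "4 * int k + 1 \<in> {1..int (4 * m)}" "4 * int k + 2 \<in> {1..int (4 * m)}"
            "4 * int k + 3 \<in> {1..int (4 * m)}" "4 * int k + 4 \<in> {1..int (4 * m)}"
            by auto
          from this[THEN imageI, of ltr] show ?thesis
            using k(2) unfolding ltr by (cases b) auto
        qed
        then show "a ` {1..2 * m} \<times> UNIV \<subseteq> ltr ` {1..int (4 * m)}"
          by auto
      qed
    qed
    show "ltr (bar r) = (fst (ltr r), \<not> snd (ltr r))" if "r \<in> {1..int (4 * m)}" for r
      using split[OF that] by (auto simp: ltr bar)
    show "bar r \<in> {1..int (4 * m)}" if "r \<in> {1..int (4 * m)}" for r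
      using split[OF that] by (auto simp: bar)
    show "bar 0 = int (4 * m) + 1" "bar (int (4 * m) + 1) = 0" "sg 0 = 1" "sg (int (4 * m) + 1) = 1"
      by (auto simp: bar_def sg_def)
    show "(sg r = 1 \<or> sg r = -1) \<and> sg (bar r) = sg r" if "r \<in> {1..int (4 * m)}" for r
      by (simp add: sg_def)
    show "d 0 = (1, 1)" "d (4 * m) = (int (4 * m) + 1, 1)"
      by (auto simp: d_def)
    show "fst (d i) \<in> {1..int (4 * m)} \<and> (snd (d i) = 1 \<or> snd (d i) = -1)" if "i < 4 * m" for i
    proof -
      from dsplit[OF that] obtain k where "k < m" "i = 4 * k \<or> i = 4 * k + 1 \<or> i = 4 * k + 2 \<or> i = 4 * k + 3"
        by blast
      then show ?thesis
        by (elim disjE) (simp_all only: d, simp_all)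
    qed
    show "turn (cross bar sg (d i)) = d (Suc i)" if "i < 4 * m" for i
    proof -
      from dsplit[OF that] obtain k
        where k: "k < m" "i = 4 * k \<or> i = 4 * k + 1 \<or> i = 4 * k + 2 \<or> i = 4 * k + 3"
        by blast
      have "Suc (4 * k) = 4 * k + 1" "Suc (4 * k + 1) = 4 * k + 2" "Suc (4 * k + 2) = 4 * k + 3"
          "Suc (4 * k + 3) = 4 * (k + 1)"
        by auto
      then show ?thesis
        using k(2) bar[OF k(1)] d[of k] d[of "k + 1"] by (elim disjE) (simp_all only:, simp_all add: turn_def cross_def sg_def)
    qed
    show "\<exists>i<4 * m. (r, e) = d i \<or> (r, e) = mirror bar sg (d i)"
      if r: "r \<in> {1..int (4 * m)}" "e = 1 \<or> e = -1" for r e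
    proof -
      obtain k where k: "k < m" "r = 4 * int k + 1 \<or> r = 4 * int k + 2 \<or> r = 4 * int k + 3 \<or> r = 4 * int k + 4"
        using split[OF r(1)] by blast
      have mir: "mirror bar sg (d (4 * k)) = (4 * int k + 3, -1)" "mirror bar sg (d (4 * k + 1)) = (4 * int k + 2, -1)"
          "mirror bar sg (d (4 * k + 2)) = (4 * int k + 1, -1)" "mirror bar sg (d (4 * k + 3)) = (4 * int k + 4, -1)"
        unfolding d by (simp_all add: mirror_def sg_def bar[OF k(1)])
      have "4 * k < 4 * m" "4 * k + 1 < 4 * m" "4 * k + 2 < 4 * m" "4 * k + 3 < 4 * m"
        using k(1) by auto
      then show ?thesis
        using k(2) r(2) d[of k] mir by metis
    qed
    have word: "map (\<lambda>i. letter_val G (ltr (fst (d i)))) [0..<4 * m] =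
        concat (map (\<lambda>b. [a (2 * b + 1), a (2 * b + 2), inv\<^bsub>G\<^esub> a (2 * b + 1), inv\<^bsub>G\<^esub> a (2 * b + 2)]) [0..<m])"
    proof -
      have "[0..<4] = [0, 1, 2, 3::nat]"
        by (simp add: upt_rec)
      then have "map (\<lambda>i. letter_val G (ltr (fst (d (4 * b + i))))) [0..<4] =
          [a (2 * b + 1), a (2 * b + 2), inv\<^bsub>G\<^esub> a (2 * b + 1), inv\<^bsub>G\<^esub> a (2 * b + 2)]" for b
        using d[of b] ltr[of b] by (simp add: letter_val_def)
      then show ?thesis
        unfolding map_upt_concat by simp
    qed
    have closed: "set [a (2 * b + 1), a (2 * b + 2), inv\<^bsub>G\<^esub> a (2 * b + 1), inv\<^bsub>G\<^esub> a (2 * b + 2)] \<subseteq> carrier G"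
      if "b \<in> set [0..<m]" for b
      using a[of "2 * b + 1"] a[of "2 * b + 2"] that by simp
    have "list_prod G (map (\<lambda>i. letter_val G (ltr (fst (d i)))) [0..<4 * m]) =
        list_prod G (map (\<lambda>b. list_prod G [a (2 * b + 1), a (2 * b + 2), inv\<^bsub>G\<^esub> a (2 * b + 1), inv\<^bsub>G\<^esub> a (2 * b + 2)]) [0..<m])"
      unfolding word by (rule list_prod_concat_map) (rule closed)
    also have "map (\<lambda>b. list_prod G [a (2 * b + 1), a (2 * b + 2), inv\<^bsub>G\<^esub> a (2 * b + 1), inv\<^bsub>G\<^esub> a (2 * b + 2)]) [0..<m] =
        map (\<lambda>b. commutator G (a (2 * b + 1)) (a (2 * b + 2))) [0..<m]"
      using a by (auto simp: commutator_def m_assoc)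
    also have "\<dots> = map (\<lambda>j. commutator G (a (2 * j - 1)) (a (2 * j))) (map (\<lambda>i. i + 1) [0..<m])"
      by (simp add: comp_def)
    also have "map (\<lambda>i. i + 1) [0..<m] = [1..<m + 1]"
      by (rule map_add_upt)
    finally show "s = list_prod G (map (\<lambda>i. letter_val G (ltr (fst (d i)))) [0..<4 * m])"
      by (simp add: s)
  qed
  show ?thesis
    using outerplanar_Cay unfolding labels .
qed

theorem theorem1p18:
  fixes G :: "('g, 'm) monoid_scheme" and a :: "nat \<Rightarrow> 'g" and A :: "'g set"
    and n :: nat and s :: 'g
  assumes "n \<ge> 2"
    and "group G"
    and "inj_on a {1..n}" and "A = a ` {1..n}"
    and "free_basis G A"
    and "s = list_prod G (map (\<lambda>i. a i [^]\<^bsub>G\<^esub> (2::nat)) [1..<n + 1]) \<or>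
         even n \<and> s = list_prod G (map (\<lambda>j. commutator G (a (2 * j - 1)) (a (2 * j))) [1..<n div 2 + 1])"
  shows "outerplanar (Cay G (A \<union> (\<lambda>x. inv\<^bsub>G\<^esub> x) ` A \<union> {s, inv\<^bsub>G\<^esub> s}))"
  using assms(6)
proof
  assume "s = list_prod G (map (\<lambda>i. a i [^]\<^bsub>G\<^esub> (2::nat)) [1..<n + 1])"
  then show ?thesis
    using outerplanar_squares[of n G a s] assms(1-5) by simp
next
  assume s: "even n \<and> s = list_prod G (map (\<lambda>j. commutator G (a (2 * j - 1)) (a (2 * j))) [1..<n div 2 + 1])"
  then obtain m where "n = 2 * m"
    by blast
  then show ?thesis
    using outerplanar_commutators[of m G a s] s assms(1-5) by simp
qed

end
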